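(* Let $K$ be a totally real cubic field with fundamental discriminant $d$, and let $d_{3} := -\frac{3d}{\gcd(3,d)^2}$. Let $f_{K}(z)= \sum_{x \in O_{K}^{0}} q^{\mathrm{t}_{K}(x)}$, where $q=e^{2\pi i z}$ with $z$ in the upper half plane, $O_K^0$ is the set of algebraic integers of $K$ with trace zero, and $\mathrm{t}_K(x)=\frac{\mathrm{tr}_{K/\mathbb{Q}}(x^2)}{2\gcd(3,d)}$. Then $$f_{K} \in \mathcal{M}_{1}\left(\Gamma_{0}(|d_{3}|), \left( \frac{d_{3}}{\cdot} \right)\right).$$
   Context: An integer is called a fundamental discriminant if it is equal to the discriminant of a quadratic number field. The integer $d_3$ is called the $3$-reflection of $d$. For a cubic field $K$ of fundamental discriminant $d$, $O^{0}_K=\{x\in O_K : \mathrm{tr}_{K/\mathbb{Q}}(x)=0\}$ is a free $\mathbb{Z}$-module of rank 2, and $\mathrm{t}_K$ is the quadratic form on $O_K^0$ given by $\mathrm{t}_K(x)=\mathrm{tr}_{K/\mathbb{Q}}(x^2)/(2\gcd(3,d))$. $\mathcal{M}_{1}(\Gamma_{0}(N),\epsilon)$ denotes the space of weight $1$ modular forms of level $N$ and nebentypus $\epsilon$ (a Dirichlet character modulo $N$); $\left(\frac{d_3}{\cdot}\right)$ is the Kronecker symbol. *)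

theory Defs
  imports
    "HOL-Complex_Analysis.Complex_Analysis"
    "HOL-Number_Theory.Number_Theory"
    "Jordan_Normal_Form.Determinant"
begin

interpretation rat_vs: vector_space "\<lambda>(q::rat) (x::'a::field_char_0). of_rat q * x"
  by unfold_locales (simp_all add: algebra_simps of_rat_add of_rat_mult)

interpretation int_mod: Modules.module "\<lambda>(m::int) (x::'a::field_char_0). of_int m * x"
  by unfold_locales (simp_all add: algebra_simps)


section \<open>Number fields\<close>

text \<open>
  Number fields are represented as subsets of an arbitrary ambient field of characteristic
  zero. An abstract number field is the case where the subset is all of \<^term>\<open>UNIV\<close>.
\<close>

definition is_subfield :: "'a::field_char_0 set \<Rightarrow> bool" where
  "is_subfield K \<longleftrightarrow>
     0 \<in> K \<and> 1 \<in> K \<and> (\<forall>x\<in>K. \<forall>y\<in>K. x - y \<in> K \<and> x * y \<in> K \<and> x / y \<in> K)"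

definition number_field :: "'a::field_char_0 set \<Rightarrow> bool" where
  "number_field K \<longleftrightarrow> is_subfield K \<and> (\<exists>B. finite B \<and> K \<subseteq> rat_vs.span B)"

definition field_degree :: "'a::field_char_0 set \<Rightarrow> nat" where
  "field_degree K = rat_vs.dim K"

definition complex_embedding :: "'a::field_char_0 set \<Rightarrow> ('a \<Rightarrow> complex) \<Rightarrow> bool" where
  "complex_embedding K \<sigma> \<longleftrightarrow>
     \<sigma> 1 = 1 \<and> (\<forall>x\<in>K. \<forall>y\<in>K. \<sigma> (x + y) = \<sigma> x + \<sigma> y \<and> \<sigma> (x * y) = \<sigma> x * \<sigma> y)"

definition totally_real :: "'a::field_char_0 set \<Rightarrow> bool" where
  "totally_real K \<longleftrightarrow> (\<forall>\<sigma>. complex_embedding K \<sigma> \<longrightarrow> \<sigma> ` K \<subseteq> \<real>)"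

definition rat_basis :: "'a::field_char_0 set \<Rightarrow> 'a set \<Rightarrow> bool" where
  "rat_basis K B \<longleftrightarrow> B \<subseteq> K \<and> rat_vs.independent B \<and> K \<subseteq> rat_vs.span B"

text \<open>
  The trace of \<open>x\<close> is the trace of the \<open>\<rat>\<close>-linear map \<open>y \<mapsto> x y\<close> on \<open>K\<close>, i.e. the sum of the
  diagonal entries of its matrix in a basis; it does not depend on the chosen basis.
\<close>

definition field_trace :: "'a::field_char_0 set \<Rightarrow> 'a \<Rightarrow> rat" where
  "field_trace K x =
     (let B = (SOME B. rat_basis K B) in \<Sum>b\<in>B. rat_vs.representation B (x * b) b)"

definition ring_of_integers :: "'a::field_char_0 set \<Rightarrow> 'a set" where
  "ring_of_integers K = {x \<in> K. algebraic_int x}"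

definition integral_basis :: "'a::field_char_0 set \<Rightarrow> 'a list \<Rightarrow> bool" where
  "integral_basis K bs \<longleftrightarrow>
     distinct bs \<and> int_mod.independent (set bs) \<and> int_mod.span (set bs) = ring_of_integers K"

definition trace_matrix :: "'a::field_char_0 set \<Rightarrow> 'a list \<Rightarrow> rat mat" where
  "trace_matrix K bs =
     Matrix.mat (length bs) (length bs) (\<lambda>(i, j). field_trace K (bs ! i * bs ! j))"

definition field_discr :: "'a::field_char_0 set \<Rightarrow> int" where
  "field_discr K =
     (THE D. \<exists>bs. integral_basis K bs \<and> of_int D = Determinant.det (trace_matrix K bs))"

text \<open>Every quadratic field embeds into \<open>\<complex>\<close>, so it suffices to consider subfields of \<open>\<complex>\<close>.\<close>

definition fundamental_discriminant :: "int \<Rightarrow> bool" where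
  "fundamental_discriminant d \<longleftrightarrow>
     (\<exists>F :: complex set. number_field F \<and> field_degree F = 2 \<and> d = field_discr F)"

definition trace_zero_integers :: "'a::field_char_0 set \<Rightarrow> 'a set" where
  "trace_zero_integers K = {x \<in> ring_of_integers K. field_trace K x = 0}"

definition trace_form :: "'a::field_char_0 set \<Rightarrow> 'a \<Rightarrow> rat" where
  "trace_form K x = field_trace K (x\<^sup>2) / of_int (2 * gcd 3 (field_discr K))"

definition trace_theta :: "'a::field_char_0 set \<Rightarrow> complex \<Rightarrow> complex" where
  "trace_theta K z =
     (\<Sum>\<^sub>\<infinity>x\<in>trace_zero_integers K. exp (2 * of_real pi * \<i> * of_rat (trace_form K x) * z))"


section \<open>The Kronecker symbol\<close>

definition kronecker_prime :: "int \<Rightarrow> int \<Rightarrow> int" where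
  "kronecker_prime a p =
     (if p = 2 then (if even a then 0 else if a mod 8 \<in> {1, 7} then 1 else -1)
      else Legendre a p)"

definition kronecker :: "int \<Rightarrow> int \<Rightarrow> int" where
  "kronecker a n =
     (if n = 0 then (if \<bar>a\<bar> = 1 then 1 else 0)
      else (if a < 0 \<and> n < 0 then -1 else 1) *
           (\<Prod>p\<in>prime_factors n. kronecker_prime a p ^ multiplicity p n))"


section \<open>Modular forms with character\<close>

definition upper_half_plane :: "complex set" where
  "upper_half_plane = {z. Im z > 0}"

text \<open>A quadruple \<open>(a, b, c, d)\<close> stands for the matrix with rows \<open>(a, b)\<close> and \<open>(c, d)\<close>.\<close>

type_synonym imat2 = "int \<times> int \<times> int \<times> int"

definition SL2Z :: "imat2 set" where
  "SL2Z = {(a, b, c, d). a * d - b * c = 1}"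

definition Gamma0 :: "int \<Rightarrow> imat2 set" where
  "Gamma0 N = {(a, b, c, d) \<in> SL2Z. N dvd c}"

definition moebius_act :: "imat2 \<Rightarrow> complex \<Rightarrow> complex" where
  "moebius_act = (\<lambda>(a, b, c, d) z. (of_int a * z + of_int b) / (of_int c * z + of_int d))"

definition automorphy :: "imat2 \<Rightarrow> complex \<Rightarrow> complex" where
  "automorphy = (\<lambda>(a, b, c, d) z. of_int c * z + of_int d)"

definition slash :: "int \<Rightarrow> (complex \<Rightarrow> complex) \<Rightarrow> imat2 \<Rightarrow> complex \<Rightarrow> complex" where
  "slash k f \<gamma> z = automorphy \<gamma> z powi (-k) * f (moebius_act \<gamma> z)"

text \<open>
  The space \<open>M\<^sub>k(\<Gamma>\<^sub>0(N), \<epsilon>)\<close>, where \<open>\<epsilon>\<close> is meant to be a Dirichlet character modulo \<open>N\<close>, viewed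
  as a function on the integers. Holomorphy at the cusps is the boundedness of every \<open>f |\<^sub>k \<gamma>\<close>,
  \<open>\<gamma> \<in> SL\<^sub>2(\<int>)\<close>, as \<open>Im z \<longlongrightarrow> \<infinity>\<close>. The values of \<open>f\<close> outside of the upper half plane are
  irrelevant.
\<close>

definition modular_forms :: "int \<Rightarrow> int \<Rightarrow> (int \<Rightarrow> complex) \<Rightarrow> (complex \<Rightarrow> complex) set" where
  "modular_forms k N \<epsilon> =
     {f. f holomorphic_on upper_half_plane \<and>
         (\<forall>(a, b, c, d) \<in> Gamma0 N. \<forall>z\<in>upper_half_plane.
            f (moebius_act (a, b, c, d) z) =
              \<epsilon> d * automorphy (a, b, c, d) z powi k * f z) \<and>
         (\<forall>\<gamma>\<in>SL2Z. Bfun (slash k f \<gamma>) (filtercomap Im at_top))}"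

end

theory Submission
  imports Defs "HOL-Probability.Probability" "Jordan_Normal_Form.Schur_Decomposition"
begin

text \<open>
  Extending a \<open>\<int>\<close>-basis \<open>e\<^sub>1, e\<^sub>2\<close> of the trace zero integers to an integral basis of \<open>K\<close> by an
  element of trace 1 shows that the Gram determinant of \<open>e\<^sub>1, e\<^sub>2\<close> is \<open>3 d\<close>, so
  \<open>t\<^sub>K\<close> is an integral positive definite binary form \<open>a x\<^sup>2 + b x y + c y\<^sup>2\<close> of discriminant \<open>d\<^sub>3\<close>.
  (An element of trace 1 exists because a fundamental discriminant is not divisible by 27.)
  For \<open>(\<alpha>, \<beta>, \<gamma>, \<delta>) \<in> \<Gamma>\<^sub>0(|d\<^sub>3|)\<close> with \<open>\<delta> > 0\<close>, splitting the theta series of the form into residue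
  classes modulo \<open>\<delta>\<close> and applying two-dimensional Poisson summation to each class yields the
  transformation law with the factor \<open>G(\<beta>, \<delta>) / \<delta>\<close>, where \<open>G\<close> is the Gauss sum
  of the form. It equals the Kronecker symbol \<open>(d\<^sub>3 / \<delta>)\<close>: squares of primes drop out of \<open>\<delta>\<close>,
  and modulo an odd prime one completes the square. The same summation at an arbitrary cusp gives boundedness.
\<close>

text \<open>For the transformation law the theta series is expanded at \<beta>/\<delta>, the image
  of 0, and not at the image of infinity. Poisson summation there produces the dual form (c, -b,
  a)/N with Gauss sums twisted by linear terms as coefficients. As N divides \<gamma>, the relation
  \<alpha> \<delta> - \<beta> \<gamma> = 1 makes N invertible modulo \<delta>, and completing the
  square turns each twist into a phase times the untwisted sum. With t the distance from
  \<beta>/\<delta>, the dual variable is -1/(\<delta>^2 t) = -\<gamma>/\<delta> - 1/z, and its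
  rational part cancels exactly that phase. What remains is the dual expansion of the theta series
  at z itself, so the same form comes back and not its dual. Total reality enters at one place: it
  makes the trace form positive definite on elements of trace zero, on which convergence, the
  existence of a lattice basis and the sign of the discriminant all rest.\<close>

text \<open>
  The interpreted simp rules \<open>scale_scale\<close> rewrite \<open>of_int a * (of_int b * x)\<close> to
  \<open>of_int (a * b) * x\<close>, which loops with \<open>of_int_mult\<close> and \<open>mult.assoc\<close>.
\<close>

declare int_mod.scale_scale [simp del] rat_vs.scale_scale [simp del]

section \<open>Poisson summation\<close>

lemma periodic_int:
  fixes h :: "real \<Rightarrow> 'b"
  assumes "\<And>x. h (x + 1) = h x"
  shows "h (x + of_int n) = h x"
proof (induction n rule: int_induct[where k = 0])
  case (step1 i)
  have "h (x + of_int (i + 1)) = h ((x + of_int i) + 1)" by (simp add: algebra_simps)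
  then show ?case using assms step1 by simp
next
  case (step2 i)
  have "h (x + of_int i) = h ((x + of_int (i - 1)) + 1)" by (simp add: algebra_simps)
  then show ?case using assms[of "x + of_int (i - 1)"] step2 by simp
qed simp

text \<open>Orthogonality to all characters of the circle. The class of such functions is closed
  under multiplication by trigonometric polynomials, which is what a density argument needs.\<close>

definition fourier_coeffs_vanish :: "(real \<Rightarrow> complex) \<Rightarrow> bool" where
  "fourier_coeffs_vanish h \<longleftrightarrow>
     continuous_on UNIV h \<and> (\<forall>m::int. integral {0..1} (\<lambda>x. h x * cis (2 * pi * of_int m * x)) = 0)"

lemma fourier_coeffs_vanish_add:
  assumes "fourier_coeffs_vanish f" "fourier_coeffs_vanish g"
  shows "fourier_coeffs_vanish (\<lambda>x. f x + g x)"
proof -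
  have c: "continuous_on UNIV f" "continuous_on UNIV g"
    using assms by (auto simp: fourier_coeffs_vanish_def)
  have i: "(\<lambda>x. f x * cis (2 * pi * of_int m * x)) integrable_on {0..1}"
          "(\<lambda>x. g x * cis (2 * pi * of_int m * x)) integrable_on {0..1}" for m
    by (intro integrable_continuous_real continuous_intros continuous_on_subset[OF c(1)]
        continuous_on_subset[OF c(2)]; simp)+
  show ?thesis
    using assms c integral_add[OF i]
    by (auto simp: fourier_coeffs_vanish_def ring_distribs intro!: continuous_intros)
qed

lemma fourier_coeffs_vanish_cmult:
  assumes "fourier_coeffs_vanish f"
  shows "fourier_coeffs_vanish (\<lambda>x. c * f x)"
  using assms by (auto simp: fourier_coeffs_vanish_def mult.assoc intro!: continuous_intros)

lemma fourier_coeffs_vanish_cis: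
  assumes "fourier_coeffs_vanish f"
  shows "fourier_coeffs_vanish (\<lambda>x. f x * cis (2 * pi * of_int k * x))"
proof -
  have "integral {0..1} (\<lambda>x. f x * cis (2 * pi * of_int k * x) * cis (2 * pi * of_int m * x)) = 0" for m
  proof -
    have "cis (2 * pi * of_int k * x) * cis (2 * pi * of_int m * x) = cis (2 * pi * of_int (k + m) * x)" for x
      by (simp add: cis_mult algebra_simps)
    then have "f x * cis (2 * pi * of_int k * x) * cis (2 * pi * of_int m * x) =
        f x * cis (2 * pi * of_int (k + m) * x)" for x
      by (simp only: mult.assoc[of "f x"])
    then show ?thesis using assms by (simp only: fourier_coeffs_vanish_def)
  qed
  then show ?thesis using assms
    by (auto simp: fourier_coeffs_vanish_def intro!: continuous_intros)
qed

text \<open>Cosine and sine are combinations of the characters for 1 and -1; they are the coordinate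
  functions from which polynomials on the circle are built.\<close>

lemma fourier_coeffs_vanish_Re_Im:
  assumes "fourier_coeffs_vanish f"
  shows "fourier_coeffs_vanish (\<lambda>x. f x * of_real (Re (cis (2 * pi * x))))"
        "fourier_coeffs_vanish (\<lambda>x. f x * of_real (Im (cis (2 * pi * x))))"
proof -
  have 1: "f x * of_real (Re (cis (2 * pi * x))) =
      (1/2) * (f x * cis (2 * pi * of_int 1 * x)) + (1/2) * (f x * cis (2 * pi * of_int (-1) * x))" for x
    by (simp add: complex_eq_iff field_simps)
  have 2: "f x * of_real (Im (cis (2 * pi * x))) =
      (-\<i>/2) * (f x * cis (2 * pi * of_int 1 * x)) + (\<i>/2) * (f x * cis (2 * pi * of_int (-1) * x))" for x
    by (simp add: complex_eq_iff field_simps)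
  show "fourier_coeffs_vanish (\<lambda>x. f x * of_real (Re (cis (2 * pi * x))))"
    unfolding 1 by (intro fourier_coeffs_vanish_add fourier_coeffs_vanish_cmult fourier_coeffs_vanish_cis assms)
  show "fourier_coeffs_vanish (\<lambda>x. f x * of_real (Im (cis (2 * pi * x))))"
    unfolding 2 by (intro fourier_coeffs_vanish_add fourier_coeffs_vanish_cmult fourier_coeffs_vanish_cis assms)
qed

text \<open>Polynomials in the two real coordinates restrict to trigonometric polynomials on the
  unit circle. This is the shape in which Stone-Weierstrass supplies approximants.\<close>

lemma fourier_coeffs_vanish_polynomial:
  assumes "real_polynomial_function p" "fourier_coeffs_vanish f"
  shows "fourier_coeffs_vanish (\<lambda>x. f x * of_real (p (cis (2 * pi * x))))"
  using assms
proof (induction arbitrary: f rule: real_polynomial_function.induct)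
  case (linear p)
  have "p z = Re z * p 1 + Im z * p \<i>" if "z = cis (2 * pi * x)" for z x
  proof -
    have "z = Re z *\<^sub>R 1 + Im z *\<^sub>R \<i>" by (simp add: complex_eq_iff)
    then have "p z = p (Re z *\<^sub>R 1 + Im z *\<^sub>R \<i>)" by (rule arg_cong)
    also have "\<dots> = Re z *\<^sub>R p 1 + Im z *\<^sub>R p \<i>"
      by (simp only: linear_simps[OF linear.hyps])
    finally show ?thesis by simp
  qed
  note p = this[OF refl]
  have "f x * of_real (p (cis (2 * pi * x))) =
      of_real (p 1) * (f x * of_real (Re (cis (2 * pi * x)))) +
      of_real (p \<i>) * (f x * of_real (Im (cis (2 * pi * x))))" for x
    by (subst p) (simp add: algebra_simps)
  then show ?case
    using fourier_coeffs_vanish_add[OF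
        fourier_coeffs_vanish_cmult[OF fourier_coeffs_vanish_Re_Im(1)[OF linear.prems]]
        fourier_coeffs_vanish_cmult[OF fourier_coeffs_vanish_Re_Im(2)[OF linear.prems]], of "of_real (p 1)" "of_real (p \<i>)"]
    by (simp only:)
next
  case (const c)
  then show ?case using fourier_coeffs_vanish_cmult[of f "of_real c"] by (simp add: mult.commute)
next
  case (add p q)
  show ?case
    using fourier_coeffs_vanish_add[OF add.IH(1)[OF add.prems] add.IH(2)[OF add.prems]]
    by (simp add: ring_distribs)
next
  case (mult p q)
  have "fourier_coeffs_vanish (\<lambda>x. (f x * of_real (p (cis (2 * pi * x)))) * of_real (q (cis (2 * pi * x))))"
    by (intro mult.IH mult.prems)
  then show ?case by (simp add: mult.assoc)
qed

text \<open>Transports a function of period 1 to the compact circle, where Stone-Weierstrass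
  applies. \<open>Arg\<close> jumps along the negative real axis; near that axis it is exchanged for
  \<open>Arg2pi\<close>, continuous off the nonnegative axis, and periodicity hides the difference
  by a multiple of 2 pi.\<close>

lemma continuous_on_circle_lift:
  fixes h :: "real \<Rightarrow> 'b :: metric_space"
  assumes cont: "continuous_on UNIV h" and per: "\<And>x. h (x + 1) = h x"
  shows "continuous_on (sphere 0 1) (\<lambda>z. h (Arg z / (2 * pi)))"
    and "h (Arg (cis (2 * pi * x)) / (2 * pi)) = h x"
proof -
  have cong: "h (s / (2 * pi)) = h (t / (2 * pi))" if "cis s = cis t" for s t
  proof -
    have "exp (of_real s * \<i>) = exp (of_real t * \<i>)" using that by (simp add: cis_conv_exp mult.commute)
    then obtain n :: int where "of_real s * \<i> = of_real t * \<i> + (of_int (2 * n) * pi) * \<i>"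
      unfolding exp_eq by auto
    then have "s = t + of_int n * (2 * pi)" by (simp add: complex_eq_iff)
    then have "s / (2 * pi) = t / (2 * pi) + of_int n" by (simp add: field_simps)
    then show ?thesis using periodic_int[of h, OF per] by simp
  qed
  show "h (Arg (cis (2 * pi * x)) / (2 * pi)) = h x"
    using cong[of "Arg (cis (2 * pi * x))" "2 * pi * x"] cis_Arg[of "cis (2 * pi * x)"]
    by (simp add: sgn_div_norm)
  have alt: "h (Arg z / (2 * pi)) = h (Arg2pi z / (2 * pi))" if "z \<noteq> 0" for z
  proof (rule cong)
    have "of_real (cmod z) * cis (Arg z) = of_real (cmod z) * cis (Arg2pi z)"
      using Arg2pi_eq[of z] cis_Arg[OF that] that
      by (simp add: cis_conv_exp sgn_div_norm field_simps scaleR_conv_of_real)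
    then show "cis (Arg z) = cis (Arg2pi z)" using that by simp
  qed
  have contc: "isCont (\<lambda>x. h (x / (2 * pi))) y" for y
    by (rule continuous_on_interior[of UNIV])
       (auto intro!: continuous_intros continuous_on_compose2[OF cont])
  have "isCont (\<lambda>z. h (Arg z / (2 * pi))) z" if "z \<noteq> 0" for z
  proof (cases "z \<in> \<real>\<^sub>\<le>\<^sub>0")
    case False
    show ?thesis
      by (rule isCont_o2[OF continuous_at_Arg[OF False] contc])
  next
    case True
    then have "z \<notin> \<real>\<^sub>\<ge>\<^sub>0" using \<open>z \<noteq> 0\<close>
      by (auto simp: complex_nonneg_Reals_iff complex_nonpos_Reals_iff complex_eq_iff)
    then have "isCont (\<lambda>z. h (Arg2pi z / (2 * pi))) z"
      by (intro isCont_o2[OF continuous_at_Arg2pi contc])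
    moreover have "eventually (\<lambda>z. h (Arg z / (2 * pi)) = h (Arg2pi z / (2 * pi))) (nhds z)"
      using t1_space_nhds[OF \<open>z \<noteq> 0\<close>] by eventually_elim (rule alt)
    ultimately show ?thesis using isCont_cong[of "\<lambda>z. h (Arg z / (2 * pi))" "\<lambda>z. h (Arg2pi z / (2 * pi))" z]
      by simp
  qed
  moreover have "z \<noteq> 0" if "z \<in> sphere 0 1" for z :: complex
    using that by auto
  ultimately show "continuous_on (sphere 0 1) (\<lambda>z. h (Arg z / (2 * pi)))"
    by (simp add: continuous_at_imp_continuous_on)
qed

text \<open>If a trigonometric polynomial \<open>G\<close> is within \<open>e\<close> of the
  conjugate of \<open>h\<close>, then the integral of \<open>h * G\<close> vanishes, so the integral
  of |h|^2 equals that of \<open>h * (cnj h - G)\<close> and is at most \<open>e * M\<close>.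
  Letting \<open>e\<close> tend to 0 gives \<open>h = 0\<close> on the unit interval, and
  periodicity does the rest.\<close>

lemma fourier_unique:
  assumes v: "fourier_coeffs_vanish h" and per: "\<And>x. h (x + 1) = h x"
  shows "h x = 0"
proof -
  have cont: "continuous_on UNIV h" using v by (simp add: fourier_coeffs_vanish_def)
  then have c: "continuous_on {0..1} h" by (rule continuous_on_subset) simp
  define J where "J = integral {0..1} (\<lambda>x. (cmod (h x))\<^sup>2)"
  define M where "M = integral {0..1} (\<lambda>x. cmod (h x))"
  have "J \<ge> 0" unfolding J_def by (intro integral_nonneg integrable_continuous_real continuous_intros c) auto
  have "M \<ge> 0" unfolding M_def by (intro integral_nonneg integrable_continuous_real continuous_intros c) auto
  have bound: "J \<le> e * M" if "e > 0" for e
  proof -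
    have cc: "continuous_on UNIV (\<lambda>x. cnj (h x))" by (intro continuous_intros cont)
    have cc': "continuous_on (sphere 0 1) (\<lambda>z. cnj (h (Arg z / (2 * pi))))"
      by (rule continuous_on_circle_lift(1)[of "\<lambda>x. cnj (h x)", OF cc]) (simp add: per)
    obtain g where g: "polynomial_function g"
      and gh: "\<And>z. z \<in> sphere 0 1 \<Longrightarrow> norm (cnj (h (Arg z / (2 * pi))) - g z) < e"
      using Stone_Weierstrass_polynomial_function[OF compact_sphere cc' \<open>e > 0\<close>] by auto
    define G where "G x = g (cis (2 * pi * x))" for x :: real
    have gG: "cmod (cnj (h x) - G x) \<le> e" for x
      using gh[of "cis (2 * pi * x)"] continuous_on_circle_lift(2)[of h x, OF cont per]
      by (simp add: G_def)
    have rp: "real_polynomial_function (\<lambda>z. Re (g z))" "real_polynomial_function (\<lambda>z. Im (g z))"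
      using g[unfolded polynomial_function_def, rule_format, OF bounded_linear_Re]
        g[unfolded polynomial_function_def, rule_format, OF bounded_linear_Im] by (simp_all add: o_def)
    have "fourier_coeffs_vanish (\<lambda>x. h x * of_real (Re (G x)) + \<i> * (h x * of_real (Im (G x))))"
      unfolding G_def
      by (rule fourier_coeffs_vanish_add[OF rp(1)[THEN fourier_coeffs_vanish_polynomial, OF v]
        fourier_coeffs_vanish_cmult[OF rp(2)[THEN fourier_coeffs_vanish_polynomial, OF v]]])
    moreover have "h x * of_real (Re (G x)) + \<i> * (h x * of_real (Im (G x))) = h x * G x" for x
      by (simp add: complex_eq_iff)
    ultimately have fG: "fourier_coeffs_vanish (\<lambda>x. h x * G x)" by simp
    then have 0: "integral {0..1} (\<lambda>x. h x * G x) = 0"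
      unfolding fourier_coeffs_vanish_def by (elim conjE allE[of _ 0]) simp
    have i1: "(\<lambda>x. h x * G x) integrable_on {0..1}"
      using fG unfolding fourier_coeffs_vanish_def
      by (intro integrable_continuous_real) (auto intro: continuous_on_subset)
    have i2: "(\<lambda>x. h x * cnj (h x)) integrable_on {0..1}"
      by (intro integrable_continuous_real continuous_intros c)
    have "complex_of_real J = integral {0..1} (\<lambda>x. of_real ((cmod (h x))\<^sup>2))"
      unfolding J_def using integral_linear[of "\<lambda>x. (cmod (h x))\<^sup>2" "{0..1}" "of_real :: real \<Rightarrow> complex"] c
      by (simp only: o_def integrable_continuous_real continuous_intros bounded_linear_of_real)
    also have "\<dots> = integral {0..1} (\<lambda>x. h x * cnj (h x))"
      by (simp only: complex_norm_square)
    also have "\<dots> = integral {0..1} (\<lambda>x. h x * cnj (h x) - h x * G x)"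
      using integral_diff[OF i2 i1] 0 by simp
    finally have J: "complex_of_real J = integral {0..1} (\<lambda>x. h x * cnj (h x) - h x * G x)" .
    have "cmod (integral {0..1} (\<lambda>x. h x * cnj (h x) - h x * G x)) \<le> integral {0..1} (\<lambda>x. e * cmod (h x))"
    proof (rule integral_norm_bound_integral)
      show "(\<lambda>x. h x * cnj (h x) - h x * G x) integrable_on {0..1}"
        by (intro integrable_diff i1 i2)
      show "(\<lambda>x. e * cmod (h x)) integrable_on {0..1}"
        by (intro integrable_continuous_real continuous_intros c)
      show "cmod (h x * cnj (h x) - h x * G x) \<le> e * cmod (h x)" for x
      proof -
        have "h x * cnj (h x) - h x * G x = h x * (cnj (h x) - G x)" by (simp add: algebra_simps)
        then have "cmod (h x * cnj (h x) - h x * G x) = cmod (h x) * cmod (cnj (h x) - G x)"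
          by (simp add: norm_mult)
        then show ?thesis using mult_left_mono[OF gG norm_ge_zero] by (simp add: mult.commute)
      qed
    qed
    then have "cmod (complex_of_real J) \<le> e * M" unfolding J M_def by simp
    then show "J \<le> e * M" using \<open>J \<ge> 0\<close> by simp
  qed
  have "J \<le> 0"
  proof (rule field_le_epsilon)
    fix e :: real assume "e > 0"
    \<comment> \<open>Dividing by \<open>M + 1\<close> keeps the choice valid when
      \<open>M = 0\<close>.\<close>
    have "J \<le> (e / (M + 1)) * M" using \<open>e > 0\<close> \<open>M \<ge> 0\<close> by (intro bound) auto
    also have "\<dots> \<le> 0 + e" using \<open>e > 0\<close> \<open>M \<ge> 0\<close> by (simp add: field_simps)
    finally show "J \<le> 0 + e" .
  qed
  then have "J = 0" using \<open>J \<ge> 0\<close> by simp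
  have "h y = 0" if "y \<in> {0..1}" for y
  proof -
    have "\<forall>y\<in>{0..1}. (cmod (h y))\<^sup>2 = 0"
      using \<open>J = 0\<close> unfolding J_def
      by (subst integral_eq_0_iff[symmetric]) (simp_all add: c continuous_on_norm continuous_on_power)
    then show ?thesis using that by simp
  qed
  moreover have "frac x \<in> {0..1}" using frac_lt_1[of x] by (simp add: less_imp_le)
  ultimately have z: "h (frac x) = 0" by blast
  have "h x = h (frac x + of_int \<lfloor>x\<rfloor>)" by (simp add: frac_def)
  also have "\<dots> = h (frac x)" by (rule periodic_int[of h, OF per])
  finally show ?thesis using z by simp
qed

section \<open>The one-dimensional Poisson summation formula\<close>

lemma summable_on_int_inverse_square: "(\<lambda>n::int. 1 / (1 + (of_int n)\<^sup>2) :: real) summable_on UNIV"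
proof -
  let ?f = "\<lambda>n::int. 1 / (1 + (of_int n)\<^sup>2) :: real"
  have s: "summable (\<lambda>n::nat. 1 / (1 + (of_nat n)\<^sup>2) :: real)"
  proof (rule summable_comparison_test_ev)
    show "summable (\<lambda>n::nat. inverse (of_nat n ^ 2) :: real)"
      by (rule inverse_power_summable) simp
    show "eventually (\<lambda>n. norm (1 / (1 + (of_nat n)\<^sup>2) :: real) \<le> inverse (of_nat n ^ 2)) sequentially"
      using eventually_gt_at_top[of 0]
    proof eventually_elim
      case (elim n)
      then show ?case by (simp add: field_simps add_pos_nonneg)
    qed
  qed
  have n: "(\<lambda>n::nat. 1 / (1 + (of_nat n)\<^sup>2) :: real) summable_on UNIV"
    using s by (subst summable_on_UNIV_nonneg_real_iff) auto
  have 1: "?f summable_on range int"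
    using n by (subst summable_on_reindex) (auto simp: o_def)
  have "?f summable_on ((\<lambda>n. - int n) ` UNIV)"
    using n by (subst summable_on_reindex) (auto simp: o_def inj_on_def)
  then have 2: "?f summable_on {..<0}"
    by (rule summable_on_subset_banach) (auto intro!: image_eqI[of _ _ "nat (- _)"])
  have "UNIV = range int \<union> {..<0::int}"
    by (auto simp: image_iff) (metis nonneg_int_cases not_le)
  moreover have "?f summable_on (range int \<union> {..<0})"
    by (rule summable_on_Un_disjoint[OF 1 2]) auto
  ultimately show ?thesis by simp
qed

text \<open>Makes the inverse square majorant uniform for shifts in a bounded range. After clearing
  denominators the difference of the two sides is 1 + (2x + n)^2 + 2(R^2 - x^2) + 2 R^2 (x +
  n)^2.\<close>

lemma inverse_square_shift_bound:
  fixes x R n :: real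
  assumes "\<bar>x\<bar> \<le> R"
  shows "1 / (1 + (x + n)\<^sup>2) \<le> (2 * (1 + R\<^sup>2)) * (1 / (1 + n\<^sup>2))"
proof -
  have "x\<^sup>2 \<le> R\<^sup>2" using assms by (metis abs_ge_zero power2_abs power_mono)
  have "0 \<le> (2 * x + n)\<^sup>2 + R\<^sup>2 * (x + n)\<^sup>2" by simp
  then have "1 + n\<^sup>2 \<le> 2 * (1 + R\<^sup>2) * (1 + (x + n)\<^sup>2)"
  proof -
    have "0 \<le> R\<^sup>2 * (x + n)\<^sup>2" "0 \<le> (2 * x + n)\<^sup>2" by simp_all
    with \<open>x\<^sup>2 \<le> R\<^sup>2\<close> show ?thesis by (simp add: power2_eq_square algebra_simps)
  qed
  then show ?thesis by (simp add: divide_simps add_pos_nonneg)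
qed

lemma integrable_inverse_1_plus_square_lborel: "integrable lborel (\<lambda>x::real. 1 / (1 + x\<^sup>2))"
  using integrable_inverse_1_plus_square by (simp add: set_integrable_def inverse_eq_divide)

lemma integral_cis_period:
  fixes m :: int
  shows "integral {0..1} (\<lambda>x. cis (2 * pi * of_int m * x)) = (if m = 0 then 1 else 0)"
proof (cases "m = 0")
  case False
  define w where "w = 2 * pi * \<i> * of_int m"
  have w: "w \<noteq> 0" using False by (simp add: w_def)
  have eq: "cis (2 * pi * of_int m * x) = exp (w * of_real x)" for x
    by (simp add: w_def cis_conv_exp algebra_simps)
  have "((\<lambda>x. exp (w * of_real x)) has_integral (exp (w * of_real 1) / w - exp (w * of_real 0) / w)) {0..1}"
  proof (rule fundamental_theorem_of_calculus)
    fix x :: real assume "x \<in> {0..1}"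
    have "((\<lambda>z. exp (w * z) / w) has_field_derivative exp (w * of_real x)) (at (of_real x))"
      using w by (auto intro!: derivative_eq_intros)
    then show "((\<lambda>x. exp (w * of_real x) / w) has_vector_derivative exp (w * of_real x)) (at x within {0..1})"
      by (rule has_vector_derivative_real_field)
  qed simp
  moreover have "exp (w * of_real 1) = 1"
    using exp_integer_2pi[of "of_int m"] by (simp add: w_def algebra_simps)
  ultimately show ?thesis using False by (simp add: eq has_integral_integral integral_unique)
qed simp

text \<open>The series of translates is shown to converge uniformly on bounded intervals, so the
  continuity of its sum is assembled from those.\<close>

lemma continuous_on_UNIV_intervals:
  fixes f :: "real \<Rightarrow> 'b::topological_space"
  assumes "\<And>R. R > 0 \<Longrightarrow> continuous_on {-R..R} f"
  shows "continuous_on UNIV f"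
proof (rule continuous_at_imp_continuous_on, rule ballI)
  fix x :: real
  have "continuous_on {-(\<bar>x\<bar> + 1)..\<bar>x\<bar> + 1} f" by (rule assms) simp
  moreover have "x \<in> interior {-(\<bar>x\<bar> + 1)..\<bar>x\<bar> + 1}" by auto
  ultimately show "isCont f x" by (rule continuous_on_interior)
qed

text \<open>Both sides are continuous of period 1 with the same Fourier coefficients, so
  \<open>fourier_unique\<close> applies to their difference. The transform \<open>c\<close> is a
  parameter so that a caller can supply a closed formula.\<close>

lemma poisson_summation:
  fixes f :: "real \<Rightarrow> complex" and c :: "int \<Rightarrow> complex"
  assumes cont: "continuous_on UNIV f"
    and decay: "\<And>x. norm (f x) \<le> C * (1 / (1 + x\<^sup>2))"
    and ft: "\<And>m. c m = (LBINT x. f x * cis (- (2 * pi * of_int m * x)))"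
    and summ: "(\<lambda>m. norm (c m)) summable_on UNIV"
  shows "(\<Sum>\<^sub>\<infinity>n. f (x + of_int n)) = (\<Sum>\<^sub>\<infinity>m. c m * cis (2 * pi * of_int m * x))"
proof -
  define F where "F x = (\<Sum>\<^sub>\<infinity>n. f (x + of_int n))" for x
  define B where "B x = (\<Sum>\<^sub>\<infinity>m. c m * cis (2 * pi * of_int m * x))" for x
  have C: "C \<ge> 0" using order_trans[OF norm_ge_zero decay[of 0]] by simp
  have unifF: "uniform_limit {-R..R} (\<lambda>X x. \<Sum>n\<in>X. f (x + of_int n)) F (finite_subsets_at_top UNIV)" for R
    unfolding F_def
  proof (rule Weierstrass_m_test_general)
    fix n :: int and x assume "x \<in> {-R..R}"
    then have x: "\<bar>x\<bar> \<le> R" by auto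
    have "norm (f (x + of_int n)) \<le> C * (1 / (1 + (x + of_int n)\<^sup>2))" by (rule decay)
    also have "\<dots> \<le> C * ((2 * (1 + R\<^sup>2)) * (1 / (1 + (of_int n)\<^sup>2)))"
      by (intro mult_left_mono inverse_square_shift_bound x C)
    finally show "norm (f (x + of_int n)) \<le> C * ((2 * (1 + R\<^sup>2)) * (1 / (1 + (of_int n)\<^sup>2)))" .
  qed (intro summable_on_cmult_right summable_on_int_inverse_square)
  have unifB: "uniform_limit UNIV (\<lambda>X x. \<Sum>m\<in>X. c m * cis (2 * pi * of_int m * x)) B (finite_subsets_at_top UNIV)"
    unfolding B_def by (rule Weierstrass_m_test_general[OF _ summ]) (simp add: norm_mult)
  have contf: "continuous_on S (\<lambda>x. f (x + a))" for S a
    by (rule continuous_on_compose2[OF cont]) (auto intro!: continuous_intros)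
  have contF: "continuous_on UNIV F"
    by (rule continuous_on_UNIV_intervals, rule uniform_limit_theorem[OF _ unifF])
       (auto intro!: always_eventually continuous_intros contf)
  have contB: "continuous_on UNIV B"
    by (rule uniform_limit_theorem[OF _ unifB]) (auto intro!: always_eventually continuous_intros)
  have per: "F (x + 1) - B (x + 1) = F x - B x" for x
  proof -
    have "F (x + 1) = (\<Sum>\<^sub>\<infinity>n. f (x + of_int (n + 1)))" by (simp add: F_def add_ac)
    also have "\<dots> = F x" unfolding F_def
      by (rule infsum_reindex_bij_witness[of _ "\<lambda>n. n - 1" "\<lambda>n. n + 1"]) auto
    finally have 1: "F (x + 1) = F x" .
    have "cis (2 * pi * of_int m * (x + 1)) = cis (2 * pi * of_int m * x)" for m
    proof -
      have "cis (2 * pi * of_int m * (x + 1)) = cis (2 * pi * of_int m * x) * cis (2 * pi * of_int m)"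
        unfolding cis_mult by (rule arg_cong[of _ _ cis]) (simp add: algebra_simps)
      moreover have "cis (2 * pi * of_int m) = 1" by (rule cis_multiple_2pi) simp
      ultimately show ?thesis by simp
    qed
    then have "B (x + 1) = B x" by (simp add: B_def)
    with 1 show ?thesis by simp
  qed
  \<comment> \<open>The translates of the unit interval tile the line, so integrating the sum of
    translates over one period unfolds into the full Fourier transform.\<close>
  have intF: "integral {0..1} (\<lambda>x. F x * cis (2 * pi * of_int k * x)) = c (- k)" for k
  proof -
    define g where "g y = f y * cis (2 * pi * of_int k * y)" for y
    have contg: "continuous_on S g" for S
      unfolding g_def by (intro continuous_intros continuous_on_subset[OF cont]) simp
    have gi: "g integrable_on {a..b}" for a b by (rule integrable_continuous_real[OF contg])
    have normg: "norm (g y) \<le> C * (1 / (1 + y\<^sup>2))" for y using decay[of y] by (simp add: g_def norm_mult)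
    have u: "uniform_limit {0..1} (\<lambda>X x. (\<Sum>n\<in>X. f (x + of_int n)) * cis (2 * pi * of_int k * x))
        (\<lambda>x. F x * cis (2 * pi * of_int k * x)) (finite_subsets_at_top UNIV)"
    proof (rule uniform_lim_mult)
      show "uniform_limit {0..1} (\<lambda>X x. \<Sum>n\<in>X. f (x + of_int n)) F (finite_subsets_at_top UNIV)"
        by (rule uniform_limit_on_subset[OF unifF[of 1]]) auto
      show "bounded (F ` {0..1})"
        by (intro compact_imp_bounded compact_continuous_image continuous_on_subset[OF contF]) auto
      show "bounded ((\<lambda>x. cis (2 * pi * of_int k * x)) ` {0..1})"
        by (auto simp: bounded_iff intro!: exI[of _ 1])
    qed (rule uniform_limit_const)
    obtain I J where I: "\<And>X. ((\<lambda>x. (\<Sum>n\<in>X. f (x + of_int n)) * cis (2 * pi * of_int k * x)) has_integral I X) {0..1}"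
      and J: "((\<lambda>x. F x * cis (2 * pi * of_int k * x)) has_integral J) {0..1}"
      and IJ: "(I \<longlongrightarrow> J) (finite_subsets_at_top UNIV)"
      by (rule uniform_limit_integral[OF u]) (auto intro!: continuous_intros contf)
    have one: "integral {0..1} (\<lambda>x. f (x + of_int n) * cis (2 * pi * of_int k * x)) = integral {of_int n..of_int n + 1} g" for n
    proof -
      have "f (x + of_int n) * cis (2 * pi * of_int k * x) = g (x + of_int n)" for x
      proof -
        have "cis (2 * pi * of_int k * (x + of_int n)) = cis (2 * pi * of_int k * x) * cis (2 * pi * of_int (k * n))"
          unfolding cis_mult by (rule arg_cong[of _ _ cis]) (simp add: algebra_simps)
        moreover have "cis (2 * pi * of_int (k * n)) = 1" by (rule cis_multiple_2pi) simp
        ultimately show ?thesis by (simp add: g_def)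
      qed
      then show ?thesis
        using integral_shift_real_ivl[of "of_int n" "of_int n" "of_int n + 1" g] by (simp add: algebra_simps)
    qed
    have IX: "I X = (\<Sum>n\<in>X. integral {of_int n..of_int n + 1} g)" for X
    proof -
      have "I X = integral {0..1} (\<lambda>x. (\<Sum>n\<in>X. f (x + of_int n)) * cis (2 * pi * of_int k * x))"
        using I[of X] by (simp add: integral_unique)
      also have "\<dots> = integral {0..1} (\<lambda>x. (\<Sum>n\<in>X. f (x + of_int n) * cis (2 * pi * of_int k * x)))"
        by (simp add: sum_distrib_right)
      also have "\<dots> = (\<Sum>n\<in>X. integral {of_int n..of_int n + 1} g)"
      proof (cases "finite X")
        case True
        then show ?thesis
          by (subst integral_sum)
             (auto simp: one intro!: integrable_continuous_real continuous_intros contf)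
      qed simp
      finally show ?thesis .
    qed
    \<comment> \<open>The limit of \<open>I\<close> runs over all finite sets of integers. It is
      evaluated along these intervals, which are cofinal and on which the unit pieces join into a
      single integral.\<close>
    have part: "I {-int N..<int N} = integral {- real N..real N} g" for N
    proof (induction N)
      case (Suc N)
      have e: "- real N - 1 = - 1 - real N" by simp
      have "{-int (Suc N)..<int (Suc N)} = insert (-int (Suc N)) (insert (int N) {-int N..<int N})" by auto
      then have "I {-int (Suc N)..<int (Suc N)} = integral {- real N - 1..- real N} g +
        (integral {real N..real N + 1} g + I {-int N..<int N})"
        unfolding IX by (simp add: algebra_simps e)
      also have "\<dots> = integral {- real N - 1..- real N} g + (integral {- real N..real N} g + integral {real N..real N + 1} g)"
        by (simp add: Suc)
      also have "integral {- real N..real N} g + integral {real N..real N + 1} g = integral {- real N..real N + 1} g"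
        by (rule Henstock_Kurzweil_Integration.integral_combine) (auto intro!: gi)
      also have "integral {- real N - 1..- real N} g + integral {- real N..real N + 1} g = integral {- real N - 1..real N + 1} g"
        by (rule Henstock_Kurzweil_Integration.integral_combine) (auto intro!: gi)
      finally show ?case by (simp add: algebra_simps e)
    qed (simp add: IX)
    have gm: "g \<in> borel_measurable lborel" using contg[of UNIV] by (simp add: borel_measurable_continuous_onI)
    have gint: "integrable lborel g"
      by (rule Bochner_Integration.integrable_bound[OF integrable_mult_right[OF integrable_inverse_1_plus_square_lborel, of C] gm])
         (use normg C in \<open>auto intro!: AE_I2 intro: order_trans\<close>)
    have part': "integral {- real N..real N} g = (LBINT y. indicator {- real N..real N} y *\<^sub>R g y)" for N
    proof -
      have "set_integrable lborel {- real N..real N} g"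
        unfolding set_integrable_def using gint by (intro integrable_mult_indicator) auto
      then show ?thesis using set_borel_integral_eq_integral(2) by (metis set_lebesgue_integral_def)
    qed
    have "(\<lambda>N. LBINT y. indicator {- real N..real N} y *\<^sub>R g y) \<longlonglongrightarrow> (LBINT y. g y)"
    proof (rule integral_dominated_convergence[where w = "\<lambda>y. norm (g y)"])
      show "AE y in lborel. (\<lambda>N. indicator {- real N..real N} y *\<^sub>R g y) \<longlonglongrightarrow> g y"
      proof (rule AE_I2, rule tendsto_eventually)
        fix y :: real
        have "eventually (\<lambda>N. \<bar>y\<bar> \<le> real N) sequentially"
          using filterlim_real_sequentially by (simp add: filterlim_at_top)
        then show "eventually (\<lambda>N. indicator {- real N..real N} y *\<^sub>R g y = g y) sequentially"
          by eventually_elim (auto simp: indicator_def)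
      qed
    qed (use gint gm in \<open>auto simp: indicator_def\<close>)
    moreover have "(LBINT y. g y) = c (- k)" by (simp add: g_def ft)
    ultimately have lim1: "(\<lambda>N. I {-int N..<int N}) \<longlonglongrightarrow> c (- k)" by (simp add: part part')
    have "filterlim (\<lambda>N. {-int N..<int N}) (finite_subsets_at_top UNIV) sequentially"
      unfolding filterlim_finite_subsets_at_top
    proof (intro allI impI)
      fix X :: "int set" assume X: "finite X \<and> X \<subseteq> UNIV"
      \<comment> \<open>The sum of the absolute values bounds every element of
        \<open>X\<close>.\<close>
      define K where "K = nat (\<Sum>n\<in>X. \<bar>n\<bar>) + 1"
      have "\<bar>n\<bar> < int K" if "n \<in> X" for n
        using member_le_sum[OF that, of abs] X unfolding K_def by auto
      then have K: "X \<subseteq> {-int K..<int K}" by force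
      show "eventually (\<lambda>N. finite {-int N..<int N} \<and> X \<subseteq> {-int N..<int N} \<and> {-int N..<int N} \<subseteq> UNIV) sequentially"
        using eventually_ge_at_top[of K] by eventually_elim (use K in force)
    qed
    then have "(\<lambda>N. I {-int N..<int N}) \<longlonglongrightarrow> J" by (rule filterlim_compose[OF IJ])
    then have "J = c (- k)" using lim1 by (rule LIMSEQ_unique)
    then show ?thesis using J by (simp add: integral_unique)
  qed
  have intB: "integral {0..1} (\<lambda>x. B x * cis (2 * pi * of_int k * x)) = c (- k)" for k
  proof -
    have u: "uniform_limit {0..1} (\<lambda>X x. (\<Sum>m\<in>X. c m * cis (2 * pi * of_int m * x)) * cis (2 * pi * of_int k * x))
        (\<lambda>x. B x * cis (2 * pi * of_int k * x)) (finite_subsets_at_top UNIV)"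
    proof (rule uniform_lim_mult)
      show "uniform_limit {0..1} (\<lambda>X x. \<Sum>m\<in>X. c m * cis (2 * pi * of_int m * x)) B (finite_subsets_at_top UNIV)"
        by (rule uniform_limit_on_subset[OF unifB]) auto
      show "bounded (B ` {0..1})"
        by (intro compact_imp_bounded compact_continuous_image continuous_on_subset[OF contB]) auto
      show "bounded ((\<lambda>x. cis (2 * pi * of_int k * x)) ` {0..1})"
        by (auto simp: bounded_iff intro!: exI[of _ 1])
    qed (rule uniform_limit_const)
    obtain I J where I: "\<And>X. ((\<lambda>x. (\<Sum>m\<in>X. c m * cis (2 * pi * of_int m * x)) * cis (2 * pi * of_int k * x)) has_integral I X) {0..1}"
      and J: "((\<lambda>x. B x * cis (2 * pi * of_int k * x)) has_integral J) {0..1}"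
      and IJ: "(I \<longlongrightarrow> J) (finite_subsets_at_top UNIV)"
      by (rule uniform_limit_integral[OF u]) (auto intro!: continuous_intros)
    have IX: "I X = (if - k \<in> X then c (- k) else 0)" if "finite X" for X
    proof -
      have cc: "c m * cis (2 * pi * of_int m * x) * cis (2 * pi * of_int k * x) = c m * cis (2 * pi * of_int (m + k) * x)" for m x
        unfolding mult.assoc[of "c m"] cis_mult by (rule arg_cong[of _ _ "\<lambda>u. c m * cis u"]) (simp add: algebra_simps)
      have "I X = integral {0..1} (\<lambda>x. \<Sum>m\<in>X. c m * cis (2 * pi * of_int (m + k) * x))"
        using integral_unique[OF I[of X]] by (simp only: sum_distrib_right cc)
      also have "\<dots> = (\<Sum>m\<in>X. integral {0..1} (\<lambda>x. c m * cis (2 * pi * of_int (m + k) * x)))"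
        using that by (intro integral_sum integrable_continuous_real continuous_intros) auto
      also have "\<dots> = (\<Sum>m\<in>X. c m * (if m + k = 0 then 1 else 0))"
        by (simp only: integral_mult_right integral_cis_period)
      also have "\<dots> = (\<Sum>m\<in>X. if m = - k then c m else 0)"
        by (intro sum.cong) auto
      also have "\<dots> = (if - k \<in> X then c (- k) else 0)" using that by simp
      finally show ?thesis .
    qed
    \<comment> \<open>By orthogonality the integral no longer changes once -k belongs to the finite
      set.\<close>
    have "eventually (\<lambda>X. I X = c (- k)) (finite_subsets_at_top UNIV)"
      unfolding eventually_finite_subsets_at_top
      by (rule exI[of _ "{- k}"]) (auto simp: IX)
    then have "(I \<longlongrightarrow> c (- k)) (finite_subsets_at_top UNIV)" by (rule tendsto_eventually)
    then have "J = c (- k)" using IJ by (intro tendsto_unique[of "finite_subsets_at_top UNIV"]) auto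
    then show ?thesis using J by (simp add: integral_unique)
  qed
  have "fourier_coeffs_vanish (\<lambda>x. F x - B x)"
    unfolding fourier_coeffs_vanish_def
  proof (intro conjI allI)
    show "continuous_on UNIV (\<lambda>x. F x - B x)" by (intro continuous_intros contF contB)
    fix k :: int
    have i: "(\<lambda>x. F x * cis (2 * pi * of_int k * x)) integrable_on {0..1}"
      "(\<lambda>x. B x * cis (2 * pi * of_int k * x)) integrable_on {0..1}"
      by (intro integrable_continuous_real continuous_intros continuous_on_subset[OF contF]
          continuous_on_subset[OF contB]; simp)+
    show "integral {0..1} (\<lambda>x. (F x - B x) * cis (2 * pi * of_int k * x)) = 0"
      using integral_diff[OF i] intF[of k] intB[of k] by (simp add: left_diff_distrib)
  qed
  then have "F x - B x = 0" by (rule fourier_unique) (rule per)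
  then show ?thesis by (simp add: F_def B_def)
qed

section \<open>Gaussians and their Fourier transform\<close>

text \<open>From 1 + u <= exp u with u = t x^2; the factor \<open>max 1 (1 / t)\<close> treats small
  and large t at once.\<close>

lemma gaussian_decay:
  fixes t :: real
  assumes "t > 0"
  shows "exp (- (t * x\<^sup>2)) \<le> max 1 (1 / t) * (1 / (1 + x\<^sup>2))"
proof -
  have "1 + x\<^sup>2 \<le> max 1 (1 / t) * (1 + t * x\<^sup>2)"
  proof -
    have "1 \<le> max 1 (1 / t)" "1 \<le> max 1 (1 / t) * t" using assms
      by (auto simp: max_def field_simps)
    then have "1 * 1 + 1 * x\<^sup>2 \<le> max 1 (1 / t) * 1 + (max 1 (1 / t) * t) * x\<^sup>2"
      by (intro add_mono mult_right_mono) auto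
    then show ?thesis by (simp add: algebra_simps)
  qed
  also have "\<dots> \<le> max 1 (1 / t) * exp (t * x\<^sup>2)"
    by (intro mult_left_mono exp_ge_add_one_self) auto
  finally have "1 + x\<^sup>2 \<le> max 1 (1 / t) * exp (t * x\<^sup>2)" .
  then show ?thesis
    by (simp add: exp_minus field_simps add_pos_nonneg)
qed

text \<open>The characteristic function of the standard normal distribution after the substitution
  of \<sigma> x for x, where \<sigma>^2 = 2 pi t turns the normal density into a multiple of exp(-pi
  t x^2).\<close>

lemma fourier_transform_gaussian:
  fixes t w :: real
  assumes "t > 0"
  shows "(LBINT x. of_real (exp (- (pi * t * x\<^sup>2))) * cis (2 * pi * w * x)) =
    of_real (exp (- (pi * w\<^sup>2 / t)) / sqrt t)"
proof -
  define \<sigma> where "\<sigma> = sqrt (2 * pi * t)"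
  have \<sigma>: "\<sigma> > 0" "\<sigma>\<^sup>2 = 2 * pi * t" using assms by (simp_all add: \<sigma>_def)
  define u where "u = 2 * pi * w / \<sigma>"
  have "complex_of_real (exp (- u\<^sup>2 / 2)) = char std_normal_distribution u"
    by (simp add: char_std_normal_distribution)
  also have "\<dots> = (LBINT x. std_normal_density x *\<^sub>R iexp (u * x))"
    unfolding char_def by (subst integral_density) (auto simp: normal_density_nonneg)
  also have "\<dots> = \<bar>\<sigma>\<bar> *\<^sub>R (LBINT x. std_normal_density (0 + \<sigma> * x) *\<^sub>R iexp (u * (0 + \<sigma> * x)))"
    using \<sigma> by (intro lborel_integral_real_affine) auto
  also have "(\<lambda>x. std_normal_density (0 + \<sigma> * x) *\<^sub>R iexp (u * (0 + \<sigma> * x))) =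
     (\<lambda>x. complex_of_real (1 / sqrt (2 * pi)) * (of_real (exp (- (pi * t * x\<^sup>2))) * cis (2 * pi * w * x)))"
  proof
    fix x
    have "(\<sigma> * x)\<^sup>2 / 2 = pi * t * x\<^sup>2" using \<sigma> by (simp add: power_mult_distrib)
    moreover have "u * (\<sigma> * x) = 2 * pi * w * x" using \<sigma>(1) by (simp add: u_def)
    then have "iexp (u * (\<sigma> * x)) = cis (2 * pi * w * x)" by (simp only: cis_conv_exp)
    ultimately show "std_normal_density (0 + \<sigma> * x) *\<^sub>R iexp (u * (0 + \<sigma> * x)) =
      complex_of_real (1 / sqrt (2 * pi)) * (of_real (exp (- (pi * t * x\<^sup>2))) * cis (2 * pi * w * x))"
      unfolding std_normal_density_def scaleR_conv_of_real by simp
  qed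
  also have "\<bar>\<sigma>\<bar> *\<^sub>R (LBINT x. complex_of_real (1 / sqrt (2 * pi)) * (of_real (exp (- (pi * t * x\<^sup>2))) * cis (2 * pi * w * x)))
     = of_real (\<sigma> / sqrt (2 * pi)) * (LBINT x. of_real (exp (- (pi * t * x\<^sup>2))) * cis (2 * pi * w * x))"
    using \<sigma>(1) by (subst integral_mult_right_zero) (simp add: scaleR_conv_of_real)
  also have "\<sigma> / sqrt (2 * pi) = sqrt t" using assms by (simp add: \<sigma>_def real_sqrt_mult)
  finally have "complex_of_real (exp (- u\<^sup>2 / 2)) = of_real (sqrt t) *
      (LBINT x. of_real (exp (- (pi * t * x\<^sup>2))) * cis (2 * pi * w * x))" .
  moreover have "- u\<^sup>2 / 2 = - (pi * w\<^sup>2 / t)"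
    unfolding u_def power_divide \<sigma>(2) using assms by (simp add: power_mult_distrib field_simps power2_eq_square)
  ultimately have "complex_of_real (exp (- (pi * w\<^sup>2 / t))) = of_real (sqrt t) *
      (LBINT x. of_real (exp (- (pi * t * x\<^sup>2))) * cis (2 * pi * w * x))" by (simp only:)
  then show ?thesis using assms by simp
qed

text \<open>The frequency \<open>s\<close> serves binary forms: when one sums over the two variables
  in turn, the mixed term b x y becomes such a modulation in the second sum.\<close>

lemma gaussian_poisson:
  fixes t x s :: real
  assumes t: "t > 0"
  shows "(\<Sum>\<^sub>\<infinity>n::int. of_real (exp (- (pi * t * (x + of_int n)\<^sup>2))) * cis (2 * pi * s * (x + of_int n))) =
    (\<Sum>\<^sub>\<infinity>m::int. of_real (exp (- (pi * (of_int m - s)\<^sup>2 / t)) / sqrt t) * cis (2 * pi * of_int m * x))"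
proof (rule poisson_summation)
  let ?f = "\<lambda>x. complex_of_real (exp (- (pi * t * x\<^sup>2))) * cis (2 * pi * s * x)"
  show "continuous_on UNIV ?f" by (intro continuous_intros)
  show "norm (?f x) \<le> max 1 (1 / (pi * t)) * (1 / (1 + x\<^sup>2))" for x
    using gaussian_decay[of "pi * t" x] t by (simp add: norm_mult)
  show "complex_of_real (exp (- (pi * (of_int m - s)\<^sup>2 / t)) / sqrt t) =
     (LBINT x. ?f x * cis (- (2 * pi * of_int m * x)))" for m
  proof -
    have "?f x * cis (- (2 * pi * of_int m * x)) = of_real (exp (- (pi * t * x\<^sup>2))) * cis (2 * pi * (s - of_int m) * x)" for x
      by (simp add: mult.assoc cis_mult) (simp add: algebra_simps)
    then show ?thesis
      using fourier_transform_gaussian[OF t, of "s - of_int m"] by (simp only: power2_commute[of s])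
  qed
  define C where "C = max 1 (1 / (pi / t))"
  have C: "C \<ge> 0" by (simp add: C_def)
  show "(\<lambda>m::int. norm (complex_of_real (exp (- (pi * (of_int m - s)\<^sup>2 / t)) / sqrt t))) summable_on UNIV"
  proof (rule summable_on_comparison_test)
    show "(\<lambda>m::int. (C / sqrt t) * ((2 * (1 + \<bar>s\<bar>\<^sup>2)) * (1 / (1 + (of_int m)\<^sup>2)))) summable_on UNIV"
      by (intro summable_on_cmult_right summable_on_int_inverse_square)
    fix m :: int
    have "exp (- (pi / t * (- s + of_int m)\<^sup>2)) \<le> C * (1 / (1 + (- s + of_int m)\<^sup>2))"
      unfolding C_def using t by (intro gaussian_decay) simp
    also have "\<dots> \<le> C * ((2 * (1 + \<bar>s\<bar>\<^sup>2)) * (1 / (1 + (of_int m)\<^sup>2)))"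
      by (intro mult_left_mono inverse_square_shift_bound C) simp
    finally have "exp (- (pi / t * (- s + of_int m)\<^sup>2)) / sqrt t \<le> C * ((2 * (1 + \<bar>s\<bar>\<^sup>2)) * (1 / (1 + (of_int m)\<^sup>2))) / sqrt t"
      using t by (intro divide_right_mono) auto
    then show "norm (complex_of_real (exp (- (pi * (of_int m - s)\<^sup>2 / t)) / sqrt t)) \<le>
       (C / sqrt t) * ((2 * (1 + \<bar>s\<bar>\<^sup>2)) * (1 / (1 + (of_int m)\<^sup>2)))"
      using t by (simp add: norm_divide mult.commute)
  qed simp
qed

section \<open>Binary theta series\<close>

text \<open>Polymorphic, since the same polynomial is evaluated at integers, for congruences, and at
  real points shifted off the lattice.\<close>

definition bqf :: "'a::comm_ring_1 \<Rightarrow> 'a \<Rightarrow> 'a \<Rightarrow> 'a \<Rightarrow> 'a \<Rightarrow> 'a" where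
  "bqf a b c x y = a * x\<^sup>2 + b * x * y + c * y\<^sup>2"

definition ee :: "complex \<Rightarrow> complex" where
  "ee z = exp (2 * of_real pi * \<i> * z)"

lemma ee_add: "ee (z + w) = ee z * ee w" by (simp add: ee_def exp_add ring_distribs)
lemma norm_ee: "norm (ee z) = exp (- (2 * pi * Im z))" by (simp add: ee_def)
lemma ee_of_real: "ee (of_real x) = cis (2 * pi * x)" by (simp add: ee_def cis_conv_exp algebra_simps)
lemma ee_of_int [simp]: "ee (of_int n) = 1"
  using exp_integer_2pi[of "of_int n"] by (simp add: ee_def algebra_simps)
lemma ee_0 [simp]: "ee 0 = 1" by (simp add: ee_def)

lemma ee_add_of_int [simp]: "ee (z + of_int n) = ee z" by (simp add: ee_add)

lemma summable_on_product:
  fixes f :: "'a \<Rightarrow> real" and g :: "'b \<Rightarrow> real"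
  assumes "f summable_on A" "g summable_on B" "\<And>x. f x \<ge> 0" "\<And>y. g y \<ge> 0"
  shows "(\<lambda>(x, y). f x * g y) summable_on A \<times> B"
proof (rule summable_on_SigmaI[where g = "\<lambda>x. f x * infsum g B"])
  fix x assume "x \<in> A"
  show "((\<lambda>y. case (x, y) of (x, y) \<Rightarrow> f x * g y) has_sum f x * infsum g B) B"
    using assms(2) by (auto intro!: has_sum_cmult_right has_sum_infsum)
qed (use assms in \<open>auto intro!: summable_on_cmult_left\<close>)

lemma bqf_complete_square:
  fixes a :: real
  assumes "a \<noteq> 0"
  shows "bqf a b c x y = a * (x + b * y / (2 * a))\<^sup>2 + (4 * a * c - b\<^sup>2) / (4 * a) * y\<^sup>2"
  using assms by (simp add: bqf_def field_simps power2_eq_square)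

text \<open>Completing the square in either variable bounds the form below by N y^2 / (4a) and by N
  x^2 / (4c); the average of the two gives the constant \<open>k\<close>.\<close>

lemma bqf_lower_bound:
  fixes a b c :: real
  assumes "a > 0" "4 * a * c - b\<^sup>2 > 0"
  shows "\<exists>k>0. \<forall>x y. bqf a b c x y \<ge> k * (x\<^sup>2 + y\<^sup>2)"
proof -
  define N where "N = 4 * a * c - b\<^sup>2"
  have "4 * a * c > 0" using assms(2) zero_le_power2[of b] by linarith
  then have c: "c > 0" using assms(1) by (simp add: zero_less_mult_iff)
  have N: "N > 0" using assms by (simp add: N_def)
  define k where "k = N / (8 * (a + c))"
  have k: "k > 0" using N assms c by (simp add: k_def)
  have "bqf a b c x y \<ge> k * (x\<^sup>2 + y\<^sup>2)" for x y
  proof -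
    have 1: "bqf a b c x y \<ge> N / (4 * a) * y\<^sup>2"
      unfolding N_def using assms(1) by (subst bqf_complete_square) auto
    have 2: "bqf c b a y x \<ge> N / (4 * c) * x\<^sup>2"
      unfolding N_def using c by (subst bqf_complete_square) (auto simp: mult_ac)
    have e: "bqf c b a y x = bqf a b c x y" by (simp add: bqf_def)
    have "N / (4 * a) \<ge> 2 * k" "N / (4 * c) \<ge> 2 * k"
      unfolding k_def using N assms c by (simp_all add: field_simps)
    then have "2 * k * y\<^sup>2 \<le> N / (4 * a) * y\<^sup>2" "2 * k * x\<^sup>2 \<le> N / (4 * c) * x\<^sup>2"
      by (intro mult_right_mono; simp)+
    then show ?thesis using 1 2 e by (simp add: ring_distribs)
  qed
  with k show ?thesis by blast
qed

text \<open>The bound k (x^2 + y^2) splits the exponential into a product of two one-variable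
  Gaussians.\<close>

lemma bqf_summable:
  fixes a b c t x y :: real
  assumes "a > 0" "4 * a * c - b\<^sup>2 > 0" "t > 0"
  shows "(\<lambda>(u, v). exp (- (t * bqf a b c (x + of_int u) (y + of_int v)))) summable_on (UNIV :: (int \<times> int) set)"
proof -
  obtain k where k: "k > 0" "\<And>x y. bqf a b c x y \<ge> k * (x\<^sup>2 + y\<^sup>2)"
    using bqf_lower_bound[OF assms(1,2)] by blast
  define C where "C = max 1 (1 / (t * k))"
  have C: "C \<ge> 0" by (simp add: C_def)
  define M where "M x n = C * ((2 * (1 + \<bar>x\<bar>\<^sup>2)) * (1 / (1 + (of_int n)\<^sup>2)))" for x :: real and n :: int
  have M: "M x n \<ge> 0" for x n using C by (simp add: M_def)
  have Mb: "exp (- (t * k * (x + of_int n)\<^sup>2)) \<le> M x n" for x n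
  proof -
    have "exp (- (t * k * (x + of_int n)\<^sup>2)) \<le> C * (1 / (1 + (x + of_int n)\<^sup>2))"
      unfolding C_def using assms k by (intro gaussian_decay) simp
    also have "\<dots> \<le> M x n" unfolding M_def
      by (intro mult_left_mono inverse_square_shift_bound C) simp
    finally show ?thesis .
  qed
  have Ms: "M x summable_on UNIV" for x
    unfolding M_def by (intro summable_on_cmult_right summable_on_int_inverse_square)
  have "(\<lambda>(u, v). M x u * M y v) summable_on UNIV \<times> UNIV"
    by (intro summable_on_product Ms M)
  then have "(\<lambda>(u, v). M x u * M y v) summable_on UNIV" by simp
  then show ?thesis
  proof (rule summable_on_comparison_test)
    fix p :: "int \<times> int"
    obtain u v where p: "p = (u, v)" by (cases p)
    have "exp (- (t * bqf a b c (x + of_int u) (y + of_int v))) \<le>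
       exp (- (t * (k * ((x + of_int u)\<^sup>2 + (y + of_int v)\<^sup>2))))"
      using mult_left_mono[OF k(2), of t] assms by simp
    also have "\<dots> = exp (- (t * k * (x + of_int u)\<^sup>2)) * exp (- (t * k * (y + of_int v)\<^sup>2))"
      by (simp add: exp_add[symmetric] algebra_simps)
    also have "\<dots> \<le> M x u * M y v" by (intro mult_mono Mb M) auto
    finally show "(case p of (u, v) \<Rightarrow> exp (- (t * bqf a b c (x + of_int u) (y + of_int v)))) \<le> (case p of (u, v) \<Rightarrow> M x u * M y v)"
      by (simp add: p)
  qed (auto split: prod.splits)
qed

section \<open>Poisson summation for a binary form\<close>

text \<open>On the closed ball of radius Im z / 2 about z the imaginary part is at least Im z / 2,
  so one summable series dominates all terms there. The weights \<open>w\<close> carry the phases of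
  the dual series.\<close>

lemma exp_series_holomorphic:
  fixes l :: "'i \<Rightarrow> real" and w :: "'i \<Rightarrow> complex"
  assumes sum: "\<And>y. y > 0 \<Longrightarrow> (\<lambda>i. exp (- (2 * pi * y * l i))) summable_on I"
    and w: "\<And>i. norm (w i) \<le> 1" and l: "\<And>i. l i \<ge> 0"
  shows "(\<lambda>z. \<Sum>\<^sub>\<infinity>i\<in>I. w i * ee (of_real (l i) * z)) holomorphic_on {z. Im z > 0}"
    (is "?f holomorphic_on _")
proof -
  have "?f field_differentiable (at z)" if z: "Im z > 0" for z
  proof -
    define r where "r = Im z / 2"
    have r: "r > 0" using z by (simp add: r_def)
    have ul: "uniform_limit (cball z r) (\<lambda>X z. \<Sum>i\<in>X. w i * ee (of_real (l i) * z)) ?f (finite_subsets_at_top I)"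
    proof (rule Weierstrass_m_test_general[OF _ sum[OF r]])
      fix i s assume "s \<in> cball z r"
      then have "\<bar>Im (z - s)\<bar> \<le> r" using abs_Im_le_cmod[of "z - s"] by (simp add: dist_norm)
      then have s: "Im s \<ge> r" unfolding r_def minus_complex.simps abs_le_iff by linarith
      have "norm (w i * ee (of_real (l i) * s)) \<le> 1 * exp (- (2 * pi * (l i * Im s)))"
        unfolding norm_mult norm_ee using w[of i] by (intro mult_mono) auto
      also have "\<dots> \<le> exp (- (2 * pi * r * l i))"
        using mult_left_mono[OF s l[of i]] by (simp add: mult_ac)
      finally show "norm (w i * ee (of_real (l i) * s)) \<le> exp (- (2 * pi * r * l i))" .
    qed
    have ev: "eventually (\<lambda>X. continuous_on (cball z r) (\<lambda>z. \<Sum>i\<in>X. w i * ee (of_real (l i) * z)) \<and>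
        (\<lambda>z. \<Sum>i\<in>X. w i * ee (of_real (l i) * z)) holomorphic_on ball z r) (finite_subsets_at_top I)"
      by (intro always_eventually allI conjI) (auto simp: ee_def intro!: continuous_intros holomorphic_intros)
    have "?f holomorphic_on ball z r"
      using holomorphic_uniform_limit[OF ev ul] by auto
    then show ?thesis using r by (intro holomorphic_on_imp_differentiable_at[of _ "ball z r"]) auto
  qed
  then show ?thesis
    unfolding holomorphic_on_def by (auto intro: field_differentiable_at_within)
qed

text \<open>At z = i y all terms are real Gaussians, so the one-dimensional formula can be used
  twice: in the first variable after completing the square, then in the second, modulated by the
  frequency that the first step leaves behind. The dual form (c, -b, a)/N belongs to the inverse of
  the matrix with rows (2a, b) and (b, 2c).\<close>

lemma bqf_poisson_imaginary:
  fixes a b c x1 x2 y :: real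
  assumes a: "a > 0" and N: "N = 4 * a * c - b\<^sup>2" "N > 0" and y: "y > 0"
  shows "(\<Sum>\<^sub>\<infinity>(u, v)\<in>(UNIV :: (int \<times> int) set).
            ee (of_real (bqf a b c (x1 + of_int u) (x2 + of_int v)) * (\<i> * of_real y))) =
    of_real (1 / (y * sqrt N)) * (\<Sum>\<^sub>\<infinity>(m, k)\<in>(UNIV :: (int \<times> int) set).
       ee (of_real (of_int m * x1 + of_int k * x2)) *
       ee (of_real (bqf c (- b) a (of_int m) (of_int k) / N) * (\<i> / of_real y)))"
proof -
  have "4 * a * c > 0" using N zero_le_power2[of b] by linarith
  then have c: "c > 0" using a by (simp add: zero_less_mult_iff)
  \<comment> \<open>With these widths exp(-2 pi y Q) is the product of exp(-pi t1 X^2) and exp(-pi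
    t2 Y^2), where X and Y are the two squared terms of the completed form.\<close>
  define t1 where "t1 = 2 * y * a"
  define t2 where "t2 = y * N / (2 * a)"
  have t: "t1 > 0" "t2 > 0" using a y N by (simp_all add: t1_def t2_def)
  \<comment> \<open>The frequency in the second variable left by the first summation: the dual index
    \<open>m\<close> times the shift b / (2a).\<close>
  define s where "s m = of_int m * b / (2 * a)" for m :: int
  define f where "f u v = ee (of_real (bqf a b c (x1 + of_int u) (x2 + of_int v)) * (\<i> * of_real y))" for u v :: int
  have f_eq: "f u v = of_real (exp (- (pi * t2 * (x2 + of_int v)\<^sup>2))) *
      (of_real (exp (- (pi * t1 * ((x1 + b * (x2 + of_int v) / (2 * a)) + of_int u)\<^sup>2))) *
        cis (2 * pi * 0 * ((x1 + b * (x2 + of_int v) / (2 * a)) + of_int u)))" for u v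
  proof -
    have "f u v = of_real (exp (- (2 * pi * y * bqf a b c (x1 + of_int u) (x2 + of_int v))))"
      by (simp add: f_def ee_def exp_of_real[symmetric] algebra_simps)
    also have "- (2 * pi * y * bqf a b c (x1 + of_int u) (x2 + of_int v)) =
       - (pi * t2 * (x2 + of_int v)\<^sup>2) + - (pi * t1 * ((x1 + b * (x2 + of_int v) / (2 * a)) + of_int u)\<^sup>2)"
      using a by (subst bqf_complete_square) (simp_all add: t1_def t2_def N(1) field_simps power2_eq_square)
    finally show ?thesis unfolding exp_add of_real_mult by simp
  qed
  define g where "g m k = of_real (exp (- (pi * (of_int m)\<^sup>2 / t1)) / sqrt t1) * cis (2 * pi * of_int m * x1) *
      (of_real (exp (- (pi * (of_int k - s m)\<^sup>2 / t2)) / sqrt t2) * cis (2 * pi * of_int k * x2))" for m k :: int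
  define h where "h v m = of_real (exp (- (pi * t2 * (x2 + of_int v)\<^sup>2))) *
      (of_real (exp (- (pi * (of_int m)\<^sup>2 / t1)) / sqrt t1) *
       (cis (2 * pi * of_int m * x1) * cis (2 * pi * s m * (x2 + of_int v))))" for v m :: int
  have g_eq: "g m k = of_real (1 / (y * sqrt N)) * (ee (of_real (of_int m * x1 + of_int k * x2)) *
       ee (of_real (bqf c (- b) a (of_int m) (of_int k) / N) * (\<i> / of_real y)))" for m k
  proof -
    have "sqrt t1 * sqrt t2 = sqrt (y\<^sup>2 * N)"
      using a y by (simp add: real_sqrt_mult[symmetric] t1_def t2_def power2_eq_square)
    also have "\<dots> = y * sqrt N" using y by (simp add: real_sqrt_mult)
    finally have sq: "sqrt t1 * sqrt t2 = y * sqrt N" .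
    define S where "S = (of_int k - s m)\<^sup>2"
    have "bqf c (- b) a (of_int m) (of_int k) = bqf a (- b) c (of_int k) (of_int m)"
      by (simp add: bqf_def)
    also have "\<dots> = a * S + N / (4 * a) * (of_int m)\<^sup>2"
      unfolding S_def N(1) s_def using a by (subst bqf_complete_square) (simp_all add: mult_ac)
    finally have "2 * pi * (bqf c (- b) a (of_int m) (of_int k) / N / y) =
      pi * (of_int m)\<^sup>2 / t1 + pi * S / t2"
      using a y N(2) by (simp add: t1_def t2_def field_simps)
    then have ex: "- (2 * pi * (bqf c (- b) a (of_int m) (of_int k) / N / y)) =
      - (pi * (of_int m)\<^sup>2 / t1) + - (pi * (of_int k - s m)\<^sup>2 / t2)"
      by (simp add: S_def)
    have "ee (of_real (bqf c (- b) a (of_int m) (of_int k) / N) * (\<i> / of_real y)) =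
       of_real (exp (- (2 * pi * (bqf c (- b) a (of_int m) (of_int k) / N / y))))"
      by (simp add: ee_def exp_of_real[symmetric] field_simps)
    also have "\<dots> = of_real (exp (- (pi * (of_int m)\<^sup>2 / t1)) * exp (- (pi * (of_int k - s m)\<^sup>2 / t2)))"
      unfolding ex exp_add ..
    finally have 1: "ee (of_real (bqf c (- b) a (of_int m) (of_int k) / N) * (\<i> / of_real y)) = \<dots>" .
    have 2: "ee (of_real (of_int m * x1 + of_int k * x2)) = cis (2 * pi * of_int m * x1) * cis (2 * pi * of_int k * x2)"
      unfolding ee_of_real cis_mult by (simp add: algebra_simps)
    show ?thesis unfolding 1 2 g_def sq[symmetric] by (simp add: field_simps)
  qed
  have inner1: "(\<Sum>\<^sub>\<infinity>u. f u v) = (\<Sum>\<^sub>\<infinity>m. h v m)" for v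
  proof -
    have "(\<Sum>\<^sub>\<infinity>u. f u v) = of_real (exp (- (pi * t2 * (x2 + of_int v)\<^sup>2))) *
       (\<Sum>\<^sub>\<infinity>m::int. of_real (exp (- (pi * (of_int m - 0)\<^sup>2 / t1)) / sqrt t1) *
          cis (2 * pi * of_int m * (x1 + b * (x2 + of_int v) / (2 * a))))"
      unfolding f_eq by (subst infsum_cmult_right', subst gaussian_poisson[OF t(1)]) simp
    also have "\<dots> = (\<Sum>\<^sub>\<infinity>m. h v m)"
    proof -
      have "2 * pi * of_int m * (x1 + b * (x2 + of_int v) / (2 * a)) =
        2 * pi * of_int m * x1 + 2 * pi * s m * (x2 + of_int v)" for m :: int
        using a by (simp add: s_def field_simps)
      then show ?thesis
        unfolding infsum_cmult_right'[symmetric] h_def cis_mult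
        by (intro infsum_cong) (simp only: diff_0_right)
    qed
    finally show ?thesis .
  qed
  have inner2: "(\<Sum>\<^sub>\<infinity>v. h v m) = (\<Sum>\<^sub>\<infinity>k. g m k)" for m
  proof -
    have "(\<Sum>\<^sub>\<infinity>v. h v m) = (\<Sum>\<^sub>\<infinity>v. (of_real (exp (- (pi * (of_int m)\<^sup>2 / t1)) / sqrt t1) * cis (2 * pi * of_int m * x1)) *
       (of_real (exp (- (pi * t2 * (x2 + of_int v)\<^sup>2))) * cis (2 * pi * s m * (x2 + of_int v))))"
      by (intro infsum_cong) (simp add: h_def)
    also have "\<dots> = (\<Sum>\<^sub>\<infinity>k. g m k)"
      unfolding infsum_cmult_right' g_def by (subst gaussian_poisson[OF t(2)]) simp
    finally show ?thesis .
  qed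
  \<comment> \<open>Each Poisson step acts on the inner variable, so the order of summation is
    exchanged before the first step and between the two. Hence absolute summability of the original,
    the mixed and the dual double series.\<close>
  have f_sum: "(\<lambda>(u, v). f u v) summable_on UNIV"
  proof (rule abs_summable_summable)
    have "norm (f u v) = exp (- (2 * pi * y * bqf a b c (x1 + of_int u) (x2 + of_int v)))" for u v
      by (simp add: f_def norm_ee mult_ac)
    then show "(\<lambda>p. norm (case p of (u, v) \<Rightarrow> f u v)) summable_on UNIV"
      using bqf_summable[of a c b "2 * pi * y" x1 x2] a N y by (simp add: case_prod_unfold)
  qed
  have h_sum: "(\<lambda>(v, m). h v m) summable_on UNIV \<times> UNIV"
  proof (rule abs_summable_summable)
    have sv: "(\<lambda>v::int. exp (- (pi * t2 * (x2 + of_int v)\<^sup>2))) summable_on UNIV"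
    proof (rule summable_on_comparison_test)
      show "(\<lambda>v::int. max 1 (1 / (pi * t2)) * ((2 * (1 + \<bar>x2\<bar>\<^sup>2)) * (1 / (1 + (of_int v)\<^sup>2)))) summable_on UNIV"
        by (intro summable_on_cmult_right summable_on_int_inverse_square)
      fix v :: int
      have "exp (- ((pi * t2) * (x2 + of_int v)\<^sup>2)) \<le> max 1 (1 / (pi * t2)) * (1 / (1 + (x2 + of_int v)\<^sup>2))"
        using t by (intro gaussian_decay) simp
      also have "\<dots> \<le> max 1 (1 / (pi * t2)) * ((2 * (1 + \<bar>x2\<bar>\<^sup>2)) * (1 / (1 + (of_int v)\<^sup>2)))"
        by (intro mult_left_mono inverse_square_shift_bound) auto
      finally show "exp (- (pi * t2 * (x2 + of_int v)\<^sup>2)) \<le> max 1 (1 / (pi * t2)) * ((2 * (1 + \<bar>x2\<bar>\<^sup>2)) * (1 / (1 + (of_int v)\<^sup>2)))" .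
    qed simp
    have sm: "(\<lambda>m::int. exp (- (pi * (of_int m)\<^sup>2 / t1)) / sqrt t1) summable_on UNIV"
    proof (rule summable_on_comparison_test)
      show "(\<lambda>m::int. (max 1 (1 / (pi / t1)) / sqrt t1) * (1 / (1 + (of_int m)\<^sup>2))) summable_on UNIV"
        by (intro summable_on_cmult_right summable_on_int_inverse_square)
      fix m :: int
      have "exp (- ((pi / t1) * (of_int m)\<^sup>2)) \<le> max 1 (1 / (pi / t1)) * (1 / (1 + (of_int m)\<^sup>2))"
        using t by (intro gaussian_decay) simp
      then have "exp (- ((pi / t1) * (of_int m)\<^sup>2)) / sqrt t1 \<le> max 1 (1 / (pi / t1)) * (1 / (1 + (of_int m)\<^sup>2)) / sqrt t1"
        using t by (intro divide_right_mono) auto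
      then show "exp (- (pi * (of_int m)\<^sup>2 / t1)) / sqrt t1 \<le> (max 1 (1 / (pi / t1)) / sqrt t1) * (1 / (1 + (of_int m)\<^sup>2))"
        by (simp add: mult.commute)
    qed (use t in simp)
    have "(\<lambda>(v, m). exp (- (pi * t2 * (x2 + of_int v)\<^sup>2)) * (exp (- (pi * (of_int m)\<^sup>2 / t1)) / sqrt t1))
        summable_on (UNIV :: int set) \<times> (UNIV :: int set)"
      using t by (intro summable_on_product sv sm) auto
    then show "(\<lambda>p. norm (case p of (v, m) \<Rightarrow> h v m)) summable_on UNIV \<times> UNIV"
      using t by (simp add: case_prod_unfold h_def norm_mult norm_divide)
  qed
  have g_sum: "(\<lambda>(m, k). g m k) summable_on UNIV"
  proof (rule abs_summable_summable)
    have ng: "norm (g m k) = (1 / (y * sqrt N)) * exp (- (2 * pi / (y * N) * bqf c (- b) a (0 + of_int m) (0 + of_int k)))" for m k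
      unfolding g_eq norm_mult ee_of_real norm_cis norm_ee norm_of_real using y N by (simp add: field_simps)
    have "(\<lambda>p. norm (case p of (m, k) \<Rightarrow> g m k)) = (\<lambda>p. (1 / (y * sqrt N)) *
        (case p of (m, k) \<Rightarrow> exp (- (2 * pi / (y * N) * bqf c (- b) a (0 + of_int m) (0 + of_int k)))))"
      by (rule ext) (simp only: case_prod_unfold ng)
    moreover have "\<dots> summable_on UNIV"
      using c N y by (intro summable_on_cmult_right bqf_summable) (simp_all add: mult_ac)
    ultimately show "(\<lambda>p. norm (case p of (m, k) \<Rightarrow> g m k)) summable_on UNIV" by simp
  qed
  have "(\<Sum>\<^sub>\<infinity>(u, v)\<in>UNIV. f u v) = (\<Sum>\<^sub>\<infinity>u. \<Sum>\<^sub>\<infinity>v. f u v)"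
    using infsum_Sigma'_banach[of f UNIV "\<lambda>_. UNIV"] f_sum by simp
  also have "\<dots> = (\<Sum>\<^sub>\<infinity>v. \<Sum>\<^sub>\<infinity>u. f u v)"
    by (rule infsum_swap_banach) (use f_sum in simp)
  also have "\<dots> = (\<Sum>\<^sub>\<infinity>m. \<Sum>\<^sub>\<infinity>v. h v m)"
    unfolding inner1 by (rule infsum_swap_banach[OF h_sum])
  also have "\<dots> = (\<Sum>\<^sub>\<infinity>(m, k)\<in>UNIV. g m k)"
    unfolding inner2 using infsum_Sigma'_banach[of g UNIV "\<lambda>_. UNIV"] g_sum by simp
  also have "\<dots> = of_real (1 / (y * sqrt N)) * (\<Sum>\<^sub>\<infinity>(m, k)\<in>UNIV.
       ee (of_real (of_int m * x1 + of_int k * x2)) *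
       ee (of_real (bqf c (- b) a (of_int m) (of_int k) / N) * (\<i> / of_real y)))"
    unfolding g_eq case_prod_unfold by (rule infsum_cmult_right')
  finally show ?thesis by (simp only: f_def)
qed

lemma bqf_nonneg:
  fixes a b c :: real
  assumes "a > 0" "4 * a * c - b\<^sup>2 > 0"
  shows "bqf a b c x y \<ge> 0"
proof -
  obtain k where "k > 0" "bqf a b c x y \<ge> k * (x\<^sup>2 + y\<^sup>2)"
    using bqf_lower_bound[OF assms] by blast
  moreover have "k * (x\<^sup>2 + y\<^sup>2) \<ge> 0" using \<open>k > 0\<close> by simp
  ultimately show ?thesis by linarith
qed

lemma bqf_exp_summable:
  fixes a b c x y t :: real
  assumes "a > 0" "4 * a * c - b\<^sup>2 > 0" "t > 0"
  shows "(\<lambda>p. exp (- (2 * pi * t * (case p of (u, v) \<Rightarrow> bqf a b c (x + of_int u) (y + of_int v)))))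
    summable_on (UNIV :: (int \<times> int) set)"
  using bqf_summable[of a c b "2 * pi * t" x y] assms by (simp add: case_prod_unfold)

text \<open>Both sides are holomorphic on the upper half plane and agree on the imaginary axis,
  where i / (sqrt N z) becomes 1 / (y sqrt N); the identity theorem extends the formula.\<close>

theorem bqf_poisson:
  fixes a b c x1 x2 :: real
  assumes a: "a > 0" and N: "N = 4 * a * c - b\<^sup>2" "N > 0" and z: "Im z > 0"
  shows "(\<Sum>\<^sub>\<infinity>(u, v)\<in>(UNIV :: (int \<times> int) set).
            ee (of_real (bqf a b c (x1 + of_int u) (x2 + of_int v)) * z)) =
    \<i> / (of_real (sqrt N) * z) * (\<Sum>\<^sub>\<infinity>(m, k)\<in>(UNIV :: (int \<times> int) set).
       ee (of_real (of_int m * x1 + of_int k * x2)) *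
       ee (of_real (bqf c (- b) a (of_int m) (of_int k) / N) * (- 1 / z)))"
proof -
  have "4 * a * c > 0" using N zero_le_power2[of b] by linarith
  then have c: "c > 0" using a by (simp add: zero_less_mult_iff)
  define H where "H = {z::complex. Im z > 0}"
  have H: "open H" "connected H" unfolding H_def
    by (auto intro: open_halfspace_Im_gt convex_connected convex_halfspace_Im_gt)
  define L where "L z = (\<Sum>\<^sub>\<infinity>p\<in>UNIV. 1 * ee (of_real (case p of (u, v) \<Rightarrow>
      bqf a b c (x1 + of_int u) (x2 + of_int v)) * z))" for z
  define S where "S z = (\<Sum>\<^sub>\<infinity>p\<in>UNIV. ee (of_real (case p of (m, k) \<Rightarrow> of_int m * x1 + of_int k * x2)) *
     ee (of_real (case p of (m, k) \<Rightarrow> bqf c (- b) a (of_int m) (of_int k) / N) * z))" for z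
  have L: "L holomorphic_on H"
    unfolding L_def H_def
  proof (rule exp_series_holomorphic)
    show "(case p of (u, v) \<Rightarrow> bqf a b c (x1 + of_int u) (x2 + of_int v)) \<ge> 0" for p
      using bqf_nonneg[of a c b] a N by (auto split: prod.splits)
  qed (use a N bqf_exp_summable in auto)
  have S: "S holomorphic_on H"
    unfolding S_def H_def
  proof (rule exp_series_holomorphic)
    fix y :: real assume "y > 0"
    have "(\<lambda>p. exp (- (2 * pi * (y / N) * (case p of (u, v) \<Rightarrow> bqf c (- b) a (0 + of_int u) (0 + of_int v)))))
        summable_on (UNIV :: (int \<times> int) set)"
      using c N \<open>y > 0\<close> by (intro bqf_exp_summable) (simp_all add: mult_ac)
    then show "(\<lambda>p. exp (- (2 * pi * y * (case p of (m, k) \<Rightarrow> bqf c (- b) a (of_int m) (of_int k) / N))))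
        summable_on (UNIV :: (int \<times> int) set)"
      by (simp add: case_prod_unfold mult_ac)
  next
    show "(case p of (m, k) \<Rightarrow> bqf c (- b) a (of_int m) (of_int k) / N) \<ge> 0" for p
      using bqf_nonneg[of c a "- b"] c N by (auto split: prod.splits simp: mult_ac)
  qed (simp only: ee_of_real norm_cis)
  define D where "D z = L z - \<i> / (of_real (sqrt N) * z) * S (- 1 / z)" for z
  have nz: "w \<noteq> 0" if "w \<in> H" for w using that by (auto simp: H_def)
  have inv: "- 1 / w \<in> H" if "w \<in> H" for w
  proof -
    have "Im (- 1 / w) = Im w / (cmod w)\<^sup>2" by (simp add: Im_divide cmod_power2)
    then show ?thesis using that nz[OF that] by (simp add: H_def)
  qed
  have "(\<lambda>z. S (- 1 / z)) holomorphic_on H"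
    using nz inv by (intro holomorphic_on_compose_gen[OF _ S, unfolded o_def] holomorphic_intros) auto
  then have D: "D holomorphic_on H"
    unfolding D_def using N nz by (intro holomorphic_intros L) auto
  define U where "U = (\<lambda>y. \<i> * of_real y) ` {0<..}"
  have "D z = 0"
  proof (rule analytic_continuation[OF D H])
    show "U \<subseteq> H" by (auto simp: U_def H_def)
    show "\<i> \<in> H" by (simp add: H_def)
    show "\<i> islimpt U"
      unfolding islimpt_approachable
    proof (intro allI impI)
      fix e :: real assume "e > 0"
      then show "\<exists>x'\<in>U. x' \<noteq> \<i> \<and> dist x' \<i> < e"
        by (intro bexI[of _ "\<i> * of_real (1 + e / 2)"])
           (auto simp: U_def dist_norm algebra_simps norm_mult complex_eq_iff intro!: image_eqI[of _ _ "1 + e / 2"])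
    qed
    show "D w = 0" if w: "w \<in> U" for w
    proof -
      obtain y where y: "y > 0" "w = \<i> * of_real y" using w by (auto simp: U_def)
      have iw: "- 1 / w = \<i> / of_real y" and cw: "\<i> / (of_real (sqrt N) * w) = of_real (1 / (y * sqrt N))"
        using y by (simp_all add: field_simps)
      show ?thesis
        using bqf_poisson_imaginary[OF a N y(1), of x1 x2] unfolding D_def cw iw
        by (simp add: L_def S_def y(2) case_prod_unfold)
    qed
    show "z \<in> H" using z by (simp add: H_def)
  qed
  then show ?thesis by (simp add: D_def L_def S_def case_prod_unfold)
qed

section \<open>Expansion of the theta series at a rational point\<close>

definition bqf_theta :: "int \<Rightarrow> int \<Rightarrow> int \<Rightarrow> complex \<Rightarrow> complex" where
  "bqf_theta a b c z = (\<Sum>\<^sub>\<infinity>(u, v)\<in>UNIV. ee (of_int (bqf a b c u v) * z))"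

text \<open>The linear terms m r + k s are the phases that Poisson summation attaches to the residue
  class (r, s); with them the sum is exactly the coefficient at (m, k) of the dual series.\<close>

definition bqf_gauss_sum :: "int \<Rightarrow> int \<Rightarrow> int \<Rightarrow> int \<Rightarrow> int \<Rightarrow> int \<Rightarrow> int \<Rightarrow> complex" where
  "bqf_gauss_sum a b c p q m k =
     (\<Sum>(r, s)\<in>{0..<q} \<times> {0..<q}. ee (of_int (p * bqf a b c r s + m * r + k * s) / of_int q))"

lemma real_of_int_bqf: "real_of_int (bqf a b c x y) = bqf (of_int a) (of_int b) (of_int c) (of_int x) (of_int y)"
  by (simp add: bqf_def)

lemma complex_of_int_bqf:
  "complex_of_int (bqf a b c x y) =
     of_real (bqf (real_of_int a) (real_of_int b) (real_of_int c) (real_of_int x) (real_of_int y))"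
  by (simp add: bqf_def)

lemma ee_cong_mod:
  assumes "[x = y] (mod q)" "q \<noteq> 0"
  shows "ee (of_int x / of_int q) = ee (of_int y / of_int q)"
proof -
  obtain k where "x = y + q * k" using assms(1) by (metis cong_iff_lin cong_sym)
  then have "of_int x / of_int q = (of_int y / of_int q + of_int k :: complex)"
    using assms(2) by (simp add: field_simps)
  then show ?thesis by (simp only: ee_add_of_int)
qed

lemma norm_bqf_gauss_sum:
  assumes "q > 0"
  shows "norm (bqf_gauss_sum a b c p q m k) \<le> (of_int q)\<^sup>2"
proof -
  have "ee (of_int x / of_int q) = ee (of_real (of_int x / of_int q))" for x by simp
  then have "norm (ee (of_int x / of_int q)) = 1" for x
    by (simp only: ee_of_real norm_cis)
  then have "norm (bqf_gauss_sum a b c p q m k) \<le> (\<Sum>(r, s)\<in>{0..<q} \<times> {0..<q}. 1)"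
    unfolding bqf_gauss_sum_def by (intro sum_norm_le) (simp only: case_prod_unfold order_refl)
  also have "\<dots> = (of_int q)\<^sup>2" using assms by (simp add: power2_eq_square)
  finally show ?thesis .
qed

lemma summable_infsum_sum:
  fixes f :: "'i \<Rightarrow> 'a \<Rightarrow> complex"
  assumes "finite I" "\<And>i. i \<in> I \<Longrightarrow> f i summable_on A"
  shows "(\<lambda>x. \<Sum>i\<in>I. f i x) summable_on A \<and> (\<Sum>i\<in>I. infsum (f i) A) = (\<Sum>\<^sub>\<infinity>x\<in>A. \<Sum>i\<in>I. f i x)"
  using assms
  by (induction I rule: finite_induct) (auto simp: summable_on_add infsum_add)

lemmas infsum_sum = summable_infsum_sum[THEN conjunct2]

text \<open>\<open>N\<close> is minus the discriminant of the form and the determinant of its matrix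
  with rows (2a, b) and (b, 2c); it becomes the level.\<close>

locale posdef_bqf =
  fixes a b c N :: int
  assumes a: "a > 0" and N: "N = 4 * a * c - b\<^sup>2" and Npos: "N > 0"
begin

lemma c_pos: "c > 0"
proof -
  have "4 * a * c > 0" using N Npos zero_le_power2[of b] by linarith
  then show ?thesis using a by (simp add: zero_less_mult_iff)
qed

lemma real_pos: "real_of_int a > 0" "real_of_int N = 4 * of_int a * of_int c - (of_int b)\<^sup>2" "real_of_int N > 0"
  "real_of_int c > 0"
proof -
  show "real_of_int N > 0" using Npos by (simp only: of_int_0_less_iff)
qed (use a c_pos N in simp_all)

lemma real_disc: "4 * real_of_int a * real_of_int c - (real_of_int b)\<^sup>2 > 0"
  using real_pos by linarith

lemma real_disc': "4 * real_of_int c * real_of_int a - (- real_of_int b)\<^sup>2 > 0"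
  using real_disc by (simp add: mult_ac)

text \<open>Stated for arbitrary bounded coefficients because it is applied to pure phases and to
  Gauss sums alike.\<close>

lemma dual_summable:
  assumes "Im w > 0" "\<And>p. norm (f p) \<le> C"
  shows "(\<lambda>(m, k). norm (f (m, k) * ee (of_real (bqf (real_of_int c) (- real_of_int b) (real_of_int a) (of_int m) (of_int k) / N) * w))) summable_on (UNIV :: (int \<times> int) set)"
proof (rule summable_on_comparison_test)
  have "(\<lambda>p. C * exp (- (2 * pi * (Im w / N) * (case p of (u, v) \<Rightarrow> bqf (real_of_int c) (- real_of_int b) (real_of_int a) (0 + of_int u) (0 + of_int v)))))
        summable_on (UNIV :: (int \<times> int) set)"
    using assms real_pos real_disc' by (intro summable_on_cmult_right bqf_exp_summable) auto
  then show "(\<lambda>(u, v). C * exp (- (2 * pi * (bqf (real_of_int c) (- real_of_int b) (real_of_int a) (of_int u) (of_int v) / N * Im w)))) summable_on (UNIV :: (int \<times> int) set)"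
    by (simp add: case_prod_unfold mult_ac)
  show "(case p of (m, k) \<Rightarrow> norm (f (m, k) * ee (of_real (bqf (real_of_int c) (- real_of_int b) (real_of_int a) (of_int m) (of_int k) / N) * w))) \<le>
     (case p of (u, v) \<Rightarrow> C * exp (- (2 * pi * (bqf (real_of_int c) (- real_of_int b) (real_of_int a) (of_int u) (of_int v) / N * Im w))))" for p
  proof -
    obtain m k where p: "p = (m, k)" by (cases p)
    have "Im (of_real (bqf (real_of_int c) (- real_of_int b) (real_of_int a) (of_int m) (of_int k) / N) * w) = bqf (real_of_int c) (- real_of_int b) (real_of_int a) (of_int m) (of_int k) / N * Im w"
      by (simp only: Im_complex_of_real Re_complex_of_real times_complex.simps)
    then show ?thesis using assms(2)[of p]
      by (simp only: p case_prod_conv norm_mult norm_ee) (intro mult_right_mono; simp)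
  qed
qed auto

lemma bqf_theta_abs_summable:
  assumes "Im z > 0"
  shows "(\<lambda>p. norm (case p of (u, v) \<Rightarrow> ee (of_int (bqf a b c u v) * z))) summable_on UNIV"
proof -
  have "(\<lambda>p. exp (- (2 * pi * Im z * (case p of (u, v) \<Rightarrow> bqf (real_of_int a) (real_of_int b) (real_of_int c) (0 + of_int u) (0 + of_int v)))))
        summable_on (UNIV :: (int \<times> int) set)"
    using assms real_pos real_disc by (intro bqf_exp_summable) auto
  then show ?thesis by (simp add: case_prod_unfold norm_ee complex_of_int_bqf mult_ac)
qed

lemma bqf_theta_holomorphic: "bqf_theta a b c holomorphic_on {z. Im z > 0}"
proof -
  have "(\<lambda>z. \<Sum>\<^sub>\<infinity>p\<in>UNIV. 1 * ee (of_real (case p of (u, v) \<Rightarrow> bqf (real_of_int a) (real_of_int b) (real_of_int c) (0 + of_int u) (0 + of_int v)) * z))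
    holomorphic_on {z. Im z > 0}"
  proof (rule exp_series_holomorphic)
    fix y :: real assume "y > 0"
    then show "(\<lambda>p. exp (- (2 * pi * y * (case p of (u, v) \<Rightarrow> bqf (real_of_int a) (real_of_int b) (real_of_int c) (0 + of_int u) (0 + of_int v)))))
        summable_on (UNIV :: (int \<times> int) set)"
      by (intro bqf_exp_summable real_pos real_disc)
  next
    show "(case p of (u, v) \<Rightarrow> bqf (of_int a) (of_int b) (of_int c) (0 + of_int u) (0 + of_int v)) \<ge> (0::real)" for p :: "int \<times> int"
      using bqf_nonneg real_pos real_disc by (auto split: prod.splits)
  qed simp
  moreover have "bqf_theta a b c = (\<lambda>z. \<Sum>\<^sub>\<infinity>p\<in>UNIV. 1 * ee (of_real (case p of (u, v) \<Rightarrow> bqf (real_of_int a) (real_of_int b) (real_of_int c) (0 + of_int u) (0 + of_int v)) * z))"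
    unfolding bqf_theta_def by (auto intro!: infsum_cong simp: complex_of_int_bqf split: prod.splits)
  ultimately show ?thesis by simp
qed

text \<open>The factor exp(2 pi i p Q / q) depends on the residues modulo q alone, while Q(r + q u,
  s + q v) = q^2 Q(r/q + u, s/q + v). So each residue class contributes a constant times a shifted
  theta series in the variable q^2 t.\<close>

lemma bqf_theta_split:
  assumes q: "q > 0" and t: "Im t > 0"
  shows "bqf_theta a b c (of_int p / of_int q + t) = (\<Sum>(r, s)\<in>{0..<q} \<times> {0..<q}.
     ee (of_int (p * bqf a b c r s) / of_int q) * (\<Sum>\<^sub>\<infinity>(u, v)\<in>(UNIV :: (int \<times> int) set).
       ee (of_real (bqf (real_of_int a) (real_of_int b) (real_of_int c) (r / q + of_int u) (s / q + of_int v)) * ((of_int q)\<^sup>2 * t))))"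
proof -
  \<comment> \<open>\<open>h\<close> puts residues (r, s) and quotients (u, v) modulo
    \<open>q\<close> back together.\<close>
  define h where "h = (\<lambda>((r, s), (u, v)). (r + q * u, s + q * v))"
  define f where "f = (\<lambda>(u, v). ee (of_int (bqf a b c u v) * (of_int p / of_int q + t)))"
  have bij: "bij_betw h (({0..<q} \<times> {0..<q}) \<times> (UNIV :: (int \<times> int) set)) UNIV"
  proof (rule bij_betwI')
    fix x y assume xy: "x \<in> ({0..<q} \<times> {0..<q}) \<times> (UNIV :: (int \<times> int) set)" "y \<in> ({0..<q} \<times> {0..<q}) \<times> (UNIV :: (int \<times> int) set)"
    obtain r s u v r' s' u' v' where e: "x = ((r, s), (u, v))" "y = ((r', s'), (u', v'))"
      by (metis surj_pair)
    have uniq: "i = i' \<and> j = j'" if "i + q * j = i' + q * j'" "0 \<le> i" "i < q" "0 \<le> i'" "i' < q" for i j i' j' :: int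
    proof -
      have "(i + q * j) mod q = i" "(i' + q * j') mod q = i'" using that(2-5) by simp_all
      then have "i = i'" using that(1) by simp
      with that q show ?thesis by simp
    qed
    show "h x = h y \<longleftrightarrow> x = y" using xy unfolding e h_def by (auto dest: uniq)
  next
    fix y :: "int \<times> int"
    obtain u v where y: "y = (u, v)" by (cases y)
    have "y = h ((u mod q, v mod q), (u div q, v div q))" by (simp add: h_def y)
    then show "\<exists>x\<in>({0..<q} \<times> {0..<q}) \<times> UNIV. y = h x" using q by (intro bexI[of _ "((u mod q, v mod q), (u div q, v div q))"]) auto
  qed simp
  have "Im (of_int p / of_int q + t) > 0" using t by (simp add: Im_complex_of_real[of "p / q", simplified])
  then have fs: "(\<lambda>p. norm (f p)) summable_on UNIV" unfolding f_def by (rule bqf_theta_abs_summable)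
  have fs': "(\<lambda>x. norm (f (h x))) summable_on (({0..<q} \<times> {0..<q}) \<times> UNIV)"
    using summable_on_reindex_bij_betw[OF bij, of "\<lambda>p. norm (f p)"] fs by simp
  have "bqf_theta a b c (of_int p / of_int q + t) = infsum f UNIV" by (simp add: bqf_theta_def f_def)
  also have "\<dots> = (\<Sum>\<^sub>\<infinity>x\<in>({0..<q} \<times> {0..<q}) \<times> UNIV. f (h x))"
    by (rule infsum_reindex_bij_betw[OF bij, symmetric])
  also have "\<dots> = (\<Sum>\<^sub>\<infinity>rs\<in>{0..<q} \<times> {0..<q}. \<Sum>\<^sub>\<infinity>uv\<in>UNIV. f (h (rs, uv)))"
    by (rule infsum_Sigma_banach[symmetric, OF abs_summable_summable[OF fs']])
  also have "\<dots> = (\<Sum>rs\<in>{0..<q} \<times> {0..<q}. \<Sum>\<^sub>\<infinity>uv\<in>UNIV. f (h (rs, uv)))"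
    by (rule infsum_finite) simp
  also have "\<dots> = (\<Sum>(r, s)\<in>{0..<q} \<times> {0..<q}.
     ee (of_int (p * bqf a b c r s) / of_int q) * (\<Sum>\<^sub>\<infinity>(u, v)\<in>(UNIV :: (int \<times> int) set).
       ee (of_real (bqf (real_of_int a) (real_of_int b) (real_of_int c) (r / q + of_int u) (s / q + of_int v)) * ((of_int q)\<^sup>2 * t))))"
  proof (intro sum.cong refl, clarify)
    fix r s
    have "f (h ((r, s), (u, v))) = ee (of_int (p * bqf a b c r s) / of_int q) *
       ee (of_real (bqf (real_of_int a) (real_of_int b) (real_of_int c) (r / q + of_int u) (s / q + of_int v)) * ((of_int q)\<^sup>2 * t))" for u v
    proof -
      define e where "e = bqf a b c (r + q * u) (s + q * v)"
      have "e - bqf a b c r s = q * (2 * a * r * u + a * q * u\<^sup>2 + b * (r * v + u * s + q * u * v) + 2 * c * s * v + c * q * v\<^sup>2)"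
        by (simp add: e_def bqf_def power2_eq_square algebra_simps)
      then have "[p * e = p * bqf a b c r s] (mod q)"
        by (intro cong_scalar_left) (simp add: cong_iff_dvd_diff)
      then have 1: "ee (of_int (p * e) / of_int q) = ee (of_int (p * bqf a b c r s) / of_int q)"
        using q by (intro ee_cong_mod) auto
      have "(of_int q)\<^sup>2 * bqf (real_of_int a) (real_of_int b) (real_of_int c) (r / q + of_int u) (s / q + of_int v) = (of_int e :: real)"
        using q by (simp add: e_def bqf_def field_simps power2_eq_square)
      then have "of_real (bqf (real_of_int a) (real_of_int b) (real_of_int c) (r / q + of_int u) (s / q + of_int v)) * (of_int q)\<^sup>2 = (of_int e :: complex)"
        by (metis mult.commute of_real_mult of_real_of_int_eq of_real_power)
      then have 2: "of_real (bqf (real_of_int a) (real_of_int b) (real_of_int c) (r / q + of_int u) (s / q + of_int v)) * ((of_int q)\<^sup>2 * t) = of_int e * t"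
        by (simp only: mult.assoc[symmetric])
      have "f (h ((r, s), (u, v))) = ee (of_int (p * e) / of_int q + of_int e * t)"
        by (simp add: f_def h_def e_def ring_distribs mult.commute)
      then show ?thesis unfolding 2 1[symmetric] ee_add .
    qed
    then show "(\<Sum>\<^sub>\<infinity>uv\<in>UNIV. f (h ((r, s), uv))) = ee (of_int (p * bqf a b c r s) / of_int q) * (\<Sum>\<^sub>\<infinity>(u, v)\<in>(UNIV :: (int \<times> int) set).
       ee (of_real (bqf (real_of_int a) (real_of_int b) (real_of_int c) (r / q + of_int u) (s / q + of_int v)) * ((of_int q)\<^sup>2 * t)))"
      by (subst infsum_cmult_right'[symmetric]) (auto intro!: infsum_cong split: prod.splits)
  qed
  finally show ?thesis .
qed

text \<open>\<open>bqf_poisson\<close> with the shift (r/q, s/q) in every class; its phases, summed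
  over the classes against the constants of \<open>bqf_theta_split\<close>, are the twisted Gauss
  sums.\<close>

lemma bqf_theta_rational:
  assumes q: "q > 0" and t: "Im t > 0"
  shows "bqf_theta a b c (of_int p / of_int q + t) =
    \<i> / (of_real (sqrt N) * ((of_int q)\<^sup>2 * t)) * (\<Sum>\<^sub>\<infinity>(m, k)\<in>(UNIV :: (int \<times> int) set).
       bqf_gauss_sum a b c p q m k * ee (of_real (bqf (real_of_int c) (- real_of_int b) (real_of_int a) (of_int m) (of_int k) / N) * (- 1 / ((of_int q)\<^sup>2 * t))))"
proof -
  define w where "w = (of_int q)\<^sup>2 * t"
  have "(of_int q)\<^sup>2 * t = of_real ((of_int q)\<^sup>2) * t" by simp
  then have w: "Im w > 0" using q t unfolding w_def by (simp only: Im_complex_of_real Re_complex_of_real times_complex.simps) simp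
  then have w0: "w \<noteq> 0" by auto
  have "Im (- 1 / w) = Im w / (cmod w)\<^sup>2" by (simp add: Im_divide cmod_power2)
  then have iw: "Im (- 1 / w) > 0" using w w0 by simp
  define A where "A = (\<lambda>(m, k). ee (of_real (bqf (real_of_int c) (- real_of_int b) (real_of_int a) (of_int m) (of_int k) / N) * (- 1 / w)))"
  define E where "E r s = ee (of_int (p * bqf a b c r s) / of_int q)" for r s
  define F where "F r s = (\<lambda>(m, k). ee (of_real (of_int m * (r / q) + of_int k * (s / q))))" for r s :: int
  have "bqf_theta a b c (of_int p / of_int q + t) = (\<Sum>(r, s)\<in>{0..<q} \<times> {0..<q}.
     E r s * (\<i> / (of_real (sqrt N) * w) * (\<Sum>\<^sub>\<infinity>p\<in>(UNIV :: (int \<times> int) set). F r s p * A p)))"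
    unfolding bqf_theta_split[OF q t] w_def[symmetric] bqf_poisson[OF real_pos(1,2,3) w] E_def F_def A_def
    by (simp add: case_prod_unfold)
  also have "\<dots> = \<i> / (of_real (sqrt N) * w) * (\<Sum>rs\<in>{0..<q} \<times> {0..<q}. \<Sum>\<^sub>\<infinity>p\<in>UNIV. E (fst rs) (snd rs) * (F (fst rs) (snd rs) p * A p))"
    unfolding case_prod_unfold sum_distrib_left infsum_cmult_right'
    by (intro sum.cong refl mult.left_commute)
  also have "(\<Sum>rs\<in>{0..<q} \<times> {0..<q}. \<Sum>\<^sub>\<infinity>p\<in>UNIV. E (fst rs) (snd rs) * (F (fst rs) (snd rs) p * A p)) =
     (\<Sum>\<^sub>\<infinity>p\<in>UNIV. \<Sum>rs\<in>{0..<q} \<times> {0..<q}. E (fst rs) (snd rs) * (F (fst rs) (snd rs) p * A p))"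
  proof (rule infsum_sum)
    fix rs :: "int \<times> int"
    have "(\<lambda>(m, k). norm (F (fst rs) (snd rs) (m, k) * ee (of_real (bqf (real_of_int c) (- real_of_int b) (real_of_int a) (of_int m) (of_int k) / N) * (- 1 / w)))) summable_on UNIV"
      by (rule dual_summable[OF iw, of _ 1]) (simp only: F_def case_prod_unfold ee_of_real norm_cis)
    then have "(\<lambda>p. norm (F (fst rs) (snd rs) p * A p)) summable_on UNIV"
      by (simp add: A_def case_prod_unfold)
    then show "(\<lambda>p. E (fst rs) (snd rs) * (F (fst rs) (snd rs) p * A p)) summable_on UNIV"
      by (rule summable_on_cmult_right[OF abs_summable_summable])
  qed simp
  also have "\<dots> = (\<Sum>\<^sub>\<infinity>(m, k)\<in>UNIV. bqf_gauss_sum a b c p q m k * A (m, k))"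
  proof (intro infsum_cong, clarify)
    fix m k :: int
    have "E r s * F r s (m, k) = ee (of_int (p * bqf a b c r s + m * r + k * s) / of_int q)" for r s
    proof -
      have "of_int (p * bqf a b c r s + m * r + k * s) / of_int q =
        (of_int (p * bqf a b c r s) / of_int q + of_real (of_int m * (r / q) + of_int k * (s / q)) :: complex)"
        by (simp add: add_divide_distrib)
      then show ?thesis by (simp only: E_def F_def case_prod_conv ee_add)
    qed
    then show "(\<Sum>rs\<in>{0..<q} \<times> {0..<q}. E (fst rs) (snd rs) * (F (fst rs) (snd rs) (m, k) * A (m, k))) =
      bqf_gauss_sum a b c p q m k * A (m, k)"
      by (simp add: bqf_gauss_sum_def case_prod_unfold sum_distrib_right mult.assoc[symmetric])
  qed
  finally show ?thesis by (simp add: A_def w_def case_prod_unfold)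
qed

end

lemma sum_periodic_shift:
  fixes f :: "int \<Rightarrow> 'b::comm_monoid_add"
  assumes "q > 0" and per: "\<And>x y. [x = y] (mod q) \<Longrightarrow> f x = f y"
  shows "(\<Sum>r\<in>{0..<q}. f (r + t)) = (\<Sum>r\<in>{0..<q}. f r)"
proof (rule sum.reindex_bij_witness[of _ "\<lambda>r. (r - t) mod q" "\<lambda>r. (r + t) mod q"])
  fix r assume r: "r \<in> {0..<q}"
  show "((r + t) mod q - t) mod q = r" using r by (simp add: mod_diff_left_eq)
  show "((r - t) mod q + t) mod q = r" using r by (simp add: mod_add_left_eq)
  show "f ((r + t) mod q) = f (r + t)" by (rule per) (simp add: cong_def)
qed (use assms in auto)

section \<open>Transformation law with a Gauss sum, and bounds at the cusps\<close>

context posdef_bqf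
begin

text \<open>Completing the square modulo q. The determinant relation says that p N g is -1 modulo q,
  so the vector (m, k), multiplied by -g times the adjugate of the matrix of the form, is the shift
  \<open>(s1, s2)\<close> that absorbs the linear terms. The leftover is g times the dual form at
  (m, k).\<close>

lemma bqf_gauss_sum_shift:
  assumes det: "\<alpha> * q - p * (N * g) = 1" and q: "q > 0"
  shows "bqf_gauss_sum a b c p q m k =
    ee (of_int (g * bqf c (- b) a m k) / of_int q) * bqf_gauss_sum a b c p q 0 0"
proof -
  define s1 where "s1 = - g * (2 * c * m - b * k)"
  define s2 where "s2 = - g * (2 * a * k - b * m)"
  define W where "W = bqf c (- b) a m k"
  define F where "F r s = ee (of_int (p * bqf a b c r s) / of_int q)" for r s
  have F_cong: "F r s = F r' s'" if "[r = r'] (mod q)" "[s = s'] (mod q)" for r s r' s'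
    unfolding F_def using that q
    by (intro ee_cong_mod cong_scalar_left) (auto simp: bqf_def intro!: cong_add cong_mult cong_pow cong_refl)
  have eq: "ee (of_int (p * bqf a b c r s + m * r + k * s) / of_int q) = ee (of_int (g * W) / of_int q) * F (r + s1) (s + s2)" for r s
  proof -
    have "bqf a b c (r + s1) (s + s2) = bqf a b c r s + (r * (2 * a * s1 + b * s2) + s * (b * s1 + 2 * c * s2)) + bqf a b c s1 s2"
      by (simp add: bqf_def power2_eq_square algebra_simps)
    also have "r * (2 * a * s1 + b * s2) + s * (b * s1 + 2 * c * s2) = - (g * N * (r * m + s * k))"
      by (simp add: s1_def s2_def N power2_eq_square algebra_simps)
    also have "bqf a b c s1 s2 = g * N * (g * W)"
      by (simp add: s1_def s2_def N W_def bqf_def power2_eq_square algebra_simps)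
    finally have "p * bqf a b c (r + s1) (s + s2) = p * (bqf a b c r s + - (g * N * (r * m + s * k)) + g * N * (g * W))"
      by (rule arg_cong)
    also have "\<dots> = p * bqf a b c r s - p * (N * g) * (r * m + s * k) + p * (N * g) * (g * W)"
      by (simp add: algebra_simps)
    also have "p * (N * g) = \<alpha> * q - 1" using det by simp
    finally have "g * W + p * bqf a b c (r + s1) (s + s2) = p * bqf a b c r s + m * r + k * s + q * (\<alpha> * (g * W - (r * m + s * k)))"
      by (simp add: algebra_simps)
    then have "[p * bqf a b c r s + m * r + k * s = g * W + p * bqf a b c (r + s1) (s + s2)] (mod q)"
      by (simp add: cong_iff_lin)
    then have "ee (of_int (p * bqf a b c r s + m * r + k * s) / of_int q) = ee (of_int (g * W + p * bqf a b c (r + s1) (s + s2)) / of_int q)"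
      using q by (intro ee_cong_mod) auto
    then show ?thesis by (simp add: F_def ee_add[symmetric] add_divide_distrib)
  qed
  have "bqf_gauss_sum a b c p q m k = ee (of_int (g * W) / of_int q) * (\<Sum>r\<in>{0..<q}. \<Sum>s\<in>{0..<q}. F (r + s1) (s + s2))"
    unfolding bqf_gauss_sum_def eq sum.cartesian_product[symmetric] by (simp add: sum_distrib_left)
  also have "(\<Sum>r\<in>{0..<q}. \<Sum>s\<in>{0..<q}. F (r + s1) (s + s2)) = (\<Sum>r\<in>{0..<q}. \<Sum>s\<in>{0..<q}. F (r + s1) s)"
    by (intro sum.cong refl sum_periodic_shift[OF q] F_cong cong_refl)
  also have "\<dots> = (\<Sum>r\<in>{0..<q}. \<Sum>s\<in>{0..<q}. F r s)"
    by (intro sum_periodic_shift[OF q] sum.cong refl F_cong cong_refl)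
  also have "\<dots> = bqf_gauss_sum a b c p q 0 0"
    by (simp add: bqf_gauss_sum_def F_def sum.cartesian_product)
  finally show ?thesis by (simp add: W_def)
qed

lemma Im_moebius:
  assumes "\<alpha> * \<delta> - \<beta> * \<gamma> = (1::int)" "Im z > 0"
  shows "of_int \<gamma> * z + of_int \<delta> \<noteq> 0"
    and "Im ((of_int \<alpha> * z + of_int \<beta>) / (of_int \<gamma> * z + of_int \<delta>)) = Im z / (cmod (of_int \<gamma> * z + of_int \<delta>))\<^sup>2"
proof -
  have "\<gamma> \<noteq> 0 \<or> \<delta> \<noteq> 0" using assms(1) by auto
  then show "of_int \<gamma> * z + of_int \<delta> \<noteq> 0" using assms(2) by (auto simp: complex_eq_iff)
  have "Im ((of_int \<alpha> * z + of_int \<beta>) / (of_int \<gamma> * z + of_int \<delta>)) =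
     (of_int \<alpha> * of_int \<delta> - of_int \<beta> * of_int \<gamma>) * Im z / (cmod (of_int \<gamma> * z + of_int \<delta>))\<^sup>2"
    unfolding Im_divide cmod_power2 by (simp add: algebra_simps)
  also have "of_int \<alpha> * of_int \<delta> - of_int \<beta> * of_int \<gamma> = (1 :: real)"
    using assms(1) by (metis of_int_1 of_int_diff of_int_mult)
  finally show "Im ((of_int \<alpha> * z + of_int \<beta>) / (of_int \<gamma> * z + of_int \<delta>)) = Im z / (cmod (of_int \<gamma> * z + of_int \<delta>))\<^sup>2"
    by simp
qed

lemma bqf_theta_transform:
  assumes det: "\<alpha> * \<delta> - \<beta> * \<gamma> = 1" and dvd: "N dvd \<gamma>" and pos: "\<delta> > 0" and z: "Im z > 0"
  shows "bqf_theta a b c ((of_int \<alpha> * z + of_int \<beta>) / (of_int \<gamma> * z + of_int \<delta>)) =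
    bqf_gauss_sum a b c \<beta> \<delta> 0 0 / of_int \<delta> * (of_int \<gamma> * z + of_int \<delta>) * bqf_theta a b c z"
proof -
  obtain g where g: "\<gamma> = N * g" using dvd by (auto elim: dvdE)
  define j where "j = of_int \<gamma> * z + of_int \<delta>"
  have j0: "j \<noteq> 0" unfolding j_def by (rule Im_moebius(1)[OF det z])
  have z0: "z \<noteq> 0" using z by auto
  \<comment> \<open>The displacement of the transformed point from \<beta>/\<delta>, computed with
    the determinant relation.\<close>
  define t where "t = z / (of_int \<delta> * j)"
  have detc: "of_int \<alpha> * of_int \<delta> - of_int \<beta> * of_int \<gamma> = (1::complex)"
    using det by (metis of_int_1 of_int_diff of_int_mult)
  have "of_int \<delta> * (of_int \<alpha> * z + of_int \<beta>) = of_int \<beta> * j + z * (of_int \<alpha> * of_int \<delta> - of_int \<beta> * of_int \<gamma>)"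
    by (simp add: j_def algebra_simps)
  then have gz: "(of_int \<alpha> * z + of_int \<beta>) / j = of_int \<beta> / of_int \<delta> + t"
    unfolding detc using pos j0 by (simp add: t_def field_simps)
  have "Im ((of_int \<alpha> * z + of_int \<beta>) / j) > 0"
    using Im_moebius(2)[OF det z] j0 z by (simp add: j_def)
  then have t: "Im t > 0" unfolding gz by (simp add: Im_complex_of_real[of "\<beta> / \<delta>", simplified])
  \<comment> \<open>The dual variable is -1/z up to the rational translation -\<gamma>/\<delta>. On
    the dual form that translation contributes the phase -g W / \<delta>, inverse to the one of
    \<open>bqf_gauss_sum_shift\<close>.\<close>
  have inv: "- 1 / ((of_int \<delta>)\<^sup>2 * t) = - of_int \<gamma> / of_int \<delta> - 1 / z"
    using pos z0 j0 by (simp add: t_def field_simps power2_eq_square) (simp add: j_def algebra_simps)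
  define A where "A = (\<lambda>(m, k). ee (of_real (bqf (real_of_int c) (- real_of_int b) (real_of_int a) (of_int m) (of_int k) / N) * (- 1 / z)))"
  define G where "G = bqf_gauss_sum a b c \<beta> \<delta> 0 0"
  have trm: "bqf_gauss_sum a b c \<beta> \<delta> m k * ee (of_real (bqf (real_of_int c) (- real_of_int b) (real_of_int a) (of_int m) (of_int k) / N) *
     (- 1 / ((of_int \<delta>)\<^sup>2 * t))) = G * A (m, k)" for m k
  proof -
    define W where "W = bqf c (- b) a m k"
    have W: "bqf (real_of_int c) (- real_of_int b) (real_of_int a) (of_int m) (of_int k) = of_int W"
      using real_of_int_bqf[of c "- b" a m k] by (simp add: W_def)
    have "of_real (of_int W / of_int N) * (- of_int \<gamma> / of_int \<delta> - 1 / z) =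
      - (of_int (g * W) / of_int \<delta>) + of_real (of_int W / of_int N) * (- 1 / z)"
      using pos Npos z0 by (simp add: g field_simps)
    then have "ee (of_real (of_int W / of_int N) * (- 1 / ((of_int \<delta>)\<^sup>2 * t))) =
       ee (- (of_int (g * W) / of_int \<delta>)) * A (m, k)"
      unfolding inv A_def case_prod_conv W by (simp only: ee_add)
    moreover have "bqf_gauss_sum a b c \<beta> \<delta> m k = ee (of_int (g * W) / of_int \<delta>) * G"
      unfolding G_def W_def by (rule bqf_gauss_sum_shift) (use det pos g in auto)
    moreover have "ee (of_int (g * W) / of_int \<delta>) * ee (- (of_int (g * W) / of_int \<delta>)) = 1"
      by (simp only: ee_add[symmetric] add.right_inverse ee_0)
    ultimately show ?thesis unfolding W by (simp only: mult.assoc mult.left_commute) simp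
  qed
  have h1: "bqf_theta a b c ((of_int \<alpha> * z + of_int \<beta>) / j) =
    \<i> / (of_real (sqrt N) * ((of_int \<delta>)\<^sup>2 * t)) * (G * infsum A UNIV)"
    unfolding gz bqf_theta_rational[OF pos t] trm by (simp add: case_prod_unfold infsum_cmult_right')
  \<comment> \<open>The same expansion at 0/1, where every Gauss sum is 1: it recognises the
    remaining dual series as the theta series at z.\<close>
  have h2: "bqf_theta a b c z = \<i> / (of_real (sqrt N) * z) * infsum A UNIV"
    using bqf_theta_rational[of 1 z 0] z
    by (simp add: bqf_gauss_sum_def A_def case_prod_unfold atLeastLessThanPlusOne_atLeastAtMost_int[of 0 0, simplified])
  have h3: "1 / ((of_int \<delta>)\<^sup>2 * t) = j / of_int \<delta> / z"
    using pos z0 j0 by (simp add: t_def field_simps power2_eq_square)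
  have "\<i> / (of_real (sqrt N) * ((of_int \<delta>)\<^sup>2 * t)) * (G * infsum A UNIV) =
    \<i> / of_real (sqrt N) * (G * infsum A UNIV) * (1 / ((of_int \<delta>)\<^sup>2 * t))"
    by simp
  also have "\<dots> = G / of_int \<delta> * j * (\<i> / (of_real (sqrt N) * z) * infsum A UNIV)"
    unfolding h3 by (simp add: mult_ac)
  finally show ?thesis
    unfolding j_def[symmetric] h1 h2 by (simp only: G_def)
qed

text \<open>The form is nonnegative, so the terms shrink in absolute value as Im z grows, and the
  series of absolute values at z = i is a bound.\<close>

lemma bqf_theta_bounded:
  obtains C where "\<And>z. Im z \<ge> 1 \<Longrightarrow> norm (bqf_theta a b c z) \<le> C"
proof
  fix z :: complex assume z: "Im z \<ge> 1"
  have s1: "(\<lambda>p. norm (case p of (u, v) \<Rightarrow> ee (of_int (bqf a b c u v) * z))) summable_on UNIV"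
    using z by (intro bqf_theta_abs_summable) auto
  have s2: "(\<lambda>p. norm (case p of (u, v) \<Rightarrow> ee (of_int (bqf a b c u v) * \<i>))) summable_on UNIV"
    by (intro bqf_theta_abs_summable) auto
  have "norm (bqf_theta a b c z) \<le> (\<Sum>\<^sub>\<infinity>p\<in>UNIV. norm (case p of (u, v) \<Rightarrow> ee (of_int (bqf a b c u v) * z)))"
    unfolding bqf_theta_def by (rule norm_infsum_bound[OF s1])
  also have "\<dots> \<le> (\<Sum>\<^sub>\<infinity>p\<in>UNIV. norm (case p of (u, v) \<Rightarrow> ee (of_int (bqf a b c u v) * \<i>)))"
  proof (rule infsum_mono[OF s1 s2])
    fix p :: "int \<times> int"
    obtain u v where p: "p = (u, v)" by (cases p)
    define r where "r = bqf (real_of_int a) (real_of_int b) (real_of_int c) (of_int u) (of_int v)"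
    have "r \<ge> 0" unfolding r_def by (rule bqf_nonneg[OF real_pos(1) real_disc])
    then have "r * 1 \<le> r * Im z" using z by (rule mult_left_mono[rotated])
    then show "norm (case p of (u, v) \<Rightarrow> ee (of_int (bqf a b c u v) * z)) \<le> norm (case p of (u, v) \<Rightarrow> ee (of_int (bqf a b c u v) * \<i>))"
      by (simp add: p complex_of_int_bqf norm_ee r_def)
  qed
  finally show "norm (bqf_theta a b c z) \<le> (\<Sum>\<^sub>\<infinity>p\<in>UNIV. norm (case p of (u, v) \<Rightarrow> ee (of_int (bqf a b c u v) * \<i>)))" .
qed

text \<open>Here the expansion is at \<alpha>/\<gamma>, the image of infinity, because then
  -1/(\<gamma>^2 t) = z + \<delta>/\<gamma> keeps the imaginary part of z. The dual series is
  bounded by its majorant at height 1, with the Gauss sums estimated by \<gamma>^2, and the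
  prefactor is proportional to the automorphy factor.\<close>

lemma bqf_theta_cusp_bounded:
  assumes det: "\<alpha> * \<delta> - \<beta> * \<gamma> = 1" and pos: "\<gamma> > 0"
  obtains C where "\<And>z. Im z \<ge> 1 \<Longrightarrow> norm (bqf_theta a b c ((of_int \<alpha> * z + of_int \<beta>) / (of_int \<gamma> * z + of_int \<delta>))) \<le>
    C * norm (of_int \<gamma> * z + of_int \<delta>)"
proof -
  define W where "W = (\<lambda>(m, k). bqf (real_of_int c) (- real_of_int b) (real_of_int a) (of_int m) (of_int k) / N)"
  define K where "K = (\<Sum>\<^sub>\<infinity>p\<in>UNIV. (of_int \<gamma>)\<^sup>2 * exp (- (2 * pi * W p)))"
  have W0: "W p \<ge> 0" for p
    using bqf_nonneg[OF real_pos(4) real_disc'] real_pos by (auto simp: W_def split: prod.splits)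
  have main: "norm (bqf_theta a b c ((of_int \<alpha> * z + of_int \<beta>) / (of_int \<gamma> * z + of_int \<delta>))) \<le>
     (K / (sqrt N * \<gamma>)) * norm (of_int \<gamma> * z + of_int \<delta>)" if z1: "Im z \<ge> 1" for z
  proof -
    have z: "Im z > 0" using z1 by simp
    define j where "j = of_int \<gamma> * z + of_int \<delta>"
    have j0: "j \<noteq> 0" unfolding j_def by (rule Im_moebius(1)[OF det z])
    define t where "t = - 1 / (of_int \<gamma> * j)"
    have detc: "of_int \<alpha> * of_int \<delta> - of_int \<beta> * of_int \<gamma> = (1::complex)"
      using det by (metis of_int_1 of_int_diff of_int_mult)
    have "of_int \<gamma> * (of_int \<alpha> * z + of_int \<beta>) = of_int \<alpha> * j - (of_int \<alpha> * of_int \<delta> - of_int \<beta> * of_int \<gamma>)"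
      by (simp add: j_def algebra_simps)
    then have "of_int \<alpha> * z + of_int \<beta> = (of_int \<alpha> * j - 1) / of_int \<gamma>"
      unfolding detc using pos by (simp add: nonzero_eq_divide_eq mult.commute)
    then have gz: "(of_int \<alpha> * z + of_int \<beta>) / j = of_int \<alpha> / of_int \<gamma> + t"
      using pos j0 by (simp only:) (simp add: t_def field_simps)
    have "Im ((of_int \<alpha> * z + of_int \<beta>) / j) > 0"
      using Im_moebius(2)[OF det z] j0 z by (simp add: j_def)
    then have t: "Im t > 0" unfolding gz by (simp add: Im_complex_of_real[of "\<alpha> / \<gamma>", simplified])
    have inv: "- 1 / ((of_int \<gamma>)\<^sup>2 * t) = z + of_real (\<delta> / \<gamma>)"
      using pos j0 by (simp add: t_def field_simps power2_eq_square) (simp add: j_def algebra_simps)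
    define f where "f = (\<lambda>(m, k). bqf_gauss_sum a b c \<alpha> \<gamma> m k)"
    define B where "B = (\<lambda>p. f p * ee (of_real (W p) * (z + of_real (\<delta> / \<gamma>))))"
    have nf: "norm (f p) \<le> (of_int \<gamma>)\<^sup>2" for p
      using norm_bqf_gauss_sum[OF pos] by (auto simp: f_def split: prod.splits)
    have imz: "Im (z + of_real (\<delta> / \<gamma>)) > 0" using z by (simp del: of_real_divide)
    have s1: "(\<lambda>p. norm (B p)) summable_on UNIV"
      using dual_summable[OF imz nf] by (simp add: B_def W_def case_prod_unfold)
    have "(\<lambda>p. (of_int \<gamma>)\<^sup>2 * exp (- (2 * pi * (1 / N) * (case p of (u, v) \<Rightarrow> bqf (real_of_int c) (- real_of_int b) (real_of_int a) (0 + of_int u) (0 + of_int v)))))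
        summable_on (UNIV :: (int \<times> int) set)"
      by (rule summable_on_cmult_right, rule bqf_exp_summable) (use real_pos real_disc' in auto)
    then have s2: "(\<lambda>p. (of_int \<gamma>)\<^sup>2 * exp (- (2 * pi * W p))) summable_on UNIV"
      by (simp add: W_def case_prod_unfold)
    have "norm (infsum B UNIV) \<le> (\<Sum>\<^sub>\<infinity>p. norm (B p))" by (rule norm_infsum_bound[OF s1])
    also have "\<dots> \<le> K" unfolding K_def
    proof (rule infsum_mono[OF s1 s2])
      fix p
      have "Im (of_real (W p) * (z + of_real (\<delta> / \<gamma>))) = W p * Im z" by simp
      moreover have "W p * 1 \<le> W p * Im z" using z1 W0 by (intro mult_left_mono)
      ultimately have "norm (ee (of_real (W p) * (z + of_real (\<delta> / \<gamma>)))) \<le> exp (- (2 * pi * W p))"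
        by (simp only: norm_ee) simp
      then show "norm (B p) \<le> (of_int \<gamma>)\<^sup>2 * exp (- (2 * pi * W p))"
        unfolding B_def norm_mult using nf by (intro mult_mono) auto
    qed
    finally have nB: "norm (infsum B UNIV) \<le> K" .
    have "bqf_theta a b c ((of_int \<alpha> * z + of_int \<beta>) / j) = \<i> / (of_real (sqrt N) * ((of_int \<gamma>)\<^sup>2 * t)) * infsum B UNIV"
      unfolding gz bqf_theta_rational[OF pos t] inv by (simp add: B_def f_def W_def case_prod_unfold)
    also have "\<i> / (of_real (sqrt N) * ((of_int \<gamma>)\<^sup>2 * t)) = - \<i> * (j / of_real (sqrt N * \<gamma>))"
      using pos j0 Npos by (simp add: t_def field_simps power2_eq_square)
    finally have "norm (bqf_theta a b c ((of_int \<alpha> * z + of_int \<beta>) / j)) = norm j / (sqrt N * \<gamma>) * norm (infsum B UNIV)"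
      using pos Npos by (simp add: norm_mult norm_divide)
    also have "\<dots> \<le> norm j / (sqrt N * \<gamma>) * K"
      using pos Npos by (intro mult_left_mono nB) auto
    finally show ?thesis by (simp add: j_def mult_ac)
  qed
  show ?thesis by (rule that[OF main])
qed

end

section \<open>Gauss sums and modularity\<close>

definition eeq :: "int \<Rightarrow> int \<Rightarrow> complex" where "eeq x q = ee (of_int x / of_int q)"

lemma eeq_add: "eeq (x + y) q = eeq x q * eeq y q"
  by (simp add: eeq_def add_divide_distrib ee_add)

lemma eeq_cong: "[x = y] (mod q) \<Longrightarrow> q \<noteq> 0 \<Longrightarrow> eeq x q = eeq y q"
  unfolding eeq_def by (rule ee_cong_mod)

lemma eeq_0 [simp]: "eeq 0 q = 1" by (simp add: eeq_def)

lemma eeq_eq_1_iff: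
  assumes "q \<noteq> 0"
  shows "eeq x q = 1 \<longleftrightarrow> q dvd x"
proof
  assume "eeq x q = 1"
  then obtain n :: int where "2 * of_real pi * (of_int x / of_int q) = (complex_of_real (of_int (2 * n) * pi))"
    unfolding eeq_def ee_def exp_eq_1 by (auto simp: complex_eq_iff Re_divide Im_divide)
  then have "complex_of_int x = of_int q * of_int n" using assms by (simp add: field_simps)
  then have "x = q * n" by (metis of_int_eq_iff of_int_mult)
  then show "q dvd x" by simp
next
  assume "q dvd x"
  then show "eeq x q = 1" using eeq_cong[of x 0 q] assms by (simp add: cong_0_iff)
qed

lemma eeq_mult_cancel: "l \<noteq> 0 \<Longrightarrow> eeq (l * x) (l * q) = eeq x q"
  by (simp add: eeq_def)

text \<open>If q does not divide x, translating y by 1 multiplies the sum by \<open>eeq x q\<close>,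
  which differs from 1.\<close>

lemma sum_eeq:
  assumes "q > 0"
  shows "(\<Sum>y\<in>{0..<q}. eeq (x * y) q) = (if q dvd x then of_int q else 0)"
proof (cases "q dvd x")
  case True
  then have "eeq (x * y) q = 1" for y using assms by (subst eeq_eq_1_iff) auto
  then show ?thesis using True assms by simp
next
  case False
  have "(\<Sum>y\<in>{0..<q}. eeq (x * y) q) = (\<Sum>y\<in>{0..<q}. eeq (x * (y + 1)) q)"
    using assms by (intro sum_periodic_shift[symmetric] eeq_cong cong_scalar_left) auto
  also have "\<dots> = eeq x q * (\<Sum>y\<in>{0..<q}. eeq (x * y) q)"
    by (simp add: ring_distribs eeq_add sum_distrib_left mult.commute)
  finally have "(1 - eeq x q) * (\<Sum>y\<in>{0..<q}. eeq (x * y) q) = 0" by (simp add: algebra_simps)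
  then show ?thesis using False assms eeq_eq_1_iff[of q x] by auto
qed

lemma sum_periodic_mult:
  fixes f :: "int \<Rightarrow> 'b::comm_monoid_add"
  assumes q: "q > 0" and cop: "coprime j q" and per: "\<And>x y. [x = y] (mod q) \<Longrightarrow> f x = f y"
  shows "(\<Sum>r\<in>{0..<q}. f (j * r)) = (\<Sum>r\<in>{0..<q}. f r)"
proof -
  obtain j' where j': "[j * j' = 1] (mod q)" using cop by (metis cong_solve_coprime_int)
  have inv: "[j * (j' * r) = r] (mod q)" "[j' * (j * r) = r] (mod q)" for r
    using cong_scalar_right[OF j', of r] by (simp_all add: mult_ac)
  show ?thesis
  proof (rule sum.reindex_bij_witness[of _ "\<lambda>r. (j' * r) mod q" "\<lambda>r. (j * r) mod q"])
    fix r assume r: "r \<in> {0..<q}"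
    have "(j' * (j * r mod q)) mod q = r mod q" using inv(2)[of r] by (simp add: cong_def mod_mult_right_eq)
    then show "j' * (j * r mod q) mod q = r" using r by simp
    have "(j * (j' * r mod q)) mod q = r mod q" using inv(1)[of r] by (simp add: cong_def mod_mult_right_eq)
    then show "j * (j' * r mod q) mod q = r" using r by simp
    show "f ((j * r) mod q) = f (j * r)" by (rule per) (simp add: cong_def)
  qed (use q in auto)
qed

lemma sum_periodic_split:
  fixes f :: "int \<Rightarrow> 'b::comm_monoid_add"
  assumes "M > 0" "l > 0"
  shows "(\<Sum>r\<in>{0..<M * l}. f r) = (\<Sum>u\<in>{0..<M}. \<Sum>w\<in>{0..<l}. f (u + M * w))"
proof -
  have "(\<Sum>u\<in>{0..<M}. \<Sum>w\<in>{0..<l}. f (u + M * w)) = (\<Sum>(u, w)\<in>{0..<M} \<times> {0..<l}. f (u + M * w))"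
    by (simp add: sum.cartesian_product)
  also have "\<dots> = (\<Sum>r\<in>{0..<M * l}. f r)"
  proof (rule sum.reindex_bij_witness[of _ "\<lambda>r. (r mod M, r div M)" "\<lambda>(u, w). u + M * w"])
    fix p assume "p \<in> {0..<M} \<times> {0..<l}"
    then obtain u w where p: "p = (u, w)" "0 \<le> u" "u < M" "0 \<le> w" "w < l" by auto
    have "u + M * w < M * (w + 1)" using p by (simp add: algebra_simps)
    also have "\<dots> \<le> M * l" using p assms by (intro mult_left_mono) auto
    finally show "(case p of (u, w) \<Rightarrow> u + M * w) \<in> {0..<M * l}" using p assms by simp
    show "((case p of (u, w) \<Rightarrow> u + M * w) mod M, (case p of (u, w) \<Rightarrow> u + M * w) div M) = p"
      using p assms by simp
  next
    fix r assume r: "r \<in> {0..<M * l}"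
    have "M * (r div M) \<le> r" using assms pos_mod_sign[of M r] mult_div_mod_eq[of M r] by linarith
    also have "r < M * l" using r by simp
    finally have "r div M < l" using assms by simp
    then show "(r mod M, r div M) \<in> {0..<M} \<times> {0..<l}"
      using assms r by (auto simp: pos_imp_zdiv_nonneg_iff)
  qed auto
  finally show ?thesis by simp
qed

text \<open>With representatives e x + l y the mixed terms of a quadratic form are divisible by l e.
  They arise from x + l w by replacing x by e x, which is allowed because the sum over w depends on
  x modulo l only.\<close>

lemma sum_periodic_crt:
  fixes f :: "int \<Rightarrow> 'b::comm_monoid_add"
  assumes "l > 0" "e > 0" "coprime l e" and per: "\<And>x y. [x = y] (mod (l * e)) \<Longrightarrow> f x = f y"
  shows "(\<Sum>r\<in>{0..<l * e}. f r) = (\<Sum>x\<in>{0..<l}. \<Sum>y\<in>{0..<e}. f (e * x + l * y))"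
proof -
  have "(\<Sum>r\<in>{0..<l * e}. f r) = (\<Sum>x\<in>{0..<l}. \<Sum>w\<in>{0..<e}. f (x + l * w))"
    using assms by (intro sum_periodic_split) auto
  also have "\<dots> = (\<Sum>x\<in>{0..<l}. \<Sum>w\<in>{0..<e}. f (e * x + l * w))"
  proof -
    define g where "g x = (\<Sum>w\<in>{0..<e}. f (x + l * w))" for x
    have "g x = g y" if "[x = y] (mod l)" for x y
    proof -
      obtain k where k: "x = y + l * k" using \<open>[x = y] (mod l)\<close> by (metis cong_iff_lin cong_sym)
      have "g x = (\<Sum>w\<in>{0..<e}. f (y + l * (w + k)))" by (simp add: g_def k algebra_simps)
      also have "\<dots> = g y" unfolding g_def
      proof (rule sum_periodic_shift)
        show "f (y + l * x) = f (y + l * x')" if "[x = x'] (mod e)" for x x'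
          using that by (intro per cong_add cong_refl) (simp add: cong_def)
      qed fact
      finally show ?thesis .
    qed
    then have "(\<Sum>x\<in>{0..<l}. g (e * x)) = (\<Sum>x\<in>{0..<l}. g x)"
      using assms by (intro sum_periodic_mult) (auto simp: coprime_commute)
    then show ?thesis by (simp add: g_def)
  qed
  finally show ?thesis .
qed

section \<open>Quadratic Gauss sums modulo an odd prime\<close>

lemma card_sqrt_mod_prime:
  fixes l :: int
  assumes l: "prime l" "l \<noteq> 2" and y: "y \<in> {0..<l}"
  shows "int (card {x\<in>{0..<l}. [x\<^sup>2 = y] (mod l)}) = 1 + Legendre y l"
proof -
  have l0: "l > 2" using l prime_ge_2_int[of l] by simp
  have eq0: "[x = 0] (mod l) \<longleftrightarrow> x = 0" if "x \<in> {0..<l}" for x using that by (simp add: cong_def)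
  consider "y = 0" | "y \<noteq> 0" "\<not> QuadRes l y" | "y \<noteq> 0" "QuadRes l y" by blast
  then show ?thesis
  proof cases
    case 1
    have "{x\<in>{0..<l}. [x\<^sup>2 = y] (mod l)} = {0}"
      using 1 l l0 by (auto simp: cong_0_iff prime_dvd_power_iff dest: zdvd_imp_le)
    then show ?thesis using 1 by (simp add: Legendre_def)
  next
    case 2
    then have "{x\<in>{0..<l}. [x\<^sup>2 = y] (mod l)} = {}" by (auto simp: QuadRes_def)
    then show ?thesis using 2 eq0[OF y] by (simp only: Legendre_def) simp
  next
    case 3
    then obtain x0 where "[x0\<^sup>2 = y] (mod l)" by (auto simp: QuadRes_def)
    define x where "x = x0 mod l"
    have x: "[x\<^sup>2 = y] (mod l)" "x \<in> {0..<l}"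
      using \<open>[x0\<^sup>2 = y] (mod l)\<close> l0 by (simp_all add: x_def cong_def power_mod)
    have "x \<noteq> 0" using x 3 y by (auto simp: cong_def)
    have "{x\<in>{0..<l}. [x\<^sup>2 = y] (mod l)} = {x, l - x}"
    proof (intro equalityI subsetI)
      fix z assume z: "z \<in> {x\<in>{0..<l}. [x\<^sup>2 = y] (mod l)}"
      then have "[z\<^sup>2 = x\<^sup>2] (mod l)" using x by (metis (mono_tags, lifting) cong_sym cong_trans mem_Collect_eq)
      then have "l dvd (z - x) * (z + x)" by (simp add: cong_iff_dvd_diff power2_eq_square algebra_simps)
      then have "l dvd z - x \<or> l dvd z + x" using l(1) prime_dvd_mult_iff by blast
      then show "z \<in> {x, l - x}"
      proof
        assume "l dvd z - x"
        then have "[z = x] (mod l)" by (simp add: cong_iff_dvd_diff)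
        then show ?thesis using z x by (simp add: cong_def)
      next
        assume "l dvd z + x"
        then obtain k where k: "z + x = l * k" by (auto elim: dvdE)
        \<comment> \<open>z + x is a multiple of l strictly between 0 and 2 l, hence l
          itself.\<close>
        have "0 < l * k" "l * k < l * 2" unfolding k[symmetric] using z x \<open>x \<noteq> 0\<close> by auto
        then have "k = 1" using l0 by (simp add: zero_less_mult_iff)
        then show ?thesis using k by simp
      qed
    next
      fix z assume "z \<in> {x, l - x}"
      moreover have "[(l - x)\<^sup>2 = x\<^sup>2] (mod l)"
        by (simp add: cong_iff_dvd_diff power2_eq_square algebra_simps)
      ultimately show "z \<in> {x\<in>{0..<l}. [x\<^sup>2 = y] (mod l)}"
        using x \<open>x \<noteq> 0\<close> cong_trans by auto
    qed
    moreover have "x \<noteq> l - x"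
    proof
      assume "x = l - x"
      then have "2 dvd l" by (metis add_diff_cancel_left' diff_add_cancel dvd_triv_left mult_2)
      then show False using l primes_dvd_imp_eq two_is_prime_nat
        by (metis primes_dvd_imp_eq prime_int_numeral_eq two_is_prime_nat)
    qed
    ultimately show ?thesis using 3 eq0[OF y] by (simp add: Legendre_def)
  qed
qed

lemma Legendre_cong: "[x = y] (mod l) \<Longrightarrow> Legendre x l = Legendre y l"
proof -
  assume h: "[x = y] (mod l)"
  then have "[x = 0] (mod l) \<longleftrightarrow> [y = 0] (mod l)" by (metis cong_sym cong_trans)
  moreover have "QuadRes l x \<longleftrightarrow> QuadRes l y" unfolding QuadRes_def using h by (metis cong_sym cong_trans)
  ultimately show ?thesis by (simp add: Legendre_def)
qed

text \<open>Euler's criterion gives the equality modulo l, and the two sides, with values in {-1, 0,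
  1}, differ by at most 2, which is less than l.\<close>

lemma Legendre_mult:
  fixes l :: int
  assumes l: "prime l" "l \<noteq> 2"
  shows "Legendre (x * y) l = Legendre x l * Legendre y l"
proof -
  define p where "p = nat l"
  have lp: "l = int p" using l prime_ge_2_int[of l] by (simp add: p_def)
  have l2: "l > 2" using l prime_ge_2_int[of l] by simp
  have p: "prime p" "2 < p" using l l2 lp by simp_all
  have e: "[Legendre z l = z ^ ((p - 1) div 2)] (mod l)" for z using euler_criterion[OF p, of z] by (simp add: lp)
  have "[Legendre (x * y) l = x ^ ((p - 1) div 2) * y ^ ((p - 1) div 2)] (mod l)"
    using e[of "x * y"] by (simp add: power_mult_distrib)
  also have "[x ^ ((p - 1) div 2) * y ^ ((p - 1) div 2) = Legendre x l * Legendre y l] (mod l)"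
    by (intro cong_mult cong_sym[OF e])
  finally have "l dvd Legendre (x * y) l - Legendre x l * Legendre y l" by (simp add: cong_iff_dvd_diff)
  moreover have "\<bar>Legendre (x * y) l - Legendre x l * Legendre y l\<bar> \<le> 2" by (simp add: Legendre_def)
  ultimately show ?thesis using l2 zdvd_imp_le[of l "\<bar>Legendre (x * y) l - Legendre x l * Legendre y l\<bar>"]
    by (cases "Legendre (x * y) l - Legendre x l * Legendre y l = 0") auto
qed

definition quad_gauss :: "int \<Rightarrow> int \<Rightarrow> complex" where
  "quad_gauss g l = (\<Sum>x\<in>{0..<l}. eeq (g * x\<^sup>2) l)"

text \<open>Sorting x by the residue y of x^2, each y occurs 1 + (y/l) times; the constant 1
  contributes a full character sum, which is 0.\<close>

lemma quad_gauss_Legendre: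
  fixes l :: int
  assumes l: "prime l" "l \<noteq> 2" and g: "\<not> l dvd g"
  shows "quad_gauss g l = (\<Sum>y\<in>{0..<l}. of_int (Legendre y l) * eeq (g * y) l)"
proof -
  have l0: "l > 2" using l prime_ge_2_int[of l] by simp
  have "quad_gauss g l = (\<Sum>y\<in>{0..<l}. \<Sum>x\<in>{x\<in>{0..<l}. x\<^sup>2 mod l = y}. eeq (g * x\<^sup>2) l)"
    unfolding quad_gauss_def using l0 by (intro sum.group[symmetric]) auto
  also have "\<dots> = (\<Sum>y\<in>{0..<l}. \<Sum>x\<in>{x\<in>{0..<l}. x\<^sup>2 mod l = y}. eeq (g * y) l)"
    using l0 by (intro sum.cong refl eeq_cong cong_scalar_left) (auto simp: cong_def)
  also have "\<dots> = (\<Sum>y\<in>{0..<l}. of_int (1 + Legendre y l) * eeq (g * y) l)"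
  proof (intro sum.cong refl)
    fix y assume y: "y \<in> {0..<l}"
    then have "{x\<in>{0..<l}. x\<^sup>2 mod l = y} = {x\<in>{0..<l}. [x\<^sup>2 = y] (mod l)}" by (auto simp: cong_def)
    then show "(\<Sum>x\<in>{x\<in>{0..<l}. x\<^sup>2 mod l = y}. eeq (g * y) l) = of_int (1 + Legendre y l) * eeq (g * y) l"
      using card_sqrt_mod_prime[OF l y, symmetric] by simp
  qed
  also have "\<dots> = (\<Sum>y\<in>{0..<l}. eeq (g * y) l) + (\<Sum>y\<in>{0..<l}. of_int (Legendre y l) * eeq (g * y) l)"
    by (simp add: ring_distribs sum.distrib)
  also have "(\<Sum>y\<in>{0..<l}. eeq (g * y) l) = 0" using l0 g by (subst sum_eeq) auto
  finally show ?thesis by simp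
qed

text \<open>In the Legendre form of the sum the substitution of j y for y moves j from the character
  into the symbol.\<close>

lemma quad_gauss_mult:
  fixes l :: int
  assumes l: "prime l" "l \<noteq> 2" and g: "\<not> l dvd g" and j: "\<not> l dvd j"
  shows "quad_gauss (j * g) l = of_int (Legendre j l) * quad_gauss g l"
proof -
  have l0: "l > 2" using l prime_ge_2_int[of l] by simp
  have jg: "\<not> l dvd j * g" using l g j by (simp add: prime_dvd_mult_iff)
  have sq: "Legendre j l * Legendre j l = 1" using j by (simp add: Legendre_def cong_0_iff)
  define f where "f y = complex_of_int (Legendre y l) * eeq (g * y) l" for y
  have f: "f x = f y" if "[x = y] (mod l)" for x y
    using that Legendre_cong[OF that] eeq_cong[of "g * x" "g * y" l] l0 by (simp add: f_def cong_scalar_left)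
  have "quad_gauss (j * g) l = (\<Sum>y\<in>{0..<l}. of_int (Legendre j l) * f (j * y))"
    unfolding quad_gauss_Legendre[OF l jg] f_def
  proof (intro sum.cong refl)
    fix y
    have "complex_of_int (Legendre j l) * complex_of_int (Legendre (j * y) l) = of_int (Legendre j l * Legendre j l * Legendre y l)"
      by (simp add: Legendre_mult[OF l])
    then show "complex_of_int (Legendre y l) * eeq (j * g * y) l = of_int (Legendre j l) * (of_int (Legendre (j * y) l) * eeq (g * (j * y)) l)"
      by (simp only: sq mult.assoc[symmetric]) (simp add: mult_ac)
  qed
  also have "\<dots> = of_int (Legendre j l) * (\<Sum>y\<in>{0..<l}. f (j * y))" by (simp add: sum_distrib_left)
  also have "(\<Sum>y\<in>{0..<l}. f (j * y)) = (\<Sum>y\<in>{0..<l}. f y)"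
    using l0 prime_imp_coprime[OF l(1) j] by (intro sum_periodic_mult f) (auto simp: coprime_commute)
  also have "\<dots> = quad_gauss g l" by (simp add: f_def quad_gauss_Legendre[OF l g])
  finally show ?thesis .
qed

text \<open>Translating x by y leaves y only in the character of 2 g x y, and orthogonality then
  selects x = 0. Up to the symbol of the discriminant, g and -g are the two multipliers that
  completing the square in a binary form produces.\<close>

lemma quad_gauss_norm:
  fixes l :: int
  assumes l: "prime l" "l \<noteq> 2" and g: "\<not> l dvd g"
  shows "quad_gauss g l * quad_gauss (- g) l = of_int l"
proof -
  have l0: "l > 2" using l prime_ge_2_int[of l] by simp
  have per: "eeq (h * x\<^sup>2) l = eeq (h * y\<^sup>2) l" if "[x = y] (mod l)" for h x y
    using that l0 by (intro eeq_cong cong_scalar_left cong_pow) auto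
  have "quad_gauss g l * quad_gauss (- g) l = (\<Sum>y\<in>{0..<l}. \<Sum>x\<in>{0..<l}. eeq (g * x\<^sup>2) l * eeq (- g * y\<^sup>2) l)"
    unfolding quad_gauss_def by (subst sum.swap) (simp add: sum_product)
  also have "\<dots> = (\<Sum>y\<in>{0..<l}. (\<Sum>x\<in>{0..<l}. eeq (g * (x + y)\<^sup>2) l) * eeq (- g * y\<^sup>2) l)"
    using l0 sum_periodic_shift[of l "\<lambda>x. eeq (g * x\<^sup>2) l"] per by (simp add: sum_distrib_right)
  also have "\<dots> = (\<Sum>y\<in>{0..<l}. \<Sum>x\<in>{0..<l}. eeq (g * x\<^sup>2) l * eeq (2 * g * x * y) l)"
    unfolding sum_distrib_right eeq_add[symmetric] by (simp add: power2_eq_square algebra_simps)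
  also have "\<dots> = (\<Sum>x\<in>{0..<l}. eeq (g * x\<^sup>2) l * (\<Sum>y\<in>{0..<l}. eeq (2 * g * x * y) l))"
    by (subst sum.swap) (simp add: sum_distrib_left)
  also have "\<dots> = (\<Sum>x\<in>{0..<l}. if x = 0 then of_int l else 0)"
  proof (intro sum.cong refl)
    fix x assume x: "x \<in> {0..<l}"
    have "\<not> l dvd 2" using l0 by (auto dest: zdvd_imp_le)
    then have "l dvd 2 * g * x \<longleftrightarrow> l dvd x" using l g by (simp add: prime_dvd_mult_iff)
    also have "\<dots> \<longleftrightarrow> x = 0" using x by (auto dest: zdvd_imp_le)
    finally show "eeq (g * x\<^sup>2) l * (\<Sum>y\<in>{0..<l}. eeq (2 * g * x * y) l) = (if x = 0 then of_int l else 0)"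
      using l0 by (subst sum_eeq) auto
  qed
  also have "\<dots> = of_int l" using l0 by simp
  finally show ?thesis .
qed

lemma bqf_cong:
  fixes a b c :: int
  assumes "[x = x'] (mod q)" "[y = y'] (mod q)"
  shows "[bqf a b c x y = bqf a b c x' y'] (mod q)"
  unfolding bqf_def using assms by (intro cong_add cong_mult cong_pow cong_refl)

section \<open>Gauss sums of binary forms, one prime at a time\<close>

definition bqf_sum :: "int \<Rightarrow> int \<Rightarrow> int \<Rightarrow> int \<Rightarrow> int \<Rightarrow> complex" where
  "bqf_sum a b c p q = (\<Sum>r\<in>{0..<q}. \<Sum>s\<in>{0..<q}. eeq (p * bqf a b c r s) q)"

lemma bqf_gauss_sum_0: "bqf_gauss_sum a b c p q 0 0 = bqf_sum a b c p q"
  by (simp add: bqf_gauss_sum_def bqf_sum_def eeq_def sum.cartesian_product)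

lemma bqf_sum_swap: "bqf_sum a b c p q = bqf_sum c b a p q"
  unfolding bqf_sum_def by (subst sum.swap) (simp add: bqf_def algebra_simps)

lemma eeq_bqf_cong:
  "[x = x'] (mod q) \<Longrightarrow> [y = y'] (mod q) \<Longrightarrow> q \<noteq> 0 \<Longrightarrow> eeq (p * bqf a b c x y) q = eeq (p * bqf a b c x' y') q"
  by (intro eeq_cong cong_scalar_left bqf_cong)

lemma sum_multiples:
  fixes l e :: int and g :: "int \<Rightarrow> 'b::comm_monoid_add"
  assumes "l > 0"
  shows "(\<Sum>u\<in>{0..<e * l}. if l dvd u then g u else 0) = (\<Sum>v\<in>{0..<e}. g (l * v))"
proof -
  have "(\<Sum>u\<in>{0..<e * l}. if l dvd u then g u else 0) = (\<Sum>u\<in>{u\<in>{0..<e * l}. l dvd u}. g u)"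
    by (rule sum.inter_filter[symmetric]) simp
  also have "\<dots> = (\<Sum>v\<in>{0..<e}. g (l * v))"
    using assms by (intro sum.reindex_bij_witness[of _ "\<lambda>v. l * v" "\<lambda>u. u div l"])
      (auto elim!: dvdE simp: zero_le_mult_iff mult.commute[of e])
  finally show ?thesis .
qed

text \<open>Write r = u + M w with M = e l. The terms quadratic in w are multiples of the modulus,
  so the sum over w is a product of two character sums modulo l. It survives only if both partial
  derivatives of the form at u vanish modulo l, and since l does not divide the discriminant this
  means that l divides u; then l^2 cancels from form and modulus. The argument includes l =
  2.\<close>

lemma bqf_sum_prime_square:
  assumes l: "prime l" and e: "e > 0" and D: "\<not> l dvd b\<^sup>2 - 4 * a * c" and p: "\<not> l dvd p"
  shows "bqf_sum a b c p (l * l * e) = of_int (l * l) * bqf_sum a b c p e"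
proof -
  have l0: "l > 0" using l by (simp add: prime_gt_0_int)
  define M where "M = e * l"
  have M: "M > 0" using l0 e by (simp add: M_def)
  have q: "l * l * e = M * l" by (simp add: M_def)
  have q0: "M * l \<noteq> 0" and M0: "M \<noteq> 0" using M l0 by simp_all
  have inner: "(\<Sum>w1\<in>{0..<l}. \<Sum>w2\<in>{0..<l}. eeq (p * bqf a b c (u1 + M * w1) (u2 + M * w2)) (M * l)) =
     (if l dvd u1 \<and> l dvd u2 then of_int (l * l) * eeq (p * bqf a b c u1 u2) (M * l) else 0)" for u1 u2
  proof -
    have "eeq (p * bqf a b c (u1 + M * w1) (u2 + M * w2)) (M * l) =
      eeq (p * bqf a b c u1 u2) (M * l) * (eeq (p * (2 * a * u1 + b * u2) * w1) l * eeq (p * (b * u1 + 2 * c * u2) * w2) l)" for w1 w2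
    proof -
      have "p * bqf a b c (u1 + M * w1) (u2 + M * w2) =
        p * bqf a b c u1 u2 + M * (p * (2 * a * u1 + b * u2) * w1 + p * (b * u1 + 2 * c * u2) * w2) + M * l * (e * p * bqf a b c w1 w2)"
        by (simp add: bqf_def power2_eq_square algebra_simps M_def)
      then have "[p * bqf a b c (u1 + M * w1) (u2 + M * w2) =
        p * bqf a b c u1 u2 + M * (p * (2 * a * u1 + b * u2) * w1 + p * (b * u1 + 2 * c * u2) * w2)] (mod (M * l))"
        by (simp add: cong_iff_dvd_diff)
      then have "eeq (p * bqf a b c (u1 + M * w1) (u2 + M * w2)) (M * l) =
        eeq (p * bqf a b c u1 u2 + M * (p * (2 * a * u1 + b * u2) * w1 + p * (b * u1 + 2 * c * u2) * w2)) (M * l)"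
        using q0 by (rule eeq_cong)
      then show ?thesis using M0 by (simp only: eeq_add[of "p * bqf a b c u1 u2"] eeq_mult_cancel[OF M0] eeq_add)
    qed
    then have "(\<Sum>w1\<in>{0..<l}. \<Sum>w2\<in>{0..<l}. eeq (p * bqf a b c (u1 + M * w1) (u2 + M * w2)) (M * l)) =
      eeq (p * bqf a b c u1 u2) (M * l) * ((\<Sum>w1\<in>{0..<l}. eeq (p * (2 * a * u1 + b * u2) * w1) l) * (\<Sum>w2\<in>{0..<l}. eeq (p * (b * u1 + 2 * c * u2) * w2) l))"
      unfolding sum_product by (simp add: sum_distrib_left)
    moreover have "l dvd p * (2 * a * u1 + b * u2) \<and> l dvd p * (b * u1 + 2 * c * u2) \<longleftrightarrow> l dvd u1 \<and> l dvd u2"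
    proof
      assume h: "l dvd p * (2 * a * u1 + b * u2) \<and> l dvd p * (b * u1 + 2 * c * u2)"
      then have h: "l dvd 2 * a * u1 + b * u2" "l dvd b * u1 + 2 * c * u2" using l p by (simp_all add: prime_dvd_mult_iff)
      \<comment> \<open>Cramer's rule: eliminating one unknown from the two linear forms leaves the
        discriminant times the other.\<close>
      have "l dvd b * (b * u1 + 2 * c * u2) - 2 * c * (2 * a * u1 + b * u2)" using h by (intro dvd_diff dvd_mult)
      also have "\<dots> = (b\<^sup>2 - 4 * a * c) * u1" by (simp add: power2_eq_square algebra_simps)
      finally have 1: "l dvd u1" using l D by (simp add: prime_dvd_mult_iff)
      have "l dvd b * (2 * a * u1 + b * u2) - 2 * a * (b * u1 + 2 * c * u2)" using h by (intro dvd_diff dvd_mult)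
      also have "\<dots> = (b\<^sup>2 - 4 * a * c) * u2" by (simp add: power2_eq_square algebra_simps)
      finally have "l dvd u2" using l D by (simp add: prime_dvd_mult_iff)
      with 1 show "l dvd u1 \<and> l dvd u2" ..
    qed auto
    ultimately show ?thesis using l0 by (simp only: sum_eeq) auto
  qed
  define f where "f r s = eeq (p * bqf a b c r s) (M * l)" for r s
  have "bqf_sum a b c p (l * l * e) = (\<Sum>u1\<in>{0..<M}. \<Sum>w1\<in>{0..<l}. \<Sum>u2\<in>{0..<M}. \<Sum>w2\<in>{0..<l}. f (u1 + M * w1) (u2 + M * w2))"
    unfolding bqf_sum_def q f_def using M l0 by (simp only: sum_periodic_split)
  also have "\<dots> = (\<Sum>u1\<in>{0..<M}. \<Sum>u2\<in>{0..<M}. \<Sum>w1\<in>{0..<l}. \<Sum>w2\<in>{0..<l}. f (u1 + M * w1) (u2 + M * w2))"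
    by (intro sum.cong refl sum.swap)
  also have "\<dots> = (\<Sum>u1\<in>{0..<M}. \<Sum>u2\<in>{0..<M}. if l dvd u1 \<and> l dvd u2 then of_int (l * l) * f u1 u2 else 0)"
    unfolding f_def inner ..
  also have "\<dots> = (\<Sum>u1\<in>{0..<M}. if l dvd u1 then (\<Sum>u2\<in>{0..<M}. if l dvd u2 then of_int (l * l) * f u1 u2 else 0) else 0)"
    by (intro sum.cong refl) auto
  also have "\<dots> = (\<Sum>v1\<in>{0..<e}. \<Sum>v2\<in>{0..<e}. of_int (l * l) * f (l * v1) (l * v2))"
    unfolding M_def by (simp only: sum_multiples[OF l0])
  also have "\<dots> = (\<Sum>v1\<in>{0..<e}. \<Sum>v2\<in>{0..<e}. of_int (l * l) * eeq (p * bqf a b c v1 v2) e)"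
  proof -
    have "f (l * v1) (l * v2) = eeq (p * bqf a b c v1 v2) e" for v1 v2
    proof -
      have "f (l * v1) (l * v2) = eeq ((l * l) * (p * bqf a b c v1 v2)) ((l * l) * e)"
        by (simp add: f_def bqf_def power2_eq_square algebra_simps M_def)
      also have "\<dots> = eeq (p * bqf a b c v1 v2) e" using l0 by (intro eeq_mult_cancel) simp
      finally show ?thesis .
    qed
    then show ?thesis by simp
  qed
  also have "\<dots> = of_int (l * l) * bqf_sum a b c p e"
    by (simp only: bqf_sum_def sum_distrib_left)
  finally show ?thesis .
qed

text \<open>Modulo l e one has Q(e x + l y) = e^2 Q(x) + l^2 Q(y); division by l e leaves the
  multipliers p e modulo l and p l modulo e.\<close>

lemma bqf_sum_coprime_mult:
  assumes "l > 0" "e > 0" "coprime l e"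
  shows "bqf_sum a b c p (l * e) = bqf_sum a b c (p * e) l * bqf_sum a b c (p * l) e"
proof -
  define f where "f r s = eeq (p * bqf a b c r s) (l * e)" for r s
  have le: "l * e \<noteq> 0" using assms by simp
  have f_cong: "f r s = f r' s'" if "[r = r'] (mod (l * e))" "[s = s'] (mod (l * e))" for r s r' s'
    unfolding f_def by (rule eeq_bqf_cong[OF that le])
  have term_eq: "f (e * x1 + l * y1) (e * x2 + l * y2) = eeq (p * e * bqf a b c x1 x2) l * eeq (p * l * bqf a b c y1 y2) e" for x1 y1 x2 y2
  proof -
    have "p * bqf a b c (e * x1 + l * y1) (e * x2 + l * y2) = e * (p * e * bqf a b c x1 x2) + l * (p * l * bqf a b c y1 y2) +
       l * e * (p * (2 * a * x1 * y1 + b * (x1 * y2 + x2 * y1) + 2 * c * x2 * y2))"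
      by (simp add: bqf_def power2_eq_square algebra_simps)
    then have "[p * bqf a b c (e * x1 + l * y1) (e * x2 + l * y2) = e * (p * e * bqf a b c x1 x2) + l * (p * l * bqf a b c y1 y2)] (mod (l * e))"
      by (simp add: cong_iff_dvd_diff)
    then have "f (e * x1 + l * y1) (e * x2 + l * y2) = eeq (e * (p * e * bqf a b c x1 x2) + l * (p * l * bqf a b c y1 y2)) (l * e)"
      unfolding f_def using le by (rule eeq_cong)
    also have "\<dots> = eeq (e * (p * e * bqf a b c x1 x2)) (e * l) * eeq (l * (p * l * bqf a b c y1 y2)) (l * e)"
      by (simp add: eeq_add mult.commute)
    finally show ?thesis using assms by (simp add: eeq_mult_cancel)
  qed
  have "bqf_sum a b c p (l * e) = (\<Sum>r\<in>{0..<l * e}. \<Sum>s\<in>{0..<l * e}. f r s)" by (simp add: bqf_sum_def f_def)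
  also have "\<dots> = (\<Sum>x1\<in>{0..<l}. \<Sum>y1\<in>{0..<e}. \<Sum>x2\<in>{0..<l}. \<Sum>y2\<in>{0..<e}. f (e * x1 + l * y1) (e * x2 + l * y2))"
  proof -
    have "(\<Sum>r\<in>{0..<l * e}. \<Sum>s\<in>{0..<l * e}. f r s) = (\<Sum>x1\<in>{0..<l}. \<Sum>y1\<in>{0..<e}. \<Sum>s\<in>{0..<l * e}. f (e * x1 + l * y1) s)"
      by (rule sum_periodic_crt[OF assms]) (intro sum.cong refl f_cong cong_refl)
    also have "\<dots> = (\<Sum>x1\<in>{0..<l}. \<Sum>y1\<in>{0..<e}. \<Sum>x2\<in>{0..<l}. \<Sum>y2\<in>{0..<e}. f (e * x1 + l * y1) (e * x2 + l * y2))"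
      by (intro sum.cong refl sum_periodic_crt[OF assms] f_cong cong_refl)
    finally show ?thesis .
  qed
  also have "\<dots> = (\<Sum>x1\<in>{0..<l}. \<Sum>x2\<in>{0..<l}. \<Sum>y1\<in>{0..<e}. \<Sum>y2\<in>{0..<e}. f (e * x1 + l * y1) (e * x2 + l * y2))"
    by (intro sum.cong refl sum.swap)
  also have "\<dots> = bqf_sum a b c (p * e) l * bqf_sum a b c (p * l) e"
    unfolding bqf_sum_def term_eq by (simp add: sum_distrib_left[symmetric] sum_distrib_right[symmetric])
  finally show ?thesis .
qed

text \<open>Since 4 a Q = (2 a r + b s)^2 - D s^2, a g with 4 a g = p modulo l splits the sum into
  the quadratic Gauss sums for g and -D g. By \<open>quad_gauss_mult\<close> and
  \<open>quad_gauss_norm\<close> their product is (D/l) l, whatever p is.\<close>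

lemma bqf_sum_odd_prime_aux:
  assumes l: "prime l" "l \<noteq> 2" and a: "\<not> l dvd a" and D: "D = b\<^sup>2 - 4 * a * c" "\<not> l dvd D" and p: "\<not> l dvd p"
  shows "bqf_sum a b c p l = of_int (Legendre D l * l)"
proof -
  have l0: "l > 2" using l prime_ge_2_int[of l] by simp
  have "\<not> l dvd 2" using l0 by (auto dest: zdvd_imp_le)
  then have a4: "\<not> l dvd 2 * a" "\<not> l dvd 4 * a"
    using l a prime_dvd_mult_iff[of l 2 2] by (auto simp: prime_dvd_mult_iff)
  have "coprime (4 * a) l" using prime_imp_coprime[OF l(1) a4(2)] by (subst coprime_commute)
  then obtain i where i: "[4 * a * i = 1] (mod l)" by (metis cong_solve_coprime_int)
  define g where "g = p * i"
  have g: "[g * (4 * a) = p] (mod l)" using cong_scalar_left[OF i, of p] by (simp add: g_def mult_ac)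
  then have ng: "\<not> l dvd g" using p by (metis cong_dvd_iff dvd_mult2)
  have per: "eeq (h * x\<^sup>2) l = eeq (h * y\<^sup>2) l" if "[x = y] (mod l)" for h x y
    using that l0 by (intro eeq_cong cong_scalar_left cong_pow) auto
  have cop: "coprime (2 * a) l" using prime_imp_coprime[OF l(1) a4(1)] by (subst coprime_commute)
  have "bqf_sum a b c p l = (\<Sum>s\<in>{0..<l}. \<Sum>r\<in>{0..<l}. eeq (g * (2 * a * r + b * s)\<^sup>2) l * eeq (- D * g * s\<^sup>2) l)"
    unfolding bqf_sum_def
  proof (subst sum.swap, intro sum.cong refl)
    fix r s
    have "[p * bqf a b c r s = g * (4 * a) * bqf a b c r s] (mod l)"
      by (rule cong_scalar_right[OF cong_sym[OF g]])
    also have "g * (4 * a) * bqf a b c r s = g * (2 * a * r + b * s)\<^sup>2 + - D * g * s\<^sup>2"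
      by (simp add: D bqf_def power2_eq_square algebra_simps)
    finally show "eeq (p * bqf a b c r s) l = eeq (g * (2 * a * r + b * s)\<^sup>2) l * eeq (- D * g * s\<^sup>2) l"
      unfolding eeq_add[symmetric] using l0 by (intro eeq_cong) auto
  qed
  also have "\<dots> = (\<Sum>s\<in>{0..<l}. quad_gauss g l * eeq (- D * g * s\<^sup>2) l)"
  proof (intro sum.cong refl)
    fix s
    have "(\<Sum>r\<in>{0..<l}. eeq (g * (2 * a * r + b * s)\<^sup>2) l) = (\<Sum>r\<in>{0..<l}. eeq (g * (r + b * s)\<^sup>2) l)"
      using l0 by (intro sum_periodic_mult[OF _ cop] per cong_add cong_refl) auto
    also have "\<dots> = quad_gauss g l"
      unfolding quad_gauss_def using l0 by (intro sum_periodic_shift per) auto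
    finally show "(\<Sum>r\<in>{0..<l}. eeq (g * (2 * a * r + b * s)\<^sup>2) l * eeq (- D * g * s\<^sup>2) l) = quad_gauss g l * eeq (- D * g * s\<^sup>2) l"
      by (simp only: sum_distrib_right[symmetric])
  qed
  also have "\<dots> = quad_gauss g l * quad_gauss (D * (- g)) l"
    by (simp add: quad_gauss_def sum_distrib_left)
  also have "quad_gauss (D * (- g)) l = of_int (Legendre D l) * quad_gauss (- g) l"
    by (rule quad_gauss_mult[OF l]) (use ng D in auto)
  finally show ?thesis using quad_gauss_norm[OF l ng] by (simp add: mult_ac)
qed

text \<open>Swapping the variables reaches a leading coefficient prime to l, unless l divides both a
  and c. Then the form is b r s modulo l, D is the square b^2, and orthogonality gives l.\<close>

lemma bqf_sum_odd_prime:
  assumes l: "prime l" "l \<noteq> 2" and D: "D = b\<^sup>2 - 4 * a * c" "\<not> l dvd D" and p: "\<not> l dvd p"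
  shows "bqf_sum a b c p l = of_int (Legendre D l * l)"
proof -
  consider "\<not> l dvd a" | "\<not> l dvd c" | "l dvd a" "l dvd c" by blast
  then show ?thesis
  proof cases
    case 1
    then show ?thesis using bqf_sum_odd_prime_aux[OF l 1 D p] by simp
  next
    case 2
    have D': "D = b\<^sup>2 - 4 * c * a" using D by simp
    show ?thesis using bqf_sum_odd_prime_aux[OF l 2 D' D(2) p] bqf_sum_swap by simp
  next
    case 3
    have l0: "l > 2" using l prime_ge_2_int[of l] by simp
    have "\<not> l dvd b" using D 3 by (auto simp: power2_eq_square)
    have "[D = b\<^sup>2] (mod l)" using 3 by (simp add: D cong_iff_dvd_diff)
    then have "Legendre D l = 1" using D(2) by (auto simp: Legendre_def QuadRes_def cong_0_iff intro: cong_sym)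
    have "bqf_sum a b c p l = (\<Sum>r\<in>{0..<l}. \<Sum>s\<in>{0..<l}. eeq (p * b * r * s) l)"
      unfolding bqf_sum_def
    proof (intro sum.cong refl eeq_cong)
      fix r s
      have "[a * r\<^sup>2 + b * r * s + c * s\<^sup>2 = 0 * r\<^sup>2 + b * r * s + 0 * s\<^sup>2] (mod l)"
        using 3 by (intro cong_add cong_mult cong_refl) (auto simp: cong_0_iff)
      then show "[p * bqf a b c r s = p * b * r * s] (mod l)"
        using cong_scalar_left[of "bqf a b c r s" "b * r * s" l p] by (simp add: bqf_def mult.assoc)
    qed (use l0 in auto)
    also have "\<dots> = (\<Sum>r\<in>{0..<l}. if r = 0 then of_int l else 0)"
    proof (intro sum.cong refl)
      fix r assume r: "r \<in> {0..<l}"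
      have "l dvd p * b * r \<longleftrightarrow> l dvd r" using l p \<open>\<not> l dvd b\<close> by (simp add: prime_dvd_mult_iff)
      also have "\<dots> \<longleftrightarrow> r = 0" using r by (auto dest: zdvd_imp_le)
      finally show "(\<Sum>s\<in>{0..<l}. eeq (p * b * r * s) l) = (if r = 0 then of_int l else 0)"
        using l0 by (subst sum_eeq) auto
    qed
    also have "\<dots> = of_int l" using l0 by simp
    finally show ?thesis using \<open>Legendre D l = 1\<close> by simp
  qed
qed

text \<open>As b is odd, D is 5 modulo 8 if a and c are both odd and 1 otherwise. In the first case
  the form is odd at all three nonzero pairs modulo 2, giving 1 - 3 = -2; in the second it is odd at
  exactly one pair, giving 3 - 1 = 2.\<close>

lemma bqf_sum_two:
  assumes D: "D = b\<^sup>2 - 4 * a * c" "odd D" and p: "odd p"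
  shows "bqf_sum a b c p 2 = of_int (kronecker_prime D 2 * 2)"
proof -
  have e: "eeq x 2 = (if even x then 1 else -1)" for x
  proof (cases "even x")
    case True
    then show ?thesis by (simp add: eeq_eq_1_iff)
  next
    case False
    then have "eeq x 2 = eeq 1 2" by (intro eeq_cong) (auto simp: cong_def odd_iff_mod_2_eq_one)
    also have "eeq 1 2 = -1" by (simp add: eeq_def ee_def)
    finally show ?thesis using False by simp
  qed
  have b: "odd b" using D by auto
  have I: "{0..<2::int} = {0, 1}" by auto
  have S: "bqf_sum a b c p 2 = (if odd a \<and> odd c then -2 else 2)"
    using p b by (auto simp: bqf_sum_def I bqf_def e)
  have "b mod 8 = 1 \<or> b mod 8 = 3 \<or> b mod 8 = 5 \<or> b mod 8 = 7" using b by presburger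
  then have b8: "b\<^sup>2 mod 8 = 1" by (auto simp: power_mod[of b 8 2, symmetric])
  have "D mod 8 \<in> {1, 7} \<longleftrightarrow> \<not> (odd a \<and> odd c)"
  proof (cases "odd a \<and> odd c")
    case True
    then obtain k where k: "a * c = 2 * k + 1" by (metis even_mult_iff oddE)
    then have "D = b\<^sup>2 - 8 * k - 4" using D(1) by (simp add: mult.assoc)
    then have "D mod 8 = 5" using b8 by presburger
    then show ?thesis using True by simp
  next
    case False
    then obtain k where k: "a * c = 2 * k" by (metis even_mult_iff evenE)
    then have "D = b\<^sup>2 - 8 * k" using D(1) by (simp add: mult.assoc)
    then have "D mod 8 = 1" using b8 by presburger
    then show ?thesis using False by simp
  qed
  then show ?thesis using S D(2) by (auto simp: kronecker_prime_def)
qed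

section \<open>The Kronecker symbol as the value of the Gauss sum\<close>

lemma kronecker_pos:
  assumes "n > 0"
  shows "kronecker D n = prod_mset (image_mset (kronecker_prime D) (prime_factorization n))"
proof -
  have "prod_mset (image_mset (kronecker_prime D) (prime_factorization n)) =
     (\<Prod>p\<in>prime_factors n. kronecker_prime D p ^ count (prime_factorization n) p)"
    by (simp add: image_prod_mset_multiplicity)
  also have "\<dots> = (\<Prod>p\<in>prime_factors n. kronecker_prime D p ^ multiplicity p n)"
    by (intro prod.cong refl) (simp add: count_prime_factorization_prime in_prime_factors_imp_prime)
  finally show ?thesis using assms by (simp add: kronecker_def)
qed

lemma kronecker_1 [simp]: "kronecker D 1 = 1"
  by (simp add: kronecker_def)

lemma kronecker_prime_times:
  assumes "prime l" "n > 0"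
  shows "kronecker D (l * n) = kronecker_prime D l * kronecker D n"
proof -
  have "l > 0" using assms by (simp add: prime_gt_0_int)
  then show ?thesis using assms
    by (simp add: kronecker_pos prime_factorization_mult prime_factorization_prime)
qed

text \<open>This sign matches the one of the automorphy factor when a matrix is replaced by its
  negative.\<close>

lemma kronecker_minus:
  assumes "D < 0" "n > 0"
  shows "kronecker D (- n) = - kronecker D n"
proof -
  have "prime_factorization (- n) = prime_factorization n"
    using prime_factorization_normalize[of "- n"] prime_factorization_normalize[of n] by simp
  moreover have "multiplicity p (- n) = multiplicity p n" for p
    using multiplicity_normalize_right[of p "- n"] multiplicity_normalize_right[of p n] by simp
  ultimately show ?thesis using assms by (simp add: kronecker_def)
qed

lemma kronecker_prime_square:
  assumes "\<not> l dvd D"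
  shows "kronecker_prime D l * kronecker_prime D l = 1"
  using assms by (auto simp: kronecker_prime_def Legendre_def cong_0_iff)

text \<open>Induction on q by removing a prime l. If l^2 divides q, both l^2 and the square of the
  symbol at l drop out; otherwise l is split off by coprimality. The splitting changes the
  multiplier, hence \<open>p\<close> is arbitrary in the induction.\<close>

theorem bqf_sum_kronecker:
  assumes D: "D = b\<^sup>2 - 4 * a * c"
  shows "q > 0 \<Longrightarrow> coprime q D \<Longrightarrow> coprime q p \<Longrightarrow> bqf_sum a b c p q = of_int (kronecker D q * q)"
proof (induction "nat q" arbitrary: q p rule: less_induct)
  case less
  show ?case
  proof (cases "q = 1")
    case True
    have "{0..<1::int} = {0}" by auto
    then show ?thesis using True by (simp add: bqf_sum_def bqf_def)
  next
    case False
    then obtain l where l: "prime l" "l dvd q" using less.prems prime_factor_int[of q] by auto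
    have l0: "l > 1" using l by (simp add: prime_gt_1_int)
    obtain e where e: "q = l * e" using l by (auto elim: dvdE)
    have e0: "e > 0" using less.prems e l0 by (simp add: zero_less_mult_iff)
    have nD: "\<not> l dvd D" "\<not> l dvd p"
      using less.prems l not_prime_unit[of l] coprime_common_divisor[of q D l]
        coprime_common_divisor[of q p l] by blast+
    show ?thesis
    proof (cases "l dvd e")
      case True
      then obtain f where f: "e = l * f" by (auto elim: dvdE)
      have f0: "f > 0" using e0 f l0 by (simp add: zero_less_mult_iff)
      have "1 * f < (l * l) * f" using f0 l0 by (intro mult_strict_right_mono less_1_mult)
      then have "f < q" by (simp add: e f)
      then have "bqf_sum a b c p f = of_int (kronecker D f * f)"
        using less.prems f0 by (intro less.hyps) (simp_all add: e f)
      moreover have "bqf_sum a b c p q = of_int (l * l) * bqf_sum a b c p f"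
        using bqf_sum_prime_square[of l f b a c p] l f0 nD D by (simp add: e f mult.assoc)
      moreover have "kronecker D q = kronecker D f"
      proof -
        have "kronecker D q = (kronecker_prime D l * kronecker_prime D l) * kronecker D f"
          using l f0 l0 by (simp add: e f kronecker_prime_times)
        then show ?thesis by (simp only: kronecker_prime_square[OF nD(1)] mult_1)
      qed
      ultimately show ?thesis by (simp add: e f mult_ac)
    next
      case False
      have cop: "coprime l e" using False l by (simp add: prime_imp_coprime)
      have "e < q" using e e0 l0 by simp
      then have 1: "bqf_sum a b c (p * l) e = of_int (kronecker D e * e)"
        using less.prems e0 cop by (intro less.hyps) (simp_all add: e coprime_commute[of e])
      have nl: "\<not> l dvd p * e" using l nD False by (simp add: prime_dvd_mult_iff)
      have 2: "bqf_sum a b c (p * e) l = of_int (kronecker_prime D l * l)"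
      proof (cases "l = 2")
        case True
        then show ?thesis using bqf_sum_two[OF D, of "p * e"] nD nl by simp
      next
        case False
        then show ?thesis using bqf_sum_odd_prime[OF l(1) False D nD(1) nl] by (simp add: kronecker_prime_def)
      qed
      have "bqf_sum a b c p q = bqf_sum a b c (p * e) l * bqf_sum a b c (p * l) e"
        unfolding e using l0 e0 cop by (intro bqf_sum_coprime_mult) auto
      then show ?thesis using 1 2 kronecker_prime_times[OF l(1) e0] by (simp add: e mult_ac)
    qed
  qed
qed

section \<open>Modularity of the theta series of a form\<close>

context posdef_bqf
begin

text \<open>Excludes N = 1, the only level at which \<open>Gamma0\<close> contains matrices with
  \<delta> = 0.\<close>

lemma N_mod_4: "N mod 4 = 0 \<or> N mod 4 = 3"
proof (cases "even b")
  case True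
  then obtain k where "b = 2 * k" by (auto elim: evenE)
  then have "N = 4 * (a * c - k * k)" by (simp add: N power2_eq_square algebra_simps)
  then show ?thesis by simp
next
  case False
  then obtain k where "b = 2 * k + 1" by (auto elim: oddE)
  then have "N = 4 * (a * c - k * k - k - 1) + 3" by (simp add: N power2_eq_square algebra_simps)
  then show ?thesis by presburger
qed

lemma bqf_theta_transform_pos:
  assumes det: "\<alpha> * \<delta> - \<beta> * \<gamma> = 1" and dvd: "N dvd \<gamma>" and pos: "\<delta> > 0" and z: "Im z > 0"
  shows "bqf_theta a b c ((of_int \<alpha> * z + of_int \<beta>) / (of_int \<gamma> * z + of_int \<delta>)) =
    of_int (kronecker (- N) \<delta>) * (of_int \<gamma> * z + of_int \<delta>) * bqf_theta a b c z"
proof -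
  have 1: "coprime \<delta> \<beta>"
  proof (rule coprimeI)
    fix e assume "e dvd \<delta>" "e dvd \<beta>"
    then have "e dvd \<alpha> * \<delta> - \<beta> * \<gamma>" by (intro dvd_diff dvd_mult dvd_mult2)
    then show "is_unit e" using det by simp
  qed
  have "coprime \<delta> \<gamma>"
  proof (rule coprimeI)
    fix e assume "e dvd \<delta>" "e dvd \<gamma>"
    then have "e dvd \<alpha> * \<delta> - \<beta> * \<gamma>" by (intro dvd_diff dvd_mult)
    then show "is_unit e" using det by simp
  qed
  then have 2: "coprime \<delta> (- N)" using dvd using coprime_divisors[of \<delta> \<delta> "- N" \<gamma>] by simp
  have "bqf_gauss_sum a b c \<beta> \<delta> 0 0 = of_int (kronecker (- N) \<delta> * \<delta>)"
    unfolding bqf_gauss_sum_0 using pos 1 2 N by (intro bqf_sum_kronecker) auto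
  then show ?thesis using bqf_theta_transform[OF det dvd pos z] pos by simp
qed

theorem bqf_theta_modular:
  "bqf_theta a b c \<in> modular_forms 1 N (\<lambda>n. of_int (kronecker (- N) n))"
proof -
  have holo: "bqf_theta a b c holomorphic_on upper_half_plane"
    using bqf_theta_holomorphic by (simp add: upper_half_plane_def)
  have trans: "bqf_theta a b c (moebius_act (\<alpha>, \<beta>, \<gamma>, \<delta>) z) =
      of_int (kronecker (- N) \<delta>) * automorphy (\<alpha>, \<beta>, \<gamma>, \<delta>) z powi 1 * bqf_theta a b c z"
    if m: "(\<alpha>, \<beta>, \<gamma>, \<delta>) \<in> Gamma0 N" and z: "Im z > 0" for \<alpha> \<beta> \<gamma> \<delta> z
  proof -
    have det: "\<alpha> * \<delta> - \<beta> * \<gamma> = 1" and dvd: "N dvd \<gamma>" using m by (auto simp: Gamma0_def SL2Z_def)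
    have "\<delta> \<noteq> 0"
    proof
      assume "\<delta> = 0"
      then have "\<gamma> dvd 1" using det by (metis dvd_minus_iff dvd_triv_right diff_0 mult_zero_right)
      then have "N dvd 1" using dvd by (rule dvd_trans[rotated])
      then have "N = 1" using Npos by simp
      then show False using N_mod_4 by simp
    qed
    then consider "\<delta> > 0" | "\<delta> < 0" by linarith
    then show ?thesis
    proof cases
      case 1
      show ?thesis using bqf_theta_transform_pos[OF det dvd 1 z] by (simp add: moebius_act_def automorphy_def)
    next
      case 2
      \<comment> \<open>Negating the matrix leaves the Moebius action alone, while the automorphy
        factor and the Kronecker symbol both change sign.\<close>
      have "bqf_theta a b c ((of_int (- \<alpha>) * z + of_int (- \<beta>)) / (of_int (- \<gamma>) * z + of_int (- \<delta>))) =
        of_int (kronecker (- N) (- \<delta>)) * (of_int (- \<gamma>) * z + of_int (- \<delta>)) * bqf_theta a b c z"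
        by (rule bqf_theta_transform_pos) (use det dvd 2 z in auto)
      moreover have "(of_int (- \<alpha>) * z + of_int (- \<beta>)) / (of_int (- \<gamma>) * z + of_int (- \<delta>)) =
        (of_int \<alpha> * z + of_int \<beta>) / (of_int \<gamma> * z + of_int \<delta>)"
      proof -
        have "of_int (- \<alpha>) * z + of_int (- \<beta>) = - (of_int \<alpha> * z + of_int \<beta>)"
          "of_int (- \<gamma>) * z + of_int (- \<delta>) = - (of_int \<gamma> * z + of_int \<delta>)" by simp_all
        then show ?thesis by (simp only: minus_divide_divide)
      qed
      moreover have "kronecker (- N) \<delta> = - kronecker (- N) (- \<delta>)"
        using kronecker_minus[of "- N" "- \<delta>"] 2 Npos by simp
      ultimately show ?thesis by (simp add: moebius_act_def automorphy_def algebra_simps)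
    qed
  qed
  have bd: "Bfun (slash 1 (bqf_theta a b c) m) (filtercomap Im at_top)" if m: "m \<in> SL2Z" for m
  proof -
    obtain \<alpha> \<beta> \<gamma> \<delta> where e: "m = (\<alpha>, \<beta>, \<gamma>, \<delta>)" by (cases m)
    have det: "\<alpha> * \<delta> - \<beta> * \<gamma> = 1" using m by (auto simp: e SL2Z_def)
    define j where "j z = of_int \<gamma> * z + of_int \<delta>" for z :: complex
    have "\<exists>C. \<forall>z. Im z \<ge> 1 \<longrightarrow> norm (bqf_theta a b c ((of_int \<alpha> * z + of_int \<beta>) / j z)) \<le> C * norm (j z)"
    proof -
      \<comment> \<open>For \<gamma> = 0 the matrix is a translation up to sign; the case \<gamma> <
        0 reduces to \<gamma> > 0 by negating the matrix.\<close>
      consider "\<gamma> = 0" | "\<gamma> > 0" | "\<gamma> < 0" by linarith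
      then show ?thesis
      proof cases
        case 1
        then have ad: "\<alpha> * \<delta> = 1" using det by simp
        then have "\<delta> = 1 \<and> \<alpha> = 1 \<or> \<delta> = -1 \<and> \<alpha> = -1" by (auto simp: zmult_eq_1_iff)
        then have n: "norm (j z) = 1" and i: "Im ((of_int \<alpha> * z + of_int \<beta>) / j z) = Im z" for z
          using 1 by (auto simp: j_def)
        obtain C where "\<And>z. Im z \<ge> 1 \<Longrightarrow> norm (bqf_theta a b c z) \<le> C" using bqf_theta_bounded by blast
        then show ?thesis using i n by (intro exI[of _ C]) auto
      next
        case 2
        then show ?thesis using bqf_theta_cusp_bounded[OF det] unfolding j_def by metis
      next
        case 3
        have "(- \<alpha>) * (- \<delta>) - (- \<beta>) * (- \<gamma>) = 1" using det by simp
        then obtain C where C: "\<And>z. Im z \<ge> 1 \<Longrightarrow> norm (bqf_theta a b c ((of_int (- \<alpha>) * z + of_int (- \<beta>)) / (of_int (- \<gamma>) * z + of_int (- \<delta>)))) \<le>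
            C * norm (of_int (- \<gamma>) * z + of_int (- \<delta>))"
          using bqf_theta_cusp_bounded[of "- \<alpha>" "- \<delta>" "- \<beta>" "- \<gamma>"] 3 by auto
        have e1: "of_int (- \<alpha>) * z + of_int (- \<beta>) = - (of_int \<alpha> * z + of_int \<beta>)"
          "of_int (- \<gamma>) * z + of_int (- \<delta>) = - j z" for z by (simp_all add: j_def)
        show ?thesis using C unfolding e1 minus_divide_divide norm_minus_cancel by blast
      qed
    qed
    then obtain C where C: "\<And>z. Im z \<ge> 1 \<Longrightarrow> norm (bqf_theta a b c ((of_int \<alpha> * z + of_int \<beta>) / j z)) \<le> C * norm (j z)"
      by blast
    \<comment> \<open>\<open>Bfun\<close> asks for a positive bound, hence
      \<open>max C 1\<close>.\<close>
    have "norm (slash 1 (bqf_theta a b c) m z) \<le> max C 1" if z: "Im z \<ge> 1" for z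
    proof -
      have j0: "j z \<noteq> 0" unfolding j_def by (rule Im_moebius(1)[OF det]) (use z in simp)
      have "slash 1 (bqf_theta a b c) m z = bqf_theta a b c ((of_int \<alpha> * z + of_int \<beta>) / j z) / j z"
        by (simp add: slash_def e automorphy_def moebius_act_def j_def power_int_minus field_simps)
      then have "norm (slash 1 (bqf_theta a b c) m z) = norm (bqf_theta a b c ((of_int \<alpha> * z + of_int \<beta>) / j z)) / norm (j z)"
        by (simp only: norm_divide)
      also have "\<dots> \<le> C" using C[OF z] j0 by (simp add: divide_le_eq)
      finally show ?thesis by simp
    qed
    then have nb: "Im z \<ge> 1 \<Longrightarrow> norm (slash 1 (bqf_theta a b c) m z) \<le> max C 1" for z .
    have "eventually (\<lambda>z. Im z \<ge> 1) (filtercomap Im at_top)"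
      by (rule eventually_filtercomapI) (rule eventually_ge_at_top)
    then have "eventually (\<lambda>z. norm (slash 1 (bqf_theta a b c) m z) \<le> max C 1) (filtercomap Im at_top)"
      by (rule eventually_mono) (rule nb)
    then show ?thesis unfolding Bfun_def by (intro exI[of _ "max C 1"]) auto
  qed
  show ?thesis
    using holo trans bd by (auto simp: modular_forms_def upper_half_plane_def)
qed

end

section \<open>Traces and rings of integers\<close>

text \<open>The determinant argument: stability of the integer span makes x an eigenvalue of an
  integer matrix, hence a root of its monic characteristic polynomial. The nonzero \<open>s\<close>
  ensures that the vector of generators is an eigenvector.\<close>

lemma algebraic_int_stable_span:
  fixes x :: "'a::field_char_0"
  assumes "finite S" "s \<in> S" "s \<noteq> 0" and stable: "\<And>t. t \<in> S \<Longrightarrow> x * t \<in> int_mod.span S"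
  shows "algebraic_int x"
proof -
  obtain vs where vs: "set vs = S" "distinct vs" using finite_distinct_list[OF assms(1)] by blast
  define n where "n = length vs"
  have "\<exists>u. x * t = (\<Sum>v\<in>S. of_int (u v) * v)" if "t \<in> S" for t
    using stable[OF that] int_mod.span_finite[OF assms(1)] by auto
  then obtain u where u: "\<And>t. t \<in> S \<Longrightarrow> x * t = (\<Sum>v\<in>S. of_int (u t v) * v)" by metis
  define A :: "int mat" where "A = Matrix.mat n n (\<lambda>(i, j). u (vs ! i) (vs ! j))"
  define M :: "'a mat" where "M = map_mat of_int A"
  have A: "A \<in> carrier_mat n n" and M: "M \<in> carrier_mat n n" by (simp_all add: A_def M_def)
  define v where "v = Matrix.vec n (\<lambda>i. vs ! i)"
  have "M *\<^sub>v v = x \<cdot>\<^sub>v v"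
  proof (rule eq_vecI)
    fix i assume "i < dim_vec (x \<cdot>\<^sub>v v)"
    then have i: "i < n" by (simp add: v_def)
    have "(M *\<^sub>v v) $ i = (\<Sum>j<n. of_int (u (vs ! i) (vs ! j)) * vs ! j)"
      using i by (simp add: M_def A_def v_def scalar_prod_def row_def atLeast0LessThan)
    also have "\<dots> = (\<Sum>w\<in>S. of_int (u (vs ! i) w) * w)"
      using vs unfolding n_def by (intro sum.reindex_bij_betw[of "(!) vs"] bij_betw_nth) auto
    also have "\<dots> = x * vs ! i" using u[of "vs ! i"] vs(1) nth_mem[of i vs] i unfolding n_def by simp
    finally show "(M *\<^sub>v v) $ i = (x \<cdot>\<^sub>v v) $ i" using i by (simp add: v_def)
  qed (simp add: v_def M_def A_def)
  moreover have "v \<noteq> 0\<^sub>v n"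
  proof
    assume h: "v = 0\<^sub>v n"
    obtain i where i: "i < n" "vs ! i = s" using assms(2) vs(1) by (auto simp: in_set_conv_nth n_def)
    then have "v $ i = s" by (simp add: v_def)
    then show False using h i assms(3) by simp
  qed
  ultimately have "eigenvector M v x" unfolding eigenvector_def using M by (auto simp: v_def)
  then have "eigenvalue M x" by (auto simp: eigenvalue_def)
  then have "poly (char_poly M) x = 0" using eigenvalue_root_char_poly[OF M] by simp
  moreover have "char_poly M = map_poly of_int (char_poly A)"
    unfolding M_def by (rule of_int_hom.char_poly_hom[OF A])
  moreover have "monic (char_poly A)" using degree_monic_char_poly[OF A] by simp
  ultimately show ?thesis unfolding algebraic_int_altdef_ipoly by metis
qed

lemma int_span_mult_stable:
  fixes x :: "'a::field_char_0"
  assumes "\<And>s. s \<in> S \<Longrightarrow> x * s \<in> int_mod.span S" "t \<in> int_mod.span S"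
  shows "x * t \<in> int_mod.span S"
  using assms(2)
proof (induction rule: int_mod.span_induct_alt)
  case base
  show ?case by (simp add: int_mod.span_zero)
next
  case (step c s t)
  have "x * (of_int c * s + t) = of_int c * (x * s) + x * t" by (simp add: algebra_simps)
  then show ?case using step assms(1) by (metis int_mod.span_add int_mod.span_scale)
qed

lemma algebraic_int_power_span:
  fixes x :: "'a::field_char_0"
  assumes "algebraic_int x"
  obtains m where "m > 0" "x ^ m \<in> int_mod.span ((\<lambda>i. x ^ i) ` {..<m})"
proof -
  obtain p where p: "poly (map_poly of_int p) x = 0" "monic p"
    using assms unfolding algebraic_int_altdef_ipoly by blast
  define m where "m = degree p"
  have m: "m > 0"
  proof (rule ccontr)
    assume "\<not> m > 0"
    then have "degree p = 0" by (simp add: m_def)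
    then have "p = 1" using monic_degree_0[OF p(2)] by blast
    then show False using p(1) by simp
  qed
  have "0 = (\<Sum>i\<le>m. of_int (poly.coeff p i) * x ^ i)"
    using p(1) by (simp add: poly_altdef m_def)
  also have "\<dots> = (\<Sum>i<m. of_int (poly.coeff p i) * x ^ i) + x ^ m"
    using p(2) by (simp add: m_def lessThan_Suc_atMost[symmetric])
  finally have "x ^ m = (\<Sum>i<m. of_int (- poly.coeff p i) * x ^ i)"
    by (simp add: sum_negf eq_neg_iff_add_eq_0 add.commute)
  also have "\<dots> \<in> int_mod.span ((\<lambda>i. x ^ i) ` {..<m})"
    by (intro int_mod.span_sum int_mod.span_scale int_mod.span_base) auto
  finally show ?thesis using m that by blast
qed

text \<open>The products x^i y^j with i < m and j < n span a lattice stable under x and under y,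
  hence under their sum and product.\<close>

lemma algebraic_int_add_mult:
  fixes x y :: "'a::field_char_0"
  assumes "algebraic_int x" "algebraic_int y"
  shows "algebraic_int (x + y) \<and> algebraic_int (x * y)"
proof -
  obtain m where m: "m > 0" "x ^ m \<in> int_mod.span ((\<lambda>i. x ^ i) ` {..<m})"
    using algebraic_int_power_span[OF assms(1)] .
  obtain n where n: "n > 0" "y ^ n \<in> int_mod.span ((\<lambda>i. y ^ i) ` {..<n})"
    using algebraic_int_power_span[OF assms(2)] .
  define S where "S = (\<lambda>(i, j). x ^ i * y ^ j) ` ({..<m} \<times> {..<n})"
  have S: "finite S" "1 \<in> S" using m n by (auto simp: S_def intro!: image_eqI[of _ _ "(0, 0)"])
  have spx: "t * y ^ j \<in> int_mod.span S" if "t \<in> int_mod.span ((\<lambda>i. x ^ i) ` {..<m})" "j < n" for t j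
    using that(1)
  proof (induction rule: int_mod.span_induct_alt)
    case base
    show ?case by (simp add: int_mod.span_zero)
  next
    case (step c s t)
    have "s * y ^ j \<in> S" using step(1) that(2) by (auto simp: S_def)
    then show ?case using step(2)
      by (simp add: ring_distribs mult.assoc int_mod.span_add int_mod.span_scale int_mod.span_base)
  qed
  have spy: "x ^ i * t \<in> int_mod.span S" if "t \<in> int_mod.span ((\<lambda>i. y ^ i) ` {..<n})" "i < m" for t i
    using that(1)
  proof (induction rule: int_mod.span_induct_alt)
    case base
    show ?case by (simp add: int_mod.span_zero)
  next
    case (step c s t)
    have "x ^ i * s \<in> S" using step(1) that(2) by (auto simp: S_def)
    then show ?case using step(2)
      by (simp add: ring_distribs mult.left_commute[of "x ^ i"] int_mod.span_add int_mod.span_scale int_mod.span_base)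
  qed
  have x: "x * s \<in> int_mod.span S" if sS: "s \<in> S" for s
  proof -
    obtain i j where s: "s = x ^ i * y ^ j" "i < m" "j < n" using sS by (auto simp: S_def)
    have "x ^ Suc i \<in> int_mod.span ((\<lambda>i. x ^ i) ` {..<m})"
      using m s(2) by (cases "Suc i = m") (auto intro!: int_mod.span_base image_eqI[of _ _ "Suc i"])
    then have "x ^ Suc i * y ^ j \<in> int_mod.span S" using s(3) by (rule spx)
    then show ?thesis by (simp add: s(1) mult.assoc)
  qed
  have y: "y * s \<in> int_mod.span S" if sS: "s \<in> S" for s
  proof -
    obtain i j where s: "s = x ^ i * y ^ j" "i < m" "j < n" using sS by (auto simp: S_def)
    have "y ^ Suc j \<in> int_mod.span ((\<lambda>i. y ^ i) ` {..<n})"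
      using n s(3) by (cases "Suc j = n") (auto intro!: int_mod.span_base image_eqI[of _ _ "Suc j"])
    then have "x ^ i * y ^ Suc j \<in> int_mod.span S" using s(2) by (rule spy)
    then show ?thesis by (simp add: s(1) mult.left_commute)
  qed
  have "(x + y) * s \<in> int_mod.span S" if "s \<in> S" for s
    using x[OF that] y[OF that] by (simp add: ring_distribs int_mod.span_add)
  moreover have "x * y * s \<in> int_mod.span S" if "s \<in> S" for s
    using int_span_mult_stable[of S x "y * s", OF x y[OF that]] by (simp add: mult.assoc)
  ultimately show ?thesis
    using algebraic_int_stable_span[OF S(1,2)] by auto
qed

lemma algebraic_int_add: "algebraic_int x \<Longrightarrow> algebraic_int y \<Longrightarrow> algebraic_int (x + y)"
  and algebraic_int_mult: "algebraic_int x \<Longrightarrow> algebraic_int y \<Longrightarrow> algebraic_int (x * y)"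
  for x y :: "'a::field_char_0"
  using algebraic_int_add_mult by auto

lemma algebraic_int_sum_list:
  "(\<And>x. x \<in> set xs \<Longrightarrow> algebraic_int x) \<Longrightarrow> algebraic_int (sum_list xs :: 'a::field_char_0)"
  by (induction xs) (auto intro: algebraic_int_add)

section \<open>Traces of complex matrices in terms of eigenvalues\<close>

definition mat_trace :: "'a::comm_ring_1 mat \<Rightarrow> 'a" where
  "mat_trace A = (\<Sum>i<dim_row A. A $$ (i, i))"

lemma mat_trace_mult_commute:
  assumes "A \<in> carrier_mat n m" "B \<in> carrier_mat m n"
  shows "mat_trace (A * B) = mat_trace (B * A)"
proof -
  have "mat_trace (A * B) = (\<Sum>i<n. \<Sum>j<m. A $$ (i, j) * B $$ (j, i))"
    using assms by (auto simp: mat_trace_def scalar_prod_def atLeast0LessThan)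
  also have "\<dots> = (\<Sum>j<m. \<Sum>i<n. B $$ (j, i) * A $$ (i, j))"
    by (subst sum.swap) (simp add: mult.commute)
  also have "\<dots> = mat_trace (B * A)"
    using assms by (auto simp: mat_trace_def scalar_prod_def atLeast0LessThan)
  finally show ?thesis .
qed

lemma mat_trace_conjugate:
  assumes "A \<in> carrier_mat n n" "P \<in> carrier_mat n n" "Q \<in> carrier_mat n n" "Q * P = 1\<^sub>m n"
  shows "mat_trace (P * A * Q) = mat_trace A"
proof -
  have "mat_trace (P * A * Q) = mat_trace (Q * (P * A))"
    using assms by (intro mat_trace_mult_commute) auto
  also have "Q * (P * A) = Q * P * A" using assms by (intro assoc_mult_mat[symmetric]) auto
  finally show ?thesis using assms by simp
qed

text \<open>Triangularising \<open>A\<close> puts the eigenvalues on the diagonal. The same base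
  change takes \<open>A * A\<close> to the square of the triangular matrix, so one list serves both
  traces.\<close>

lemma mat_trace_eigenvalues:
  fixes A :: "complex mat"
  assumes A: "A \<in> carrier_mat n n"
  obtains es where "mat_trace A = sum_list es" "mat_trace (A * A) = (\<Sum>e\<leftarrow>es. e\<^sup>2)"
    "length es = n" "\<And>e. e \<in> set es \<Longrightarrow> eigenvalue A e"
proof -
  obtain es where es: "char_poly A = (\<Prod>e\<leftarrow>es. [:- e, 1:])" using char_poly_factorized[OF A] by blast
  obtain B P Q where sd: "schur_decomposition A es = (B, P, Q)" by (metis surj_pair)
  have d: "similar_mat_wit A B P Q" "upper_triangular B" "diag_mat B = es"
    using schur_decomposition[OF A es sd] by auto
  have c: "B \<in> carrier_mat n n" "P \<in> carrier_mat n n" "Q \<in> carrier_mat n n" "Q * P = 1\<^sub>m n" "P * Q = 1\<^sub>m n" "A = P * B * Q"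
    using d(1) A unfolding similar_mat_wit_def Let_def by auto
  have len: "length es = n" using d(3) c by (auto simp: diag_mat_def)
  have esi: "es ! i = B $$ (i, i)" if "i < n" for i using d(3) c that by (auto simp: diag_mat_def)
  have "mat_trace A = mat_trace B" unfolding c(6) by (rule mat_trace_conjugate) (use c in auto)
  also have "\<dots> = sum_list es"
    using c esi len by (auto simp: mat_trace_def sum_list_sum_nth atLeast0LessThan)
  finally have 1: "mat_trace A = sum_list es" .
  have "A * A = P * (B * B) * Q"
  proof -
    have PB: "P * B \<in> carrier_mat n n" and BQ: "B * Q \<in> carrier_mat n n" using c by auto
    have "A * A = P * B * (Q * (P * B * Q))"
      unfolding c(6) by (rule assoc_mult_mat[OF PB c(3)]) (use c in auto)
    also have "P * B * Q = P * (B * Q)" by (rule assoc_mult_mat[OF c(2,1,3)])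
    also have "Q * (P * (B * Q)) = Q * P * (B * Q)" by (rule assoc_mult_mat[OF c(3,2) BQ, symmetric])
    also have "\<dots> = B * Q" using c BQ by simp
    also have "P * B * (B * Q) = P * B * B * Q" by (rule assoc_mult_mat[OF PB c(1,3), symmetric])
    also have "P * B * B = P * (B * B)" by (rule assoc_mult_mat[OF c(2,1,1)])
    finally show ?thesis .
  qed
  then have "mat_trace (A * A) = mat_trace (B * B)"
    using mat_trace_conjugate[of "B * B" n P Q] c by auto
  also have "\<dots> = (\<Sum>i<n. (B $$ (i, i))\<^sup>2)"
  proof -
    have "mat_trace (B * B) = (\<Sum>i<n. \<Sum>j<n. B $$ (i, j) * B $$ (j, i))"
      using c(1) by (auto simp: mat_trace_def scalar_prod_def atLeast0LessThan)
    also have "\<dots> = (\<Sum>i<n. \<Sum>j<n. if j = i then (B $$ (i, i))\<^sup>2 else 0)"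
    proof (intro sum.cong refl)
      fix i j assume "i \<in> {..<n}" "j \<in> {..<n}"
      then show "B $$ (i, j) * B $$ (j, i) = (if j = i then (B $$ (i, i))\<^sup>2 else 0)"
        using d(2) c(1) by (cases i j rule: linorder_cases) (auto simp: upper_triangular_def power2_eq_square)
    qed
    finally show ?thesis by simp
  qed
  also have "\<dots> = (\<Sum>e\<leftarrow>es. e\<^sup>2)"
    using esi len by (simp add: sum_list_sum_nth atLeast0LessThan)
  finally have 2: "mat_trace (A * A) = (\<Sum>e\<leftarrow>es. e\<^sup>2)" .
  have "eigenvalue A e" if "e \<in> set es" for e
  proof -
    have "poly (char_poly A) e = 0" unfolding es poly_prod_list
      using that by (auto simp: prod_list_zero_iff image_iff intro!: bexI[of _ e])
    then show ?thesis using eigenvalue_root_char_poly[OF A] by simp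
  qed
  with 1 2 len show ?thesis by (rule that)
qed

section \<open>The trace of a number field and its integers\<close>

locale number_field_loc =
  fixes K :: "'a::field_char_0 set"
  assumes nf: "number_field K"
begin

abbreviation "tr \<equiv> field_trace K"

lemma K_subfield: "is_subfield K" using nf by (simp add: number_field_def)

lemma K_0 [simp, intro]: "0 \<in> K" and K_1 [simp, intro]: "1 \<in> K"
  and K_diff [intro]: "x \<in> K \<Longrightarrow> y \<in> K \<Longrightarrow> x - y \<in> K"
  and K_mult [intro]: "x \<in> K \<Longrightarrow> y \<in> K \<Longrightarrow> x * y \<in> K"
  and K_divide [intro]: "x \<in> K \<Longrightarrow> y \<in> K \<Longrightarrow> x / y \<in> K"
  using K_subfield by (auto simp: is_subfield_def)

lemma K_uminus [intro]: "x \<in> K \<Longrightarrow> - x \<in> K" using K_diff[of 0 x] by simp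

lemma K_add [intro]: "x \<in> K \<Longrightarrow> y \<in> K \<Longrightarrow> x + y \<in> K"
  using K_diff[of x "- y"] K_uminus[of y] by simp

lemma K_of_nat [simp, intro]: "of_nat n \<in> K" by (induction n) auto

lemma K_of_int [simp, intro]: "of_int n \<in> K" by (cases n rule: int_cases2) auto

lemma K_of_rat [simp, intro]: "of_rat q \<in> K"
proof (cases q)
  case (Fract a b)
  then show ?thesis using K_divide[of "of_int a" "of_int b"] by (simp add: of_rat_rat)
qed

lemma K_power [intro]: "x \<in> K \<Longrightarrow> x ^ n \<in> K" by (induction n) auto

lemma K_subspace: "rat_vs.subspace K" by (rule rat_vs.subspaceI) auto

lemma K_span_subset: "S \<subseteq> K \<Longrightarrow> rat_vs.span S \<subseteq> K"
  by (rule rat_vs.span_minimal[OF _ K_subspace])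

text \<open>The very basis that \<open>field_trace\<close> chooses, so that the trace unfolds into
  the coordinates \<open>crd\<close>.\<close>

definition B :: "'a set" where "B = (SOME B. rat_basis K B)"

lemma rat_basis_props:
  assumes "rat_basis K C"
  shows "finite C" "card C = field_degree K" "rat_vs.span C = K"
proof -
  obtain F where F: "finite F" "K \<subseteq> rat_vs.span F" using nf by (auto simp: number_field_def)
  have C: "C \<subseteq> K" "rat_vs.independent C" "K \<subseteq> rat_vs.span C" using assms by (auto simp: rat_basis_def)
  show "finite C" using rat_vs.independent_span_bound[OF F(1) C(2)] C(1) F(2) by auto
  show "rat_vs.span C = K" using C K_span_subset by blast
  show "card C = field_degree K"
    unfolding field_degree_def using rat_vs.basis_card_eq_dim C by blast
qed

lemma B_basis: "rat_basis K B"
proof -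
  obtain C where "C \<subseteq> K" "rat_vs.independent C" "K \<subseteq> rat_vs.span C"
    using rat_vs.basis_exists[of K] by metis
  then have "\<exists>C. rat_basis K C" by (auto simp: rat_basis_def)
  then show ?thesis unfolding B_def by (rule someI_ex)
qed

lemmas B_finite = rat_basis_props(1)[OF B_basis]
  and B_card = rat_basis_props(2)[OF B_basis]
  and B_span = rat_basis_props(3)[OF B_basis]

lemma B_K: "b \<in> B \<Longrightarrow> b \<in> K" and B_indep: "rat_vs.independent B"
  using B_basis by (auto simp: rat_basis_def)

abbreviation "crd \<equiv> rat_vs.representation B"

lemma crd_add: "x \<in> K \<Longrightarrow> y \<in> K \<Longrightarrow> crd (x + y) b = crd x b + crd y b"
  using rat_vs.representation_add[OF B_indep] B_span by auto

lemma crd_scale: "x \<in> K \<Longrightarrow> crd (of_rat q * x) b = q * crd x b"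
  using rat_vs.representation_scale[OF B_indep] B_span by auto

lemma crd_sum: "x \<in> K \<Longrightarrow> (\<Sum>b\<in>B. of_rat (crd x b) * b) = x"
  using rat_vs.sum_representation_eq[OF B_indep, of x B] B_span B_finite by auto

lemma tr_eq: "tr x = (\<Sum>b\<in>B. crd (x * b) b)"
  by (simp add: field_trace_def B_def Let_def)

lemma tr_add: "x \<in> K \<Longrightarrow> y \<in> K \<Longrightarrow> tr (x + y) = tr x + tr y"
  unfolding tr_eq by (simp add: ring_distribs crd_add B_K K_mult sum.distrib)

lemma tr_scale: "x \<in> K \<Longrightarrow> tr (of_rat q * x) = q * tr x"
  unfolding tr_eq by (simp add: mult.assoc crd_scale B_K K_mult sum_distrib_left)

lemma tr_scale_int: "x \<in> K \<Longrightarrow> tr (of_int n * x) = of_int n * tr x"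
  using tr_scale[of x "of_int n"] by simp

lemma tr_1: "tr 1 = of_nat (field_degree K)"
  unfolding tr_eq using rat_vs.representation_basis[OF B_indep] by (simp add: B_card)

lemma tr_of_rat: "tr (of_rat q) = q * of_nat (field_degree K)"
  using tr_scale[of 1 q] tr_1 by simp

lemma tr_of_int: "tr (of_int n) = of_int n * of_nat (field_degree K)"
  using tr_of_rat[of "of_int n"] by simp

lemma tr_0 [simp]: "tr 0 = 0" using tr_of_int[of 0] by simp

lemma tr_uminus: "x \<in> K \<Longrightarrow> tr (- x) = - tr x"
  using tr_scale[of x "-1"] by simp

lemma tr_diff: "x \<in> K \<Longrightarrow> y \<in> K \<Longrightarrow> tr (x - y) = tr x - tr y"
  using tr_add[of x "- y"] tr_uminus[of y] K_uminus[of y] by simp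

text \<open>An eigenform of eigenvalue \<open>e\<close> stands in for an embedding of \<open>K\<close> into \<open>\<complex>\<close> mapping \<open>x\<close> to \<open>e\<close>:
  eigenforms come directly from triangularising the multiplication by \<open>x\<close> over \<open>\<complex>\<close>.\<close>

definition eigenform :: "('a \<Rightarrow> complex) \<Rightarrow> 'a \<Rightarrow> complex \<Rightarrow> bool" where
  "eigenform \<phi> x e \<longleftrightarrow> (\<forall>y\<in>K. \<forall>z\<in>K. \<phi> (y + z) = \<phi> y + \<phi> z) \<and>
     (\<forall>q. \<forall>y\<in>K. \<phi> (of_rat q * y) = of_rat q * \<phi> y) \<and> (\<forall>y\<in>K. \<phi> (x * y) = e * \<phi> y) \<and> (\<exists>y\<in>K. \<phi> y \<noteq> 0)"

text \<open>Row i of \<open>A\<close> holds the coordinates of x times the i-th basis element. Then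
  \<open>A * A\<close> belongs to x^2, and an eigenvector v defines the linear form taking the i-th
  basis element to v_i, for which A v = e v says that multiplication by x acts as e.\<close>

lemma trace_eigenvalues:
  assumes x: "x \<in> K"
  obtains es where "of_rat (tr x) = sum_list es" "of_rat (tr (x\<^sup>2)) = (\<Sum>e\<leftarrow>es. e\<^sup>2)"
    "length es = field_degree K" "\<And>e. e \<in> set es \<Longrightarrow> \<exists>\<phi>. eigenform \<phi> x e"
proof -
  obtain bs where bs: "set bs = B" "distinct bs" using finite_distinct_list[OF B_finite] by blast
  define n where "n = field_degree K"
  have len: "length bs = n" using bs B_card distinct_card[of bs] by (simp add: n_def)
  have bsB: "bs ! i \<in> B" if "i < n" for i using that bs(1) len by (metis nth_mem)
  have sumB: "(\<Sum>b\<in>B. f b) = (\<Sum>i<n. f (bs ! i))" for f :: "'a \<Rightarrow> 'b::comm_monoid_add"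
    by (rule sum.reindex_bij_betw[symmetric]) (use bs len bij_betw_nth[of bs "{..<n}" B] in auto)
  define A where "A = Matrix.mat n n (\<lambda>(i, j). of_rat (crd (x * bs ! i) (bs ! j)) :: complex)"
  have A: "A \<in> carrier_mat n n" by (simp add: A_def)
  have trA: "mat_trace A = of_rat (tr x)"
    by (simp add: mat_trace_def A_def tr_eq sumB of_rat_sum)
  have trAA: "mat_trace (A * A) = of_rat (tr (x\<^sup>2))"
  proof -
    have "crd (x\<^sup>2 * bs ! i) b = (\<Sum>j<n. crd (x * bs ! i) (bs ! j) * crd (x * bs ! j) b)" if i: "i < n" for i b
    proof -
      have crd_sum': "crd (\<Sum>j\<in>J. of_rat (g j) * h j) b = (\<Sum>j\<in>J. g j * crd (h j) b)"
        if "finite J" "\<And>j. j \<in> J \<Longrightarrow> h j \<in> K" for J :: "nat set" and g h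
        using that
      proof (induction J rule: finite_induct)
        case empty
        show ?case using crd_scale[of 0 0 b] by simp
      next
        case (insert j J)
        have "(\<Sum>j\<in>J. of_rat (g j) * h j) \<in> K"
          using insert by (intro rat_vs.subspace_sum[OF K_subspace]) auto
        then show ?case using insert by (simp add: crd_add crd_scale K_mult)
      qed
      have "x\<^sup>2 * bs ! i = x * (\<Sum>b\<in>B. of_rat (crd (x * bs ! i) b) * b)"
        using x bsB[OF i] by (subst crd_sum) (auto simp: B_K power2_eq_square mult.assoc)
      also have "\<dots> = (\<Sum>j<n. of_rat (crd (x * bs ! i) (bs ! j)) * (x * bs ! j))"
        by (simp add: sumB sum_distrib_left mult.left_commute)
      finally have "crd (x\<^sup>2 * bs ! i) b = crd (\<Sum>j<n. of_rat (crd (x * bs ! i) (bs ! j)) * (x * bs ! j)) b" by simp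
      also have "\<dots> = (\<Sum>j<n. crd (x * bs ! i) (bs ! j) * crd (x * bs ! j) b)"
        by (rule crd_sum') (use x bsB B_K in auto)
      finally show ?thesis .
    qed
    then show ?thesis
      unfolding tr_eq sumB
      by (simp add: mat_trace_def A_def scalar_prod_def atLeast0LessThan of_rat_sum of_rat_mult)
  qed
  obtain es where es: "mat_trace A = sum_list es" "mat_trace (A * A) = (\<Sum>e\<leftarrow>es. e\<^sup>2)"
    "length es = n" "\<And>e. e \<in> set es \<Longrightarrow> eigenvalue A e"
    using mat_trace_eigenvalues[OF A] by metis
  have "\<exists>\<phi>. eigenform \<phi> x e" if e: "e \<in> set es" for e
  proof -
    obtain v where v: "v \<in> carrier_vec n" "v \<noteq> 0\<^sub>v n" "A *\<^sub>v v = e \<cdot>\<^sub>v v"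
      using es(4)[OF e] A by (auto simp: eigenvalue_def eigenvector_def)
    define \<phi> where "\<phi> y = (\<Sum>i<n. of_rat (crd y (bs ! i)) * v $ i)" for y
    have add: "\<phi> (y + z) = \<phi> y + \<phi> z" if "y \<in> K" "z \<in> K" for y z
      using that by (simp add: \<phi>_def crd_add of_rat_add ring_distribs sum.distrib)
    have scale: "\<phi> (of_rat q * y) = of_rat q * \<phi> y" if "y \<in> K" for q y
      using that by (simp add: \<phi>_def crd_scale of_rat_mult sum_distrib_left mult.assoc)
    have base: "\<phi> (bs ! i) = v $ i" if "i < n" for i
    proof -
      have "crd (bs ! i) (bs ! j) = (if j = i then 1 else 0)" if "j < n" for j
        using rat_vs.representation_basis[OF B_indep bsB[OF \<open>i < n\<close>]] bs(2) len that \<open>i < n\<close>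
        by (auto simp: nth_eq_iff_index_eq)
      then have "\<phi> (bs ! i) = (\<Sum>j<n. if j = i then v $ j else 0)"
        unfolding \<phi>_def by (intro sum.cong) auto
      then show ?thesis using that by simp
    qed
    have act: "\<phi> (x * bs ! i) = e * \<phi> (bs ! i)" if i: "i < n" for i
    proof -
      have "(A *\<^sub>v v) $ i = (e \<cdot>\<^sub>v v) $ i" using v(3) by simp
      then show ?thesis
        using i v(1) by (simp add: A_def \<phi>_def scalar_prod_def atLeast0LessThan base[OF i, unfolded \<phi>_def])
    qed
    have sumK: "(\<Sum>j\<in>J. h j) \<in> K \<and> \<phi> (\<Sum>j\<in>J. h j) = (\<Sum>j\<in>J. \<phi> (h j))"
      if "finite J" "\<And>j. j \<in> J \<Longrightarrow> h j \<in> K" for J :: "nat set" and h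
      using that
    proof (induction J rule: finite_induct)
      case empty
      show ?case using scale[of 0 0] by simp
    next
      case (insert j J)
      then show ?case by (simp add: add K_add)
    qed
    have mult: "\<phi> (x * y) = e * \<phi> y" if y: "y \<in> K" for y
    proof -
      define q where "q j = crd y (bs ! j)" for j
      have y_eq: "y = (\<Sum>j<n. of_rat (q j) * bs ! j)" using crd_sum[OF y] by (simp add: sumB q_def)
      have "x * y = (\<Sum>j<n. of_rat (q j) * (x * bs ! j))"
        by (subst y_eq) (simp add: sum_distrib_left mult.left_commute)
      then have "\<phi> (x * y) = (\<Sum>j<n. of_rat (q j) * \<phi> (x * bs ! j))"
        using sumK[of "{..<n}" "\<lambda>j. of_rat (q j) * (x * bs ! j)"] x bsB B_K by (simp add: scale K_mult)
      also have "\<dots> = e * (\<Sum>j<n. of_rat (q j) * \<phi> (bs ! j))"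
        by (simp add: act sum_distrib_left mult.left_commute)
      also have "(\<Sum>j<n. of_rat (q j) * \<phi> (bs ! j)) = \<phi> (\<Sum>j<n. of_rat (q j) * bs ! j)"
        using sumK[of "{..<n}" "\<lambda>j. of_rat (q j) * bs ! j"] bsB B_K by (simp add: scale K_mult)
      finally show ?thesis using y_eq by simp
    qed
    obtain i where "i < n" "v $ i \<noteq> 0"
    proof -
      have "\<exists>i<n. v $ i \<noteq> 0"
      proof (rule ccontr)
        assume "\<not> (\<exists>i<n. v $ i \<noteq> 0)"
        then have "v = 0\<^sub>v n" using v(1) by (intro eq_vecI) auto
        then show False using v(2) by simp
      qed
      then show ?thesis using that by blast
    qed
    then have "\<exists>y\<in>K. \<phi> y \<noteq> 0" using base bsB B_K by (intro bexI[of _ "bs ! i"]) auto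
    then show ?thesis using add scale mult unfolding eigenform_def by blast
  qed
  with es trA trAA show ?thesis using that unfolding n_def by metis
qed

lemma map_poly_of_rat_pCons:
  "map_poly of_rat (pCons q p) = (pCons (of_rat q) (map_poly of_rat p) :: 'b::field_char_0 poly)"
  by (rule poly_eqI) (simp add: coeff_map_poly coeff_pCons split: nat.split)

lemma eigenform_poly:
  assumes "eigenform \<phi> x e" "x \<in> K" "y \<in> K"
  shows "\<phi> (poly (map_poly of_rat p) x * y) = poly (map_poly of_rat p) e * \<phi> y"
  using assms(3)
proof (induction p arbitrary: y)
  case 0
  have "\<phi> (of_rat 0 * 0) = of_rat 0 * \<phi> 0" using assms(1) unfolding eigenform_def by blast
  then show ?case by simp
next
  case (pCons q p)
  have pK: "poly (map_poly of_rat p) x \<in> K"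
    using assms(2) by (induction p) (auto simp: map_poly_of_rat_pCons)
  have "poly (map_poly of_rat (pCons q p)) x * y = of_rat q * y + poly (map_poly of_rat p) x * (x * y)"
    by (simp add: map_poly_of_rat_pCons algebra_simps)
  also have "\<phi> \<dots> = \<phi> (of_rat q * y) + \<phi> (poly (map_poly of_rat p) x * (x * y))"
    using assms(1) pCons.prems assms(2) pK unfolding eigenform_def by (metis K_mult K_of_rat)
  also have "\<phi> (of_rat q * y) = of_rat q * \<phi> y"
    using assms(1) pCons.prems unfolding eigenform_def by blast
  also have "\<phi> (poly (map_poly of_rat p) x * (x * y)) = poly (map_poly of_rat p) e * \<phi> (x * y)"
    using pCons.prems assms(2) by (intro pCons.IH) auto
  also have "\<phi> (x * y) = e * \<phi> y"
    using assms(1) pCons.prems unfolding eigenform_def by blast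
  finally show ?case by (simp add: map_poly_of_rat_pCons algebra_simps)
qed

text \<open>An eigenvalue satisfies every rational polynomial equation of x, so it behaves like a
  conjugate of x and inherits integrality.\<close>

lemma eigenform_root:
  assumes "eigenform \<phi> x e" "x \<in> K" "poly (map_poly of_rat p) x = 0"
  shows "poly (map_poly of_rat p) e = 0"
proof -
  obtain y where y: "y \<in> K" "\<phi> y \<noteq> 0" using assms(1) unfolding eigenform_def by blast
  have "\<phi> (of_rat 0 * 0) = of_rat 0 * \<phi> 0" using assms(1) unfolding eigenform_def by blast
  then show ?thesis using eigenform_poly[OF assms(1,2) y(1), of p] assms(3) y(2) by simp
qed

text \<open>Division by x stays in K: \<phi> y = \<phi> (x (y / x)) = e \<phi> (y / x), so e = 0
  would kill the form.\<close>

lemma eigenform_nonzero: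
  assumes "eigenform \<phi> x e" "x \<in> K" "x \<noteq> 0"
  shows "e \<noteq> 0"
proof
  assume "e = 0"
  obtain y where y: "y \<in> K" "\<phi> y \<noteq> 0" using assms(1) unfolding eigenform_def by blast
  have "\<phi> (x * (y / x)) = e * \<phi> (y / x)"
    using assms(1,2) y(1) unfolding eigenform_def by blast
  then show False using \<open>e = 0\<close> y(2) assms(3) by simp
qed

abbreviation "OK \<equiv> ring_of_integers K"

lemma OK_K: "x \<in> OK \<Longrightarrow> x \<in> K" by (simp add: ring_of_integers_def)

lemma eigenform_algebraic_int:
  assumes "eigenform \<phi> x e" "x \<in> OK"
  shows "algebraic_int e"
proof -
  have x: "x \<in> K" "algebraic_int x" using assms by (auto simp: ring_of_integers_def)
  obtain p where p: "poly (map_poly of_int p) x = 0" "monic p"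
    using x(2) unfolding algebraic_int_altdef_ipoly by blast
  have pr: "map_poly of_rat (map_poly of_int p) = (map_poly of_int p :: 'b::field_char_0 poly)" for p
    by (simp add: map_poly_map_poly o_def)
  have "poly (map_poly of_rat (map_poly of_int p)) e = 0"
    using eigenform_root[of \<phi> x e "map_poly of_int p"] assms(1) x(1) p(1) by (simp add: pr)
  then have "poly (map_poly of_int p) e = 0" by (simp add: pr)
  then show ?thesis using p(2) unfolding algebraic_int_altdef_ipoly by blast
qed

text \<open>The trace is rational and a sum of eigenvalues, each an algebraic integer.\<close>

lemma trace_algebraic_int:
  assumes "x \<in> OK"
  shows "tr x \<in> \<int>"
proof -
  obtain es where es: "of_rat (tr x) = sum_list es" "\<And>e. e \<in> set es \<Longrightarrow> \<exists>\<phi>. eigenform \<phi> x e"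
    using trace_eigenvalues[OF OK_K[OF assms]] by metis
  have "algebraic_int (of_rat (tr x) :: complex)"
    unfolding es(1) using es(2) eigenform_algebraic_int assms by (intro algebraic_int_sum_list) blast
  then have "(of_rat (tr x) :: complex) \<in> \<int>" by (rule rational_algebraic_int_is_int) simp
  then obtain n where "(of_rat (tr x) :: complex) = of_int n" by (rule Ints_cases)
  then have "(of_rat (tr x) :: complex) = of_rat (of_int n)" by simp
  then have "tr x = of_int n" by (simp only: of_rat_eq_iff)
  then show ?thesis by simp
qed

lemma OK_add: "x \<in> OK \<Longrightarrow> y \<in> OK \<Longrightarrow> x + y \<in> OK"
  and OK_mult: "x \<in> OK \<Longrightarrow> y \<in> OK \<Longrightarrow> x * y \<in> OK"
  by (auto simp: ring_of_integers_def intro: algebraic_int_add algebraic_int_mult)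

lemma OK_of_int [simp]: "of_int n \<in> OK"
  by (auto simp: ring_of_integers_def intro: int_imp_algebraic_int)

lemma OK_uminus: "x \<in> OK \<Longrightarrow> - x \<in> OK" using OK_mult[of "of_int (-1)" x] OK_of_int[of "-1"] by simp

lemma OK_diff: "x \<in> OK \<Longrightarrow> y \<in> OK \<Longrightarrow> x - y \<in> OK"
  using OK_add[of x "- y"] OK_uminus[of y] by simp

lemma OK_1 [simp]: "1 \<in> OK" and OK_0 [simp]: "0 \<in> OK"
  using OK_of_int[of 1] OK_of_int[of 0] by simp_all

lemma OK_of_rat: "of_rat q \<in> OK \<Longrightarrow> q \<in> \<int>"
proof -
  assume "of_rat q \<in> OK"
  then have "algebraic_int (of_rat q :: 'a)" by (simp add: ring_of_integers_def)
  then have "(of_rat q :: 'a) \<in> \<int>" by (rule rational_algebraic_int_is_int) simp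
  then obtain n where "(of_rat q :: 'a) = of_int n" by (rule Ints_cases)
  then have "(of_rat q :: 'a) = of_rat (of_int n)" by simp
  then have "q = of_int n" by (simp only: of_rat_eq_iff)
  then show ?thesis by simp
qed

end

section \<open>Generators of quadratic and cubic fields\<close>

lemma common_denominator:
  fixes S :: "rat set"
  assumes "finite S"
  shows "\<exists>m::int. m > 0 \<and> (\<forall>q\<in>S. of_int m * q \<in> \<int>)"
  using assms
proof (induction S rule: finite_induct)
  case empty
  show ?case by (intro exI[of _ 1]) auto
next
  case (insert q S)
  then obtain m where m: "m > 0" "\<And>q. q \<in> S \<Longrightarrow> of_int m * q \<in> \<int>" by blast
  obtain a b where q: "q = Rat.Fract a b" "b > 0" by (cases q) auto
  have "of_int b * q = of_int a" using q by (simp add: Fract_of_int_quotient)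
  then have "of_int (m * b) * q = of_int m * of_int a" by (simp add: mult.assoc)
  then have 1: "of_int (m * b) * q \<in> \<int>" by (metis Ints_mult Ints_of_int)
  have 2: "of_int (m * b) * r \<in> \<int>" if "r \<in> S" for r
  proof -
    have "of_int (m * b) * r = of_int b * (of_int m * r)" by simp
    then show ?thesis using m(2)[OF that] by (metis Ints_mult Ints_of_int)
  qed
  show ?case using 1 2 m q by (intro exI[of _ "m * b"]) auto
qed

lemma span_1: "rat_vs.span {1} = range (of_rat :: rat \<Rightarrow> 'a::field_char_0)"
  by (auto simp: rat_vs.span_singleton)

lemma span_1_x:
  fixes x y :: "'a::field_char_0"
  shows "y \<in> rat_vs.span {1, x} \<longleftrightarrow> (\<exists>a b. y = of_rat a + of_rat b * x)"
proof -
  have "{1, x} = insert x {1}" by auto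
  then have "y \<in> rat_vs.span {1, x} \<longleftrightarrow> (\<exists>k a. y - of_rat k * x = of_rat a)"
    by (simp add: rat_vs.span_insert span_1 image_iff)
  then show ?thesis by (simp add: algebra_simps) metis
qed

lemma independent_1_x:
  fixes x :: "'a::field_char_0"
  assumes "x \<notin> range of_rat"
  shows "rat_vs.independent {1, x}" "card {1, x} = 2"
proof -
  have "x \<noteq> 1" using assms by (metis of_rat_1 rangeI)
  then show "card {1, x} = 2" by simp
  have "rat_vs.independent (insert x {1})"
    using assms \<open>x \<noteq> 1\<close> unfolding rat_vs.independent_insert span_1 by (simp add: rat_vs.independent_empty)
  then show "rat_vs.independent {1, x}" by (simp add: insert_commute)
qed

context number_field_loc
begin

text \<open>A common denominator m of the matrix of multiplication by x makes m x stabilise the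
  integer span of \<open>B\<close>.\<close>

lemma multiple_in_OK:
  assumes "x \<in> K"
  obtains m :: int where "m > 0" "of_int m * x \<in> OK"
proof -
  have "finite ((\<lambda>(b, b'). crd (x * b) b') ` (B \<times> B))" using B_finite by auto
  from common_denominator[OF this] obtain m :: int where m: "m > 0"
    "\<And>q. q \<in> (\<lambda>(b, b'). crd (x * b) b') ` (B \<times> B) \<Longrightarrow> of_int m * q \<in> \<int>"
    by blast
  have "B \<noteq> {}"
  proof
    assume "B = {}"
    then have "K = {0}" using B_span by (simp add: rat_vs.span_empty)
    then show False using K_1 by auto
  qed
  then obtain b where b: "b \<in> B" by blast
  have b0: "b \<noteq> 0" using B_indep b rat_vs.dependent_zero[of B] by auto
  have "algebraic_int (of_int m * x)"
  proof (rule algebraic_int_stable_span[OF B_finite b b0])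
    fix t assume t: "t \<in> B"
    have "of_int m * x * t = of_int m * (\<Sum>b\<in>B. of_rat (crd (x * t) b) * b)"
      using assms t by (subst crd_sum) (auto simp: B_K mult.assoc)
    also have "\<dots> = (\<Sum>b\<in>B. of_rat (of_int m * crd (x * t) b) * b)"
      by (simp add: sum_distrib_left of_rat_mult mult.assoc)
    also have "\<dots> \<in> int_mod.span B"
    proof (intro int_mod.span_sum)
      fix b assume b: "b \<in> B"
      obtain k where "of_int m * crd (x * t) b = of_int k"
      proof (rule Ints_cases)
        show "of_int m * crd (x * t) b \<in> \<int>" by (rule m(2)) (use t b in \<open>auto intro!: image_eqI[of _ _ "(t, b)"]\<close>)
      qed
      then have "of_rat (of_int m * crd (x * t) b) * b = of_int k * b" by simp
      then show "of_rat (of_int m * crd (x * t) b) * b \<in> int_mod.span B"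
        using b by (simp only: int_mod.span_scale int_mod.span_base)
    qed
    finally show "of_int m * x * t \<in> int_mod.span B" .
  qed
  then have "of_int m * x \<in> OK" using assms by (auto simp: ring_of_integers_def)
  with m(1) show ?thesis by (rule that)
qed

lemma independent_card_le:
  assumes "S \<subseteq> K" "rat_vs.independent S"
  shows "finite S" "card S \<le> field_degree K" "card S = field_degree K \<Longrightarrow> rat_vs.span S = K"
proof -
  obtain C where C: "S \<subseteq> C" "C \<subseteq> K" "rat_vs.independent C" "K \<subseteq> rat_vs.span C"
    using rat_vs.maximal_independent_subset_extend[OF assms] by blast
  then have "rat_basis K C" by (simp add: rat_basis_def)
  note p = rat_basis_props[OF this]
  show "finite S" using p(1) C(1) finite_subset by blast
  show "card S \<le> field_degree K" using p(1,2) C(1) card_mono by metis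
  show "rat_vs.span S = K" if "card S = field_degree K"
  proof -
    have "S = C" using that p(1,2) C(1) by (intro card_subset_eq) auto
    then show ?thesis using p(3) by simp
  qed
qed

lemma quadratic_generated:
  assumes "field_degree K = 2" "x \<in> K" "x \<notin> range of_rat" "y \<in> K"
  obtains a b where "y = of_rat a + of_rat b * x"
proof -
  have "rat_vs.span {1, x} = K"
    using independent_card_le(3)[of "{1, x}"] independent_1_x[OF assms(3)] assms by simp
  then show ?thesis using span_1_x[of y x] assms(4) that by blast
qed

lemma exists_irrational:
  assumes "field_degree K \<ge> 2"
  obtains x where "x \<in> K" "x \<notin> range of_rat"
proof -
  have "\<not> K \<subseteq> range of_rat"
  proof
    assume h: "K \<subseteq> range of_rat"
    have "rat_basis K {1}" using h by (simp add: rat_basis_def span_1 rat_vs.independent_insert)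
    then show False using rat_basis_props(2) assms by force
  qed
  then show ?thesis using that by blast
qed

text \<open>The degree formula by hand: were x^2 a rational combination of 1 and x, any y outside
  their span would give four independent elements 1, x, y, x y in a field of degree 3.\<close>

lemma cubic_square_not_in_span:
  assumes deg: "field_degree K = 3" and x: "x \<in> K" "x \<notin> range of_rat"
  shows "x\<^sup>2 \<notin> rat_vs.span {1, x}"
proof
  assume "x\<^sup>2 \<in> rat_vs.span {1, x}"
  then obtain u v where uv: "x\<^sup>2 = of_rat u + of_rat v * x" by (auto simp: span_1_x)
  have "\<not> K \<subseteq> rat_vs.span {1, x}"
  proof
    assume "K \<subseteq> rat_vs.span {1, x}"
    then have "rat_basis K {1, x}" using independent_1_x[OF x(2)] x by (simp add: rat_basis_def)
    then show False using rat_basis_props(2) independent_1_x(2)[OF x(2)] deg by force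
  qed
  then obtain y where y: "y \<in> K" "y \<notin> rat_vs.span {1, x}" by blast
  have iy: "rat_vs.independent (insert y {1, x})" "y \<notin> {1, x}"
    using rat_vs.independent_insertI[OF y(2) independent_1_x(1)[OF x(2)]] y(2) rat_vs.span_base[of y "{1, x}"] by auto
  have nsp: "x * y \<notin> rat_vs.span (insert y {1, x})"
  proof
    assume "x * y \<in> rat_vs.span (insert y {1, x})"
    then obtain g a b where "x * y - of_rat g * y = of_rat a + of_rat b * x"
      by (auto simp: rat_vs.span_insert[of y] span_1_x)
    then have e: "(x - of_rat g) * y = of_rat a + of_rat b * x" by (simp add: algebra_simps)
    \<comment> \<open>As x^2 = u + v x, the product (x - g)(x - (v - g)) is the rational number
      \<open>c\<close>. It is nonzero, so x - g can be inverted and y falls into the span of 1 and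
      x.\<close>
    define c where "c = u + g * (v - g)"
    have xg: "x \<noteq> of_rat r" for r using x(2) by auto
    have f: "(x - of_rat (v - g)) * (x - of_rat g) = of_rat c"
    proof -
      have "(x - of_rat (v - g)) * (x - of_rat g) = x\<^sup>2 - of_rat v * x + of_rat (g * (v - g))"
        by (simp add: power2_eq_square algebra_simps of_rat_diff of_rat_mult)
      then show ?thesis by (simp add: uv c_def of_rat_add)
    qed
    have "of_rat c \<noteq> (0::'a)" unfolding f[symmetric] using xg[of g] xg[of "v - g"] by simp
    then have c0: "c \<noteq> 0" by auto
    have "of_rat c * y = (x - of_rat (v - g)) * ((x - of_rat g) * y)" by (simp only: f[symmetric] mult.assoc)
    also have "\<dots> = (x - of_rat (v - g)) * (of_rat a + of_rat b * x)" by (simp only: e)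
    also have "\<dots> = of_rat b * x\<^sup>2 + of_rat (a - b * (v - g)) * x - of_rat (a * (v - g))"
      by (simp add: power2_eq_square algebra_simps of_rat_diff of_rat_mult of_rat_add)
    also have "\<dots> = of_rat (b * u - a * (v - g)) + of_rat (b * v + a - b * (v - g)) * x"
      by (simp add: uv algebra_simps of_rat_diff of_rat_mult of_rat_add)
    finally have "of_rat c * y \<in> rat_vs.span {1, x}" unfolding span_1_x by blast
    then have "of_rat (1 / c) * (of_rat c * y) \<in> rat_vs.span {1, x}" by (rule rat_vs.span_scale)
    moreover have "of_rat (1 / c) * (of_rat c * y) = y"
      using c0 by (simp add: mult.assoc[symmetric] of_rat_mult[symmetric])
    ultimately show False using y(2) by simp
  qed
  then have nin: "x * y \<notin> insert y {1, x}"
    using rat_vs.span_base[of "x * y" "insert y {1, x}"] by blast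
  have "rat_vs.independent (insert (x * y) (insert y {1, x}))"
    by (rule rat_vs.independent_insertI[OF nsp iy(1)])
  moreover have "insert (x * y) (insert y {1, x}) \<subseteq> K" using x y by auto
  ultimately have "card (insert (x * y) (insert y {1, x})) \<le> field_degree K"
    by (intro independent_card_le(2))
  moreover have "card (insert (x * y) (insert y {1, x})) = Suc (Suc 2)"
    using nin iy(2) independent_1_x(2)[OF x(2)] by (simp only: card_insert_disjoint finite_insert finite.emptyI if_True not_False_eq_True)
  ultimately show False using deg by simp
qed

lemma cubic_generated:
  assumes deg: "field_degree K = 3" and x: "x \<in> K" "x \<notin> range of_rat" and y: "y \<in> K"
  obtains a b c where "y = of_rat a + of_rat b * x + of_rat c * x\<^sup>2"
proof -
  let ?S = "insert (x\<^sup>2) {1, x}"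
  have n: "x\<^sup>2 \<notin> rat_vs.span {1, x}" by (rule cubic_square_not_in_span[OF deg x])
  then have "x\<^sup>2 \<notin> {1, x}" using rat_vs.span_base[of _ "{1, x}"] by blast
  then have "card ?S = Suc 2"
    using independent_1_x(2)[OF x(2)] by (subst card_insert_disjoint) auto
  moreover have "rat_vs.independent ?S" by (rule rat_vs.independent_insertI[OF n independent_1_x(1)[OF x(2)]])
  moreover have "?S \<subseteq> K" using x by auto
  ultimately have "rat_vs.span ?S = K" using deg by (intro independent_card_le(3)) auto
  then have "y \<in> rat_vs.span ?S" using y by simp
  then obtain c a b where "y - of_rat c * x\<^sup>2 = of_rat a + of_rat b * x"
    by (auto simp: rat_vs.span_insert[of "x\<^sup>2"] span_1_x)
  then have "y = of_rat a + of_rat b * x + of_rat c * x\<^sup>2" by (simp add: algebra_simps)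
  then show ?thesis by (rule that)
qed

lemma tr_0_irrational:
  assumes "x \<noteq> 0" "tr x = 0" "field_degree K > 0"
  shows "x \<notin> range of_rat"
  using assms tr_of_rat by auto

text \<open>tr(x^2) is the sum of the squares of the eigenvalues of x, which must be shown real and
  nonzero. As x generates K, an eigenform normalised to 1 at 1 is multiplicative, hence an embedding
  taking x to the eigenvalue, and total reality applies.\<close>

lemma tr_square_pos:
  assumes deg: "field_degree K = 3" and real: "totally_real K"
    and x: "x \<in> K" "tr x = 0" "x \<noteq> 0"
  shows "tr (x\<^sup>2) > 0"
proof -
  have nx: "x \<notin> range of_rat" using tr_0_irrational[OF x(3,2)] deg by simp
  obtain es where es: "of_rat (tr (x\<^sup>2)) = (\<Sum>e\<leftarrow>es. e\<^sup>2)" "length es = 3" "\<And>e. e \<in> set es \<Longrightarrow> \<exists>\<phi>. eigenform \<phi> x e"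
    using trace_eigenvalues[OF x(1)] deg by metis
  have er: "e \<in> \<real>" "e \<noteq> 0" if e: "e \<in> set es" for e
  proof -
    obtain \<phi> where \<phi>: "eigenform \<phi> x e" using es(3)[OF e] by blast
    show "e \<noteq> 0" by (rule eigenform_nonzero[OF \<phi> x(1,3)])
    have p: "\<phi> (y + z) = \<phi> y + \<phi> z" "\<phi> (of_rat q * y) = of_rat q * \<phi> y" "\<phi> (x * y) = e * \<phi> y"
      if "y \<in> K" "z \<in> K" for y z q
      using \<phi>[unfolded eigenform_def, THEN conjunct1, rule_format, OF that]
        \<phi>[unfolded eigenform_def, THEN conjunct2, THEN conjunct1, rule_format, OF that(1)]
        \<phi>[unfolded eigenform_def, THEN conjunct2, THEN conjunct2, THEN conjunct1, rule_format, OF that(1)]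
      by simp_all
    have ev: "\<phi> ((of_rat a + of_rat b * x + of_rat c * x\<^sup>2) * w) = (of_rat a + of_rat b * e + of_rat c * e\<^sup>2) * \<phi> w"
      if w: "w \<in> K" for a b c w
    proof -
      have e1: "\<phi> (x * w) = e * \<phi> w" by (rule p(3)[OF w w])
      have e2: "\<phi> (x * (x * w)) = e * (e * \<phi> w)" using p(3)[of "x * w" w] w x(1) e1 by (simp add: K_mult)
      have "(of_rat a + of_rat b * x + of_rat c * x\<^sup>2) * w = of_rat a * w + (of_rat b * (x * w) + of_rat c * (x * (x * w)))"
        by (simp add: power2_eq_square algebra_simps)
      also have "\<phi> \<dots> = of_rat a * \<phi> w + (of_rat b * \<phi> (x * w) + of_rat c * \<phi> (x * (x * w)))"
        using w x(1) by (simp only: p(1) p(2)[OF _ K_0] K_add K_mult K_of_rat)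
      also have "\<dots> = (of_rat a + of_rat b * e + of_rat c * e\<^sup>2) * \<phi> w"
        unfolding e1 e2 by (simp add: power2_eq_square algebra_simps)
      finally show ?thesis .
    qed
    obtain y where y: "y \<in> K" "\<phi> y \<noteq> 0" using \<phi> unfolding eigenform_def by blast
    \<comment> \<open>If \<open>\<phi> 1\<close> were 0, then \<phi> would vanish on every
      polynomial in x, that is, on K.\<close>
    have one: "\<phi> 1 \<noteq> 0"
    proof -
      obtain a b c where "y = of_rat a + of_rat b * x + of_rat c * x\<^sup>2"
        using cubic_generated[OF deg x(1) nx y(1)] .
      then show ?thesis using ev[of 1 a b c] y(2) by auto
    qed
    define \<sigma> where "\<sigma> y = \<phi> y / \<phi> 1" for y
    have "complex_embedding K \<sigma>"
      unfolding complex_embedding_def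
    proof (intro conjI ballI)
      show "\<sigma> 1 = 1" using one by (simp add: \<sigma>_def)
      fix y z assume y: "y \<in> K" and z: "z \<in> K"
      show "\<sigma> (y + z) = \<sigma> y + \<sigma> z" using p(1)[OF y z] by (simp add: \<sigma>_def add_divide_distrib)
      obtain a b c where y_eq: "y = of_rat a + of_rat b * x + of_rat c * x\<^sup>2"
        using cubic_generated[OF deg x(1) nx y] .
      show "\<sigma> (y * z) = \<sigma> y * \<sigma> z"
        using ev[OF z, of a b c] ev[OF K_1, of a b c] one by (simp add: \<sigma>_def y_eq)
    qed
    then have "\<sigma> x \<in> \<real>" using real x(1) unfolding totally_real_def by blast
    moreover have "\<sigma> x = e" using p(3)[OF K_1 K_1] one by (simp add: \<sigma>_def)
    ultimately show "e \<in> \<real>" by simp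
  qed
  have "\<exists>r. r > 0 \<and> (\<Sum>e\<leftarrow>es'. e\<^sup>2) = complex_of_real r" if "es' \<noteq> []" "set es' \<subseteq> set es" for es'
    using that
  proof (induction es' rule: list_nonempty_induct)
    case (single e)
    then obtain s where "e = of_real s" "s \<noteq> 0" using er[of e] by (auto elim: Reals_cases)
    then show ?case by (intro exI[of _ "s\<^sup>2"]) auto
  next
    case (cons e es')
    then obtain s where "e = of_real s" "s \<noteq> 0" using er[of e] by (auto elim: Reals_cases)
    moreover obtain r where "r > 0" "(\<Sum>e\<leftarrow>es'. e\<^sup>2) = complex_of_real r" using cons by auto
    ultimately show ?case by (intro exI[of _ "s\<^sup>2 + r"]) (auto intro: add_pos_pos)
  qed
  then obtain r where r: "r > 0" "of_rat (tr (x\<^sup>2)) = complex_of_real r"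
  proof -
    have "es \<noteq> []" using es(2) by auto
    then show ?thesis using that es(1) \<open>\<And>es'. es' \<noteq> [] \<Longrightarrow> set es' \<subseteq> set es \<Longrightarrow> \<exists>r. r > 0 \<and> (\<Sum>e\<leftarrow>es'. e\<^sup>2) = complex_of_real r\<close>[of es] by auto
  qed
  \<comment> \<open>The trace is rational, while positivity is known for a real number inside the
    complex plane; a quotient of integers carries the sign back.\<close>
  obtain a b where q: "tr (x\<^sup>2) = Rat.Fract a b" "b > 0" by (cases "tr (x\<^sup>2)") auto
  then have ab: "tr (x\<^sup>2) = of_int a / of_int b" by (simp add: Fract_of_int_quotient)
  have "complex_of_real (of_int a / of_int b) = complex_of_real r"
    using r(2) by (simp add: ab of_rat_divide)
  then have "real_of_int a / of_int b = r" by (simp only: of_real_eq_iff)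
  then have "real_of_int a / of_int b > 0" using r(1) by simp
  then have "a > 0" using q(2) by (simp add: zero_less_divide_iff)
  then show ?thesis using q(2) by (simp add: ab)
qed

end

section \<open>Integral bases and the discriminant\<close>

lemma det_mat_1: "Determinant.det (Matrix.mat (Suc 0) (Suc 0) f) = (f (0, 0) :: 'a::comm_ring_1)"
  by (subst det_single) auto

lemma det_2x2:
  fixes A :: "'a::comm_ring_1 mat"
  assumes A: "A \<in> carrier_mat 2 2"
  shows "Determinant.det A = A $$ (0, 0) * A $$ (1, 1) - A $$ (0, 1) * A $$ (1, 0)"
proof -
  have "Determinant.det A = (\<Sum>j<2. A $$ (0, j) * cofactor A 0 j)"
    by (rule laplace_expansion_row[OF A]) simp
  also have "\<dots> = A $$ (0, 0) * cofactor A 0 0 + A $$ (0, 1) * cofactor A 0 1"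
    by (simp add: numeral_2_eq_2)
  finally show ?thesis
    using A by (simp add: cofactor_def mat_delete_def det_mat_1)
qed

lemma det_mat_2:
  "Determinant.det (Matrix.mat (Suc (Suc 0)) (Suc (Suc 0)) f) =
     (f (0, 0) * f (1, 1) - f (0, 1) * f (1, 0) :: 'a::comm_ring_1)"
  by (subst det_2x2) (auto simp: numeral_2_eq_2)

lemma det_3x3:
  fixes A :: "'a::comm_ring_1 mat"
  assumes A: "A \<in> carrier_mat 3 3"
  shows "Determinant.det A =
    A $$ (0, 0) * (A $$ (1, 1) * A $$ (2, 2) - A $$ (1, 2) * A $$ (2, 1)) -
    A $$ (0, 1) * (A $$ (1, 0) * A $$ (2, 2) - A $$ (1, 2) * A $$ (2, 0)) +
    A $$ (0, 2) * (A $$ (1, 0) * A $$ (2, 1) - A $$ (1, 1) * A $$ (2, 0))"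
proof -
  have "Determinant.det A = (\<Sum>j<3. A $$ (0, j) * cofactor A 0 j)"
    by (rule laplace_expansion_row[OF A]) simp
  also have "\<dots> = A $$ (0, 0) * cofactor A 0 0 + A $$ (0, 1) * cofactor A 0 1 + A $$ (0, 2) * cofactor A 0 2"
    by (simp add: numeral_3_eq_3 numeral_2_eq_2)
  finally show ?thesis
    using A by (simp add: cofactor_def det_mat_2 mat_delete_def numeral_2_eq_2 algebra_simps)
qed

lemma rat_independent_if_int_independent:
  fixes S :: "'a::field_char_0 set"
  assumes fin: "finite S" and ind: "int_mod.independent S"
  shows "rat_vs.independent S"
proof
  assume "rat_vs.dependent S"
  then obtain u w where u: "(\<Sum>v\<in>S. of_rat (u v) * v) = 0" and w: "w \<in> S" "u w \<noteq> 0"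
    using rat_vs.dependent_finite[OF fin] by auto
  have "finite (u ` S)" using fin by simp
  from common_denominator[OF this] obtain m :: int where m: "m > 0" "\<And>q. q \<in> u ` S \<Longrightarrow> of_int m * q \<in> \<int>"
    by blast
  define k where "k v = \<lfloor>of_int m * u v\<rfloor>" for v
  have k: "of_int (k v) = of_int m * u v" if "v \<in> S" for v
    using m(2)[of "u v"] that by (auto simp: k_def elim: Ints_cases)
  have "(\<Sum>v\<in>S. of_int (k v) * v) = (\<Sum>v\<in>S. of_int m * (of_rat (u v) * v))"
  proof (intro sum.cong refl)
    fix v assume "v \<in> S"
    have "(of_int (k v) :: 'a) = of_rat (of_int (k v))" by simp
    also have "\<dots> = of_rat (of_int m * u v)" using k[OF \<open>v \<in> S\<close>] by simp
    also have "\<dots> = of_int m * of_rat (u v)" by (simp add: of_rat_mult)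
    finally show "of_int (k v) * v = of_int m * (of_rat (u v) * v)" by (simp add: mult.assoc)
  qed
  also have "\<dots> = 0" using u by (simp add: sum_distrib_left[symmetric])
  finally have "(\<Sum>v\<in>S. of_int (k v) * v) = 0" .
  moreover have "k w \<noteq> 0" using k[OF w(1)] w(2) m(1) by auto
  ultimately have "int_mod.dependent S" using int_mod.dependent_finite[OF fin] w(1) by auto
  then show False using ind by simp
qed

context number_field_loc
begin

lemma integral_basis_OK:
  assumes "integral_basis K bs" "b \<in> set bs"
  shows "b \<in> OK"
  using assms int_mod.span_base unfolding integral_basis_def by blast

text \<open>Every element of K has a nonzero integer multiple in \<open>OK\<close>, so an integral
  basis is also a rational basis.\<close>

lemma integral_basis_length:
  assumes "integral_basis K bs"
  shows "length bs = field_degree K"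
proof -
  have b: "distinct bs" "int_mod.independent (set bs)" "int_mod.span (set bs) = OK"
    using assms by (auto simp: integral_basis_def)
  have "K \<subseteq> rat_vs.span (set bs)"
  proof
    fix x assume "x \<in> K"
    then obtain m :: int where m: "m > 0" "of_int m * x \<in> OK" by (rule multiple_in_OK)
    have sub: "y \<in> rat_vs.span (set bs)" if "y \<in> int_mod.span (set bs)" for y
      using that
    proof (induction rule: int_mod.span_induct_alt)
      case (step c s t)
      have "of_rat (of_int c) * s + t \<in> rat_vs.span (set bs)"
        by (intro rat_vs.span_add rat_vs.span_scale) (use step rat_vs.span_base in auto)
      then show ?case by simp
    qed (rule rat_vs.span_zero)
    have "of_rat (1 / of_int m) * (of_int m * x) \<in> rat_vs.span (set bs)"
      using m(2) b(3) sub by (intro rat_vs.span_scale) auto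
    moreover have "of_rat (1 / of_int m) * (of_int m * x) = x" using m(1) by (simp add: of_rat_divide)
    ultimately show "x \<in> rat_vs.span (set bs)" by simp
  qed
  then have "rat_basis K (set bs)"
    using rat_independent_if_int_independent[OF _ b(2)] integral_basis_OK[OF assms] OK_K
    by (auto simp: rat_basis_def)
  then show ?thesis using rat_basis_props(2) distinct_card[OF b(1)] by metis
qed

lemma tr_sum:
  "finite J \<Longrightarrow> (\<And>j. j \<in> J \<Longrightarrow> h j \<in> K) \<Longrightarrow> (\<Sum>j\<in>J. h j) \<in> K \<and> tr (\<Sum>j\<in>J. h j) = (\<Sum>j\<in>J. tr (h j))"
  for h :: "nat \<Rightarrow> 'a"
  by (induction J rule: finite_induct) (auto simp: tr_add)

text \<open>The two trace matrices are related by R T R^t with R an integer matrix, so their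
  determinants differ by an integer square.\<close>

lemma trace_matrix_change:
  assumes bs: "integral_basis K bs" and cs: "integral_basis K cs"
  shows "\<exists>u::int. Determinant.det (trace_matrix K cs) = (of_int u)\<^sup>2 * Determinant.det (trace_matrix K bs)"
proof -
  define n where "n = field_degree K"
  have len: "length bs = n" "length cs = n" using integral_basis_length bs cs by (auto simp: n_def)
  have bK: "bs ! i \<in> K" if "i < n" for i
    using integral_basis_OK[OF bs, of "bs ! i"] OK_K that len by auto
  have sumb: "(\<Sum>b\<in>set bs. f b) = (\<Sum>i<n. f (bs ! i))" for f :: "'a \<Rightarrow> 'a"
    using bs len by (intro sum.reindex_bij_betw[symmetric] bij_betw_nth) (auto simp: integral_basis_def)
  have "\<exists>u. cs ! i = (\<Sum>j<n. of_int (u j) * bs ! j)" if "i < n" for i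
  proof -
    have "cs ! i \<in> int_mod.span (set bs)"
      using integral_basis_OK[OF cs, of "cs ! i"] that len bs by (auto simp: integral_basis_def)
    then obtain u where "cs ! i = (\<Sum>b\<in>set bs. of_int (u b) * b)"
      using int_mod.span_finite[of "set bs"] by auto
    then show ?thesis by (intro exI[of _ "\<lambda>j. u (bs ! j)"]) (simp add: sumb)
  qed
  then obtain u where u: "\<And>i. i < n \<Longrightarrow> cs ! i = (\<Sum>j<n. of_int (u i j) * bs ! j)" by metis
  define U :: "int mat" where "U = Matrix.mat n n (\<lambda>(i, j). u i j)"
  define R :: "rat mat" where "R = map_mat of_int U"
  define T where "T = trace_matrix K bs"
  have car: "R \<in> carrier_mat n n" "T \<in> carrier_mat n n" "transpose_mat R \<in> carrier_mat n n"
    by (auto simp: R_def U_def T_def trace_matrix_def len)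
  have "trace_matrix K cs = R * (T * transpose_mat R)"
  proof (rule eq_matI)
    fix i k assume "i < dim_row (R * (T * transpose_mat R))" "k < dim_col (R * (T * transpose_mat R))"
    then have i: "i < n" "k < n" using car by auto
    have "tr (cs ! i * cs ! k) = tr (\<Sum>j<n. of_int (u i j) * (bs ! j * cs ! k))"
      using u[OF i(1)] by (simp add: sum_distrib_right mult.assoc)
    also have "\<dots> = (\<Sum>j<n. of_int (u i j) * tr (bs ! j * cs ! k))"
    proof -
      have ck: "cs ! k \<in> K" using integral_basis_OK[OF cs, of "cs ! k"] OK_K i len by auto
      then show ?thesis
        using tr_sum[of "{..<n}" "\<lambda>j. of_int (u i j) * (bs ! j * cs ! k)"] bK
        by (simp add: K_mult tr_scale_int)
    qed
    also have "\<dots> = (\<Sum>j<n. of_int (u i j) * (\<Sum>l<n. tr (bs ! j * bs ! l) * of_int (u k l)))"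
    proof (intro sum.cong refl arg_cong2[of _ _ _ _ times])
      fix j assume "j \<in> {..<n}"
      then have bj: "bs ! j \<in> K" using bK by simp
      have "tr (bs ! j * cs ! k) = tr (\<Sum>l<n. of_int (u k l) * (bs ! j * bs ! l))"
        using u[OF i(2)] by (simp add: sum_distrib_left mult.left_commute)
      also have "\<dots> = (\<Sum>l<n. tr (bs ! j * bs ! l) * of_int (u k l))"
        using tr_sum[of "{..<n}" "\<lambda>l. of_int (u k l) * (bs ! j * bs ! l)"] bK bj
        by (simp add: K_mult tr_scale_int mult.commute)
      finally show "tr (bs ! j * cs ! k) = (\<Sum>l<n. tr (bs ! j * bs ! l) * of_int (u k l))" .
    qed
    finally show "trace_matrix K cs $$ (i, k) = (R * (T * transpose_mat R)) $$ (i, k)"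
      using i by (simp add: trace_matrix_def len T_def R_def U_def scalar_prod_def atLeast0LessThan)
  qed (use car in \<open>auto simp: trace_matrix_def len\<close>)
  then have "Determinant.det (trace_matrix K cs) = Determinant.det R * (Determinant.det T * Determinant.det (transpose_mat R))"
    using car by (simp add: Determinant.det_mult[of _ n])
  also have "Determinant.det (transpose_mat R) = Determinant.det R" by (rule Determinant.det_transpose[OF car(1)])
  also have "Determinant.det R = of_int (Determinant.det U)" unfolding R_def by (rule of_int_hom.hom_det)
  finally show ?thesis by (intro exI[of _ "Determinant.det U"]) (simp add: T_def power2_eq_square)
qed

text \<open>Base changes in both directions give (u v)^2 = 1 and hence u^2 = 1, unless both
  determinants are 0. This makes the description in \<open>field_discr\<close> unique.\<close>

lemma trace_matrix_unique:
  assumes bs: "integral_basis K bs" and cs: "integral_basis K cs"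
  shows "Determinant.det (trace_matrix K cs) = Determinant.det (trace_matrix K bs)"
proof -
  obtain u :: int where u: "Determinant.det (trace_matrix K cs) = (of_int u)\<^sup>2 * Determinant.det (trace_matrix K bs)"
    using trace_matrix_change[OF bs cs] by blast
  obtain v :: int where v: "Determinant.det (trace_matrix K bs) = (of_int v)\<^sup>2 * Determinant.det (trace_matrix K cs)"
    using trace_matrix_change[OF cs bs] by blast
  show ?thesis
  proof (cases "Determinant.det (trace_matrix K cs) = 0")
    case True
    then show ?thesis using v by simp
  next
    case False
    have "Determinant.det (trace_matrix K cs) = of_int ((u * v)\<^sup>2) * Determinant.det (trace_matrix K cs)"
      using u v by (simp add: power_mult_distrib)
    then have "rat_of_int ((u * v)\<^sup>2) = 1" using False by simp
    then have "(u * v)\<^sup>2 = 1" by (metis of_int_1 of_int_eq_iff)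
    then have "u dvd 1" by (metis dvd_triv_left dvd_trans mult.assoc power2_eq_square)
    then have "\<bar>u\<bar> = 1" by simp
    then have "u\<^sup>2 = 1" by (metis power2_abs one_power2)
    then have "(rat_of_int u)\<^sup>2 = 1" by (metis of_int_1 of_int_power)
    then show ?thesis using u by simp
  qed
qed

lemma trace_matrix_det_int:
  assumes bs: "integral_basis K bs"
  shows "Determinant.det (trace_matrix K bs) \<in> \<int>"
proof -
  define M where "M = Matrix.mat (length bs) (length bs) (\<lambda>(i, j). \<lfloor>tr (bs ! i * bs ! j)\<rfloor>)"
  have "trace_matrix K bs = map_mat of_int M"
  proof (rule eq_matI)
    fix i j assume "i < dim_row (map_mat rat_of_int M)" "j < dim_col (map_mat rat_of_int M)"
    then have ij: "i < length bs" "j < length bs" by (auto simp: M_def)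
    then have "bs ! i * bs ! j \<in> OK" by (intro OK_mult integral_basis_OK[OF bs]) auto
    then have "tr (bs ! i * bs ! j) \<in> \<int>" by (rule trace_algebraic_int)
    then have "of_int \<lfloor>tr (bs ! i * bs ! j)\<rfloor> = tr (bs ! i * bs ! j)" by (metis Ints_cases of_int_floor_cancel)
    then show "trace_matrix K bs $$ (i, j) = map_mat of_int M $$ (i, j)"
      using ij by (simp add: trace_matrix_def M_def del: of_int_floor_cancel)
  qed (auto simp: trace_matrix_def M_def)
  then show ?thesis by (simp add: of_int_hom.hom_det)
qed

lemma field_discr_eq:
  assumes bs: "integral_basis K bs"
  shows "of_int (field_discr K) = Determinant.det (trace_matrix K bs)"
proof -
  obtain D where D: "Determinant.det (trace_matrix K bs) = of_int D"
    using trace_matrix_det_int[OF bs] by (rule Ints_cases)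
  have "field_discr K = D"
    unfolding field_discr_def
  proof (rule the_equality)
    show "\<exists>bs. integral_basis K bs \<and> of_int D = Determinant.det (trace_matrix K bs)" using bs D by auto
    fix D' assume "\<exists>bs. integral_basis K bs \<and> of_int D' = Determinant.det (trace_matrix K bs)"
    then obtain cs where "integral_basis K cs" "of_int D' = Determinant.det (trace_matrix K cs)" by blast
    then have "rat_of_int D' = of_int D" using trace_matrix_unique[OF bs] D by simp
    then show "D' = D" by simp
  qed
  then show ?thesis using D by simp
qed

end

section \<open>Cubic fields\<close>

context number_field_loc
begin

abbreviation "L0 \<equiv> trace_zero_integers K"

lemma L0_iff: "x \<in> L0 \<longleftrightarrow> x \<in> OK \<and> tr x = 0" by (simp add: trace_zero_integers_def)

lemma L0_OK: "x \<in> L0 \<Longrightarrow> x \<in> OK" and L0_tr: "x \<in> L0 \<Longrightarrow> tr x = 0" and L0_K: "x \<in> L0 \<Longrightarrow> x \<in> K"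
  by (auto simp: L0_iff OK_K)

lemma L0_add: "x \<in> L0 \<Longrightarrow> y \<in> L0 \<Longrightarrow> x + y \<in> L0"
  and L0_diff: "x \<in> L0 \<Longrightarrow> y \<in> L0 \<Longrightarrow> x - y \<in> L0"
  and L0_scale: "x \<in> L0 \<Longrightarrow> of_int n * x \<in> L0"
  by (auto simp: L0_iff OK_add OK_diff OK_mult tr_add tr_diff tr_scale_int OK_K)

lemma tr_bilinear:
  assumes "u \<in> K" "v \<in> K"
  shows "tr ((of_rat a * u + of_rat b * v) * (of_rat c * u + of_rat d * v)) =
    a * c * tr (u\<^sup>2) + (a * d + b * c) * tr (u * v) + b * d * tr (v\<^sup>2)"
proof -
  have "(of_rat a * u + of_rat b * v) * (of_rat c * u + of_rat d * v) =
    of_rat (a * c) * u\<^sup>2 + (of_rat (a * d + b * c) * (u * v) + of_rat (b * d) * v\<^sup>2)"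
    by (simp add: of_rat_mult of_rat_add power2_eq_square algebra_simps)
  also have "tr \<dots> = a * c * tr (u\<^sup>2) + ((a * d + b * c) * tr (u * v) + b * d * tr (v\<^sup>2))"
    using assms by (simp only: tr_add tr_scale K_add K_mult K_power K_of_rat)
  finally show ?thesis by simp
qed

text \<open>The squared area of the parallelogram on u and v for the trace pairing; a base change
  multiplies it by the square of its determinant.\<close>

definition gram :: "'a \<Rightarrow> 'a \<Rightarrow> rat" where
  "gram u v = tr (u\<^sup>2) * tr (v\<^sup>2) - (tr (u * v))\<^sup>2"

lemma gram_transform:
  assumes "u \<in> K" "v \<in> K"
  shows "gram (of_rat a * u + of_rat b * v) (of_rat c * u + of_rat d * v) = (a * d - b * c)\<^sup>2 * gram u v"
  unfolding gram_def power2_eq_square[of "_ + _"] tr_bilinear[OF assms]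
  by (simp add: power2_eq_square algebra_simps)

lemma gram_transform_int:
  assumes "u \<in> K" "v \<in> K"
  shows "gram (of_int a * u + of_int b * v) (of_int c * u + of_int d * v) = (of_int (a * d - b * c))\<^sup>2 * gram u v"
  using gram_transform[OF assms, of "of_int a" "of_int b" "of_int c" "of_int d"] by simp

lemma gram_Ints:
  assumes "u \<in> OK" "v \<in> OK"
  shows "gram u v \<in> \<int>"
  unfolding gram_def using assms
  by (intro Ints_diff Ints_mult Ints_power trace_algebraic_int) (auto simp: OK_mult power2_eq_square)

end

locale cubic_field = number_field_loc +
  assumes deg: "field_degree K = 3" and real: "totally_real K"
begin

text \<open>f and g are x and x^2 projected to trace zero. The combination z = A g - B f is
  orthogonal to f for the trace pairing and tr(z^2) = A gram(f, g), so positivity of the trace form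
  makes the Gram determinant positive.\<close>

lemma trace_zero_plane:
  obtains f g where "f \<in> K" "g \<in> K" "tr f = 0" "tr g = 0" "gram f g > 0"
    "\<And>y. y \<in> K \<Longrightarrow> tr y = 0 \<Longrightarrow> \<exists>b c. y = of_rat b * f + of_rat c * g"
proof -
  obtain x where x: "x \<in> K" "x \<notin> range of_rat" using exists_irrational deg by auto
  define p where "p = tr x / 3"
  define p2 where "p2 = tr (x\<^sup>2) / 3"
  define f where "f = x - of_rat p"
  define g where "g = x\<^sup>2 - of_rat p2"
  have fg: "f \<in> K" "g \<in> K" using x by (auto simp: f_def g_def)
  have t: "tr f = 0" "tr g = 0" using x by (simp_all add: f_def g_def p_def p2_def tr_diff K_power tr_of_rat deg)
  have span: "\<exists>b c. y = of_rat b * f + of_rat c * g" if y: "y \<in> K" "tr y = 0" for y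
  proof -
    obtain a b c where e: "y = of_rat a + of_rat b * x + of_rat c * x\<^sup>2"
      using cubic_generated[OF deg x y(1)] .
    define r where "r = a + b * p + c * p2"
    have e2: "y = of_rat r + (of_rat b * f + of_rat c * g)"
      unfolding e r_def f_def g_def by (simp add: of_rat_add of_rat_mult algebra_simps)
    have "tr y = r * 3 + (b * tr f + c * tr g)"
      unfolding e2 using fg by (simp only: tr_add tr_scale tr_of_rat deg K_add K_mult K_of_rat)
    then have "r = 0" using y(2) t by simp
    then show ?thesis using e2 by auto
  qed
  have nsp: "x\<^sup>2 \<notin> rat_vs.span {1, x}" by (rule cubic_square_not_in_span[OF deg x])
  have "f \<noteq> 0" using x(2) by (auto simp: f_def)
  then have A: "tr (f\<^sup>2) > 0" using tr_square_pos[OF deg real fg(1) t(1)] by simp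
  define A where "A = tr (f\<^sup>2)"
  define B where "B = tr (f * g)"
  define z where "z = of_rat (- B) * f + of_rat A * g"
  have A0: "A > 0" using A by (simp add: A_def)
  have "z \<noteq> 0"
  proof
    assume "z = 0"
    then have "of_rat A * g = of_rat B * f" by (simp add: z_def of_rat_minus)
    then have "of_rat (1 / A) * (of_rat A * g) = of_rat (1 / A) * (of_rat B * f)" by simp
    then have "g = of_rat (B / A) * f"
      using A0 by (simp add: mult.assoc[symmetric] of_rat_mult[symmetric])
    then have "x\<^sup>2 = of_rat (p2 - B / A * p) + of_rat (B / A) * x"
      unfolding f_def g_def of_rat_diff of_rat_mult by (simp only: algebra_simps)
    then have "x\<^sup>2 \<in> rat_vs.span {1, x}" unfolding span_1_x by blast
    then show False using nsp by simp
  qed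
  moreover have "z \<in> K" "tr z = 0" using fg t unfolding z_def by (simp_all only: tr_add tr_scale K_add K_mult K_of_rat mult_zero_right add_0)
  ultimately have "tr (z\<^sup>2) > 0" using tr_square_pos[OF deg real] by simp
  also have "tr (z\<^sup>2) = A * gram f g"
    unfolding z_def power2_eq_square[of "_ + _"] tr_bilinear[OF fg]
    by (simp add: gram_def A_def B_def power2_eq_square algebra_simps)
  finally have "gram f g > 0" using A0 by (simp add: zero_less_mult_iff)
  then show ?thesis using fg t span that by blast
qed

text \<open>A pair of trace zero integers with the least positive Gram determinant is a basis.\<close>

lemma L0_basis:
  obtains e1 e2 where "e1 \<in> L0" "e2 \<in> L0" "gram e1 e2 > 0"
    "\<And>y. y \<in> L0 \<Longrightarrow> \<exists>m n. y = of_int m * e1 + of_int n * e2"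
proof -
  obtain f g where fg: "f \<in> K" "g \<in> K" "tr f = 0" "tr g = 0" "gram f g > 0"
    and span: "\<And>y. y \<in> K \<Longrightarrow> tr y = 0 \<Longrightarrow> \<exists>b c. y = of_rat b * f + of_rat c * g"
    using trace_zero_plane by blast
  \<comment> \<open>Gram determinants of trace zero integers are integers, so the positive ones have
    a least element, found here among the natural numbers.\<close>
  define P where "P n \<longleftrightarrow> n > 0 \<and> (\<exists>u\<in>L0. \<exists>v\<in>L0. gram u v = of_nat n)" for n :: nat
  have toP: "P (nat \<lfloor>gram u v\<rfloor>) \<and> of_nat (nat \<lfloor>gram u v\<rfloor>) = gram u v"
    if uv: "u \<in> L0" "v \<in> L0" "gram u v > 0" for u v
  proof -
    obtain k where k: "gram u v = of_int k" using gram_Ints[OF L0_OK[OF uv(1)] L0_OK[OF uv(2)]] by (rule Ints_cases)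
    then have "k > 0" using uv(3) by simp
    then have eq: "of_nat (nat \<lfloor>gram u v\<rfloor>) = gram u v" using k by simp
    have "\<exists>u'\<in>L0. \<exists>v'\<in>L0. gram u' v' = of_nat (nat \<lfloor>gram u v\<rfloor>)"
      by (rule bexI[where x = u], rule bexI[where x = v], rule eq[symmetric]) (rule uv)+
    moreover have "nat \<lfloor>gram u v\<rfloor> > 0" using k \<open>k > 0\<close> by simp
    ultimately show ?thesis using eq unfolding P_def by blast
  qed
  have "\<exists>n. P n"
  proof -
    obtain m :: int where m: "m > 0" "of_int m * f \<in> OK" using multiple_in_OK[OF fg(1)] .
    obtain k :: int where k: "k > 0" "of_int k * g \<in> OK" using multiple_in_OK[OF fg(2)] .
    have "gram (of_int m * f + of_int 0 * g) (of_int 0 * f + of_int k * g) = (of_int (m * k - 0 * 0))\<^sup>2 * gram f g"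
      by (rule gram_transform_int[OF fg(1,2)])
    then have "gram (of_int m * f) (of_int k * g) > 0" using m(1) k(1) fg(5) by simp
    moreover have "of_int m * f \<in> L0" "of_int k * g \<in> L0"
      using m k fg by (simp_all add: L0_iff tr_scale_int)
    ultimately show ?thesis using toP by blast
  qed
  then have "P (Least P)" by (rule LeastI_ex)
  then obtain e1 e2 where e: "e1 \<in> L0" "e2 \<in> L0" "gram e1 e2 = of_nat (Least P)" "Least P > 0"
    unfolding P_def by blast
  have G: "gram e1 e2 > 0" using e by simp
  have minimal: "gram e1 e2 \<le> gram u v" if "u \<in> L0" "v \<in> L0" "gram u v > 0" for u v
  proof -
    have "Least P \<le> nat \<lfloor>gram u v\<rfloor>" using toP[OF that] by (intro Least_le) simp
    then have "(of_nat (Least P) :: rat) \<le> of_nat (nat \<lfloor>gram u v\<rfloor>)" by simp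
    then show ?thesis using toP[OF that] e(3) by simp
  qed
  note eK = L0_K[OF e(1)] L0_K[OF e(2)]
  have rat: "\<exists>q r. y = of_rat q * e1 + of_rat r * e2" if y: "y \<in> L0" for y
  proof -
    obtain b c where yb: "y = of_rat b * f + of_rat c * g" using span L0_K[OF y] L0_tr[OF y] by blast
    obtain \<alpha> \<beta> where e1: "e1 = of_rat \<alpha> * f + of_rat \<beta> * g" using span L0_K[OF e(1)] L0_tr[OF e(1)] by blast
    obtain \<gamma> \<delta> where e2: "e2 = of_rat \<gamma> * f + of_rat \<delta> * g" using span L0_K[OF e(2)] L0_tr[OF e(2)] by blast
    define D where "D = \<alpha> * \<delta> - \<beta> * \<gamma>"
    have "gram e1 e2 = D\<^sup>2 * gram f g" unfolding e1 e2 D_def by (rule gram_transform[OF fg(1,2)])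
    then have D: "D \<noteq> 0" using G by auto
    \<comment> \<open>Cramer's rule in the coordinates with respect to f and g.\<close>
    have 1: "(b * \<delta> - c * \<gamma>) / D * \<alpha> + (c * \<alpha> - b * \<beta>) / D * \<gamma> = b"
      and 2: "(b * \<delta> - c * \<gamma>) / D * \<beta> + (c * \<alpha> - b * \<beta>) / D * \<delta> = c"
      using D by (simp_all add: field_simps) (simp_all add: D_def algebra_simps)
    have "of_rat ((b * \<delta> - c * \<gamma>) / D) * e1 + of_rat ((c * \<alpha> - b * \<beta>) / D) * e2 =
      of_rat ((b * \<delta> - c * \<gamma>) / D * \<alpha> + (c * \<alpha> - b * \<beta>) / D * \<gamma>) * f +
      of_rat ((b * \<delta> - c * \<gamma>) / D * \<beta> + (c * \<alpha> - b * \<beta>) / D * \<delta>) * g"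
      unfolding e1 e2 by (simp only: of_rat_add of_rat_mult ring_distribs mult.assoc add_ac)
    then show ?thesis unfolding 1 2 yb by metis
  qed
  have "\<exists>m n. y = of_int m * e1 + of_int n * e2" if y: "y \<in> L0" for y
  proof -
    obtain q r where qr: "y = of_rat q * e1 + of_rat r * e2" using rat[OF y] by blast
    have fl: "of_rat q * x = of_int \<lfloor>q\<rfloor> * x + of_rat (frac q) * x" for q and x :: 'a
    proof -
      have "q = of_int \<lfloor>q\<rfloor> + frac q" by (simp add: frac_def)
      then have "of_rat q = (of_rat (of_int \<lfloor>q\<rfloor>) + of_rat (frac q) :: 'a)" by (metis of_rat_add)
      then show ?thesis by (simp add: ring_distribs)
    qed
    \<comment> \<open>Replacing e1 by y - floor(q) e1 multiplies the Gram determinant by (frac q)^2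
      < 1, which contradicts minimality unless frac q = 0.\<close>
    have f1: "frac q = 0"
    proof (rule ccontr)
      assume "frac q \<noteq> 0"
      then have fq: "0 < frac q" "frac q < 1" using frac_ge_0[of q] frac_lt_1[of q] by auto
      define y' where "y' = y - of_int \<lfloor>q\<rfloor> * e1"
      have y'L: "y' \<in> L0" unfolding y'_def by (intro L0_diff L0_scale y e)
      have "y' = of_rat (frac q) * e1 + of_rat r * e2" unfolding y'_def qr by (subst fl) simp
      then have g: "gram y' e2 = (frac q)\<^sup>2 * gram e1 e2"
        using gram_transform[OF eK, of "frac q" r 0 1] by simp
      then have "gram y' e2 > 0" using fq G by simp
      then have "gram e1 e2 \<le> (frac q)\<^sup>2 * gram e1 e2" using minimal[OF y'L e(2)] g by simp
      then have "1 \<le> (frac q)\<^sup>2" using G by simp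
      moreover have "(frac q)\<^sup>2 < 1" using fq by (simp add: power_less_one_iff)
      ultimately show False by simp
    qed
    have f2: "frac r = 0"
    proof (rule ccontr)
      assume "frac r \<noteq> 0"
      then have fr: "0 < frac r" "frac r < 1" using frac_ge_0[of r] frac_lt_1[of r] by auto
      define y' where "y' = y - of_int \<lfloor>r\<rfloor> * e2"
      have y'L: "y' \<in> L0" unfolding y'_def by (intro L0_diff L0_scale y e)
      have "y' = of_rat q * e1 + of_rat (frac r) * e2" unfolding y'_def qr by (subst (2) fl) simp
      then have g: "gram e1 y' = (frac r)\<^sup>2 * gram e1 e2"
        using gram_transform[OF eK, of 1 0 q "frac r"] by simp
      then have "gram e1 y' > 0" using fr G by simp
      then have "gram e1 e2 \<le> (frac r)\<^sup>2 * gram e1 e2" using minimal[OF e(1) y'L] g by simp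
      then have "1 \<le> (frac r)\<^sup>2" using G by simp
      moreover have "(frac r)\<^sup>2 < 1" using fr by (simp add: power_less_one_iff)
      ultimately show False by simp
    qed
    have "y = of_int \<lfloor>q\<rfloor> * e1 + of_int \<lfloor>r\<rfloor> * e2"
      unfolding qr fl[of q e1] fl[of r e2] f1 f2 by simp
    then show ?thesis by blast
  qed
  then show ?thesis using e(1,2) G that by blast
qed

text \<open>Putting the vanishing combination in place of u or v makes the Gram determinant 0, while
  the base change formula gives m^2 or n^2 times gram(u, v).\<close>

lemma L0_coords_unique:
  assumes "u \<in> K" "v \<in> K" "gram u v > 0" "of_int m * u + of_int n * v = 0"
  shows "m = 0" "n = 0"
proof -
  have "gram (of_int m * u + of_int n * v) (of_int 0 * u + of_int 1 * v) = (of_int (m * 1 - n * 0))\<^sup>2 * gram u v"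
    by (rule gram_transform_int[OF assms(1,2)])
  then show "m = 0" using assms(3,4) by (simp add: gram_def)
  have "gram (of_int 1 * u + of_int 0 * v) (of_int m * u + of_int n * v) = (of_int (1 * n - 0 * m))\<^sup>2 * gram u v"
    by (rule gram_transform_int[OF assms(1,2)])
  then show "n = 0" using assms(3,4) by (simp add: gram_def)
qed

text \<open>For three eigenvalues of sum 0, half the sum of the squares is minus their second
  elementary symmetric function, an algebraic integer. This accounts for the 2 in the denominator of
  \<open>trace_form\<close>.\<close>

lemma tr_square_even:
  assumes "x \<in> L0"
  shows "tr (x\<^sup>2) / 2 \<in> \<int>"
proof -
  obtain es where es: "of_rat (tr x) = sum_list es" "of_rat (tr (x\<^sup>2)) = (\<Sum>e\<leftarrow>es. e\<^sup>2)" "length es = 3"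
    "\<And>e. e \<in> set es \<Longrightarrow> \<exists>\<phi>. eigenform \<phi> x e"
    using trace_eigenvalues[OF L0_K[OF assms]] deg by metis
  then obtain a b c where abc: "es = [a, b, c]" by (metis (no_types, lifting) length_0_conv length_Suc_conv numeral_3_eq_3)
  have int: "algebraic_int a" "algebraic_int b" "algebraic_int c"
    using es(4) abc eigenform_algebraic_int L0_OK[OF assms] by auto
  have s: "a + b + c = 0" using es(1) L0_tr[OF assms] abc by (simp add: add.assoc)
  have c: "c = - (a + b)" using minus_unique[OF s] by simp
  have "of_rat (tr (x\<^sup>2) / 2) = - (a * b + a * c + b * c)"
    using es(2) abc unfolding c by (simp add: of_rat_divide power2_eq_square algebra_simps)
  then have "algebraic_int (of_rat (tr (x\<^sup>2) / 2) :: complex)"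
    using int by (simp only: algebraic_int_minus_iff algebraic_int_add algebraic_int_mult)
  then have "(of_rat (tr (x\<^sup>2) / 2) :: complex) \<in> \<int>" by (rule rational_algebraic_int_is_int) simp
  then obtain n where "(of_rat (tr (x\<^sup>2) / 2) :: complex) = of_int n" by (rule Ints_cases)
  then have "(of_rat (tr (x\<^sup>2) / 2) :: complex) = of_rat (of_int n)" by simp
  then have "tr (x\<^sup>2) / 2 = of_int n" by (simp only: of_rat_eq_iff)
  then show ?thesis by simp
qed

text \<open>The conditions on \<open>t\<close> are chosen to fit both an element of trace 1 and,
  when all traces are multiples of 3, the element 1.\<close>

lemma integral_basis_from_L0:
  assumes e: "e1 \<in> L0" "e2 \<in> L0" "gram e1 e2 > 0"
    and span: "\<And>y. y \<in> L0 \<Longrightarrow> \<exists>m n. y = of_int m * e1 + of_int n * e2"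
    and t: "t \<in> OK" "tr t \<noteq> 0" "\<And>x. x \<in> OK \<Longrightarrow> \<exists>k::int. x - of_int k * t \<in> L0"
  shows "integral_basis K [t, e1, e2]"
proof -
  note eK = L0_K[OF e(1)] L0_K[OF e(2)]
  have tK: "t \<in> K" using t(1) by (rule OK_K)
  have d12: "e1 \<noteq> e2"
  proof
    assume "e1 = e2"
    then have "gram e1 e2 = 0" by (simp add: gram_def power2_eq_square)
    then show False using e(3) by simp
  qed
  have dt: "t \<noteq> e1" "t \<noteq> e2" using t(2) L0_tr e by auto
  let ?S = "{t, e1, e2}"
  have ind: "int_mod.independent ?S"
  proof
    assume "int_mod.dependent ?S"
    then obtain u where u: "\<exists>v\<in>?S. u v \<noteq> 0" "(\<Sum>v\<in>?S. of_int (u v) * v) = 0"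
      using int_mod.dependent_finite[of ?S] by auto
    have s: "of_int (u t) * t + (of_int (u e1) * e1 + of_int (u e2) * e2) = 0"
      using u(2) d12 dt by simp
    have "tr (of_int (u t) * t + (of_int (u e1) * e1 + of_int (u e2) * e2)) = of_int (u t) * tr t"
      using tK eK L0_tr e by (simp add: tr_add tr_scale_int K_add K_mult)
    then have ut: "u t = 0" using s t(2) by simp
    then have "of_int (u e1) * e1 + of_int (u e2) * e2 = 0" using s by simp
    then have "u e1 = 0" "u e2 = 0" using L0_coords_unique[OF eK e(3)] by blast+
    then show False using ut u(1) by auto
  qed
  have "int_mod.span ?S = OK"
  proof (rule antisym)
    have "int_mod.subspace OK"
      by (rule int_mod.subspaceI) (auto intro: OK_add OK_mult)
    moreover have "?S \<subseteq> OK" using t(1) L0_OK e by auto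
    ultimately show "int_mod.span ?S \<subseteq> OK" by (intro int_mod.span_minimal)
    show "OK \<subseteq> int_mod.span ?S"
    proof
      fix x assume "x \<in> OK"
      then obtain k :: int where k: "x - of_int k * t \<in> L0" using t(3) by blast
      then obtain m n where "x - of_int k * t = of_int m * e1 + of_int n * e2" using span by blast
      then have "x = of_int k * t + (of_int m * e1 + of_int n * e2)" by (simp add: algebra_simps)
      also have "\<dots> \<in> int_mod.span ?S"
        by (intro int_mod.span_add int_mod.span_scale int_mod.span_base) auto
      finally show "x \<in> int_mod.span ?S" .
    qed
  qed
  then show ?thesis using ind d12 dt by (simp add: integral_basis_def)
qed

lemma cubic_discr_formula:
  assumes "integral_basis K [t, e1, e2]"
  shows "of_int (field_discr K) = tr (t\<^sup>2) * gram e1 e2 - (tr (t * e1))\<^sup>2 * tr (e2\<^sup>2) +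
    2 * tr (t * e1) * tr (t * e2) * tr (e1 * e2) - (tr (t * e2))\<^sup>2 * tr (e1\<^sup>2)"
proof -
  have "of_int (field_discr K) = Determinant.det (trace_matrix K [t, e1, e2])"
    by (rule field_discr_eq[OF assms])
  also have "\<dots> =
    tr (t * t) * (tr (e1 * e1) * tr (e2 * e2) - tr (e1 * e2) * tr (e1 * e2)) -
    tr (t * e1) * (tr (t * e1) * tr (e2 * e2) - tr (e1 * e2) * tr (t * e2)) +
    tr (t * e2) * (tr (t * e1) * tr (e1 * e2) - tr (e1 * e1) * tr (t * e2))"
  proof -
    have car: "trace_matrix K [t, e1, e2] \<in> carrier_mat 3 3"
      by (rule carrier_matI) (simp_all add: trace_matrix_def)
    have ent: "trace_matrix K [t, e1, e2] $$ (i, j) = tr ([t, e1, e2] ! i * [t, e1, e2] ! j)"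
      if "i < 3" "j < 3" for i j
      using that by (simp add: trace_matrix_def)
    have sym: "tr (e1 * t) = tr (t * e1)" "tr (e2 * t) = tr (t * e2)" "tr (e2 * e1) = tr (e1 * e2)"
      by (simp_all only: mult.commute)
    have nth: "[t, e1, e2] ! 0 = t" "[t, e1, e2] ! 1 = e1" "[t, e1, e2] ! 2 = e2" by simp_all
    have lt: "0 < (3::nat)" "1 < (3::nat)" "2 < (3::nat)" by simp_all
    show ?thesis by (simp only: det_3x3[OF car] ent[OF lt(1) lt(1)] ent[OF lt(1) lt(2)] ent[OF lt(1) lt(3)]
        ent[OF lt(2) lt(1)] ent[OF lt(2) lt(2)] ent[OF lt(2) lt(3)]
        ent[OF lt(3) lt(1)] ent[OF lt(3) lt(2)] ent[OF lt(3) lt(3)] nth sym)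
  qed
  also have "\<dots> = tr (t\<^sup>2) * gram e1 e2 - (tr (t * e1))\<^sup>2 * tr (e2\<^sup>2) +
    2 * tr (t * e1) * tr (t * e2) * tr (e1 * e2) - (tr (t * e2))\<^sup>2 * tr (e1\<^sup>2)"
  proof -
    have "a * (b * c - x * x) - p * (p * c - x * q) + q * (p * x - b * q) =
      a * (b * c - x\<^sup>2) - p\<^sup>2 * c + 2 * p * q * x - q\<^sup>2 * b" for a b c x p q :: rat
      by (simp add: power2_eq_square algebra_simps)
    then show ?thesis unfolding gram_def power2_eq_square[of t] power2_eq_square[of e1] power2_eq_square[of e2] .
  qed
  finally show ?thesis .
qed

end

context cubic_field
begin

text \<open>If all traces were multiples of 3, then 1, e1, e2 would be an integral basis with
  discriminant 3 gram(e1, e2), and the entries of that Gram determinant, being traces, would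
  contribute another 9. So some trace is prime to 3, and since tr k = 3 k for integers k, a change
  of sign and an integer shift bring it to 1.\<close>

lemma trace_one_element:
  assumes "\<not> 27 dvd field_discr K"
  obtains t where "t \<in> OK" "tr t = 1"
proof -
  have "\<exists>x\<in>OK. \<exists>n::int. tr x = of_int n \<and> \<not> 3 dvd n"
  proof (rule ccontr)
    assume h: "\<not> ?thesis"
    have div3: "\<exists>k::int. tr x = 3 * of_int k" if xOK: "x \<in> OK" for x
    proof -
      obtain n where n: "tr x = of_int n" using trace_algebraic_int[OF xOK] by (rule Ints_cases)
      then have "3 dvd n" using h xOK by blast
      then obtain k where "n = 3 * k" by (rule dvdE)
      then show ?thesis using n by (intro exI[of _ k]) simp
    qed
    obtain e1 e2 where e: "e1 \<in> L0" "e2 \<in> L0" "gram e1 e2 > 0"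
      "\<And>y. y \<in> L0 \<Longrightarrow> \<exists>m n. y = of_int m * e1 + of_int n * e2"
      using L0_basis by blast
    note eOK = L0_OK[OF e(1)] L0_OK[OF e(2)]
    have t1: "tr 1 = 3" by (simp add: tr_1 deg)
    have "integral_basis K [1, e1, e2]"
    proof (rule integral_basis_from_L0[OF e])
      fix x assume x: "x \<in> OK"
      obtain k :: int where "tr x = 3 * of_int k" using div3[OF x] by blast
      then have "x - of_int k * 1 \<in> L0" using x by (simp add: L0_iff OK_diff tr_diff OK_K tr_of_int deg)
      then show "\<exists>k::int. x - of_int k * 1 \<in> L0" by blast
    qed (simp_all add: t1)
    then have "of_int (field_discr K) = 3 * gram e1 e2"
      using cubic_discr_formula[of 1 e1 e2] t1 L0_tr[OF e(1)] L0_tr[OF e(2)] by simp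
    moreover obtain a b c :: int where "tr (e1\<^sup>2) = 3 * of_int a" "tr (e1 * e2) = 3 * of_int b" "tr (e2\<^sup>2) = 3 * of_int c"
      using div3[of "e1\<^sup>2"] div3[of "e1 * e2"] div3[of "e2\<^sup>2"] eOK by (auto simp: OK_mult power2_eq_square)
    ultimately have "rat_of_int (field_discr K) = of_int (27 * (a * c - b\<^sup>2))"
      by (simp add: gram_def power2_eq_square algebra_simps)
    then have "field_discr K = 27 * (a * c - b\<^sup>2)" by (simp only: of_int_eq_iff)
    then show False using assms by simp
  qed
  then obtain x n where x: "x \<in> OK" "tr x = of_int n" "\<not> 3 dvd n" by blast
  from x(3) have "n mod 3 = 1 \<or> n mod 3 = 2" by presburger
  then consider "n mod 3 = 1" | "n mod 3 = 2" by blast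
  then show ?thesis
  proof cases
    case 1
    then obtain k where "n = 3 * k + 1" by (metis mult_div_mod_eq)
    then show ?thesis using x by (intro that[of "x - of_int k"]) (simp_all add: OK_diff tr_diff OK_K tr_of_int deg)
  next
    case 2
    then have "n = 3 * (n div 3 + 1) - 1" by presburger
    then obtain k where "n = 3 * k - 1" by blast
    then show ?thesis using x by (intro that[of "of_int k - x"]) (simp_all add: OK_diff tr_diff OK_K tr_of_int deg)
  qed
qed

text \<open>On trace zero elements, pairing with w = 3 t - 1 is three times pairing with t. Writing
  w in terms of e1 and e2 eliminates t from the discriminant formula and leaves gram(e1, e2) = 3 d.
  The formula for gram(w, y), read modulo 9, shows that 3 divides tr(y^2) when 3 divides d.\<close>

lemma trace_form_lattice:
  assumes nd: "\<not> 27 dvd field_discr K"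
  obtains e1 e2 where "e1 \<in> L0" "e2 \<in> L0" "gram e1 e2 = 3 * of_int (field_discr K)" "gram e1 e2 > 0"
    "\<And>y. y \<in> L0 \<Longrightarrow> \<exists>m n. y = of_int m * e1 + of_int n * e2"
    "\<And>y. y \<in> L0 \<Longrightarrow> 3 dvd field_discr K \<Longrightarrow> \<exists>k::int. tr (y\<^sup>2) = 3 * of_int k"
proof -
  define d where "d = field_discr K"
  obtain e1 e2 where e: "e1 \<in> L0" "e2 \<in> L0" "gram e1 e2 > 0"
    "\<And>y. y \<in> L0 \<Longrightarrow> \<exists>m n. y = of_int m * e1 + of_int n * e2"
    using L0_basis by blast
  note eK = L0_K[OF e(1)] L0_K[OF e(2)]
  obtain t where t: "t \<in> OK" "tr t = 1" using trace_one_element[OF nd] .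
  have tK: "t \<in> K" using t(1) by (rule OK_K)
  have "integral_basis K [t, e1, e2]"
  proof (rule integral_basis_from_L0[OF e t(1)])
    fix x assume x: "x \<in> OK"
    obtain k where k: "tr x = of_int k" using trace_algebraic_int[OF x] by (rule Ints_cases)
    then have "x - of_int k * t \<in> L0" using x t
      by (simp add: L0_iff OK_diff OK_mult tr_diff OK_K K_mult tr_scale_int)
    then show "\<exists>k::int. x - of_int k * t \<in> L0" by blast
  qed (simp_all add: t)
  note dis = cubic_discr_formula[OF this, folded d_def]
  \<comment> \<open>The projection t - 1/3 of t to trace zero, with the denominator cleared.\<close>
  define w where "w = of_int 3 * t - 1"
  have wL: "w \<in> L0"
    using t by (simp add: w_def L0_iff OK_diff OK_mult tr_diff tr_1 deg K_mult OK_K tr_scale_int[of t 3, simplified] OK_of_int[of 3, simplified] K_of_int[of 3, simplified])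
  obtain r s where rs: "w = of_int r * e1 + of_int s * e2" using e(4)[OF wL] by blast
  have tw: "tr (w * y) = 3 * tr (t * y)" if "y \<in> L0" for y
  proof -
    have "w * y = of_int 3 * (t * y) - y" by (simp add: w_def algebra_simps)
    then show ?thesis using tr_diff[of "of_int 3 * (t * y)" y] tr_scale_int[of "t * y" 3] L0_tr[OF that] L0_K[OF that] tK
      by (simp add: K_mult K_of_int[of 3, simplified])
  qed
  define T where "T = tr (t\<^sup>2)"
  have ww: "tr (w\<^sup>2) = 9 * T - 3"
  proof -
    have "w\<^sup>2 = of_int 9 * t\<^sup>2 + (of_int (-6) * t + 1)" by (simp add: w_def power2_eq_square algebra_simps)
    also have "tr \<dots> = of_int 9 * tr (t\<^sup>2) + (of_int (-6) * tr t + tr 1)"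
      using tK by (simp only: tr_add tr_scale_int K_add K_mult K_power K_of_int K_1)
    finally show ?thesis using t by (simp add: T_def tr_1 deg)
  qed
  define A where "A = tr (e1\<^sup>2)"
  define B where "B = tr (e1 * e2)"
  define C where "C = tr (e2\<^sup>2)"
  define p where "p = tr (t * e1)"
  define q where "q = tr (t * e2)"
  define G where "G = gram e1 e2"
  have G: "G = A * C - B\<^sup>2" by (simp add: G_def gram_def A_def B_def C_def)
  have p: "3 * p = of_int r * A + of_int s * B"
    using tr_bilinear[OF eK, of "of_int r" "of_int s" 1 0] tw[OF e(1)] rs by (simp add: p_def A_def B_def)
  have q: "3 * q = of_int r * B + of_int s * C"
    using tr_bilinear[OF eK, of "of_int r" "of_int s" 0 1] tw[OF e(2)] rs by (simp add: q_def C_def B_def)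
  have w2: "9 * T - 3 = (of_int r)\<^sup>2 * A + 2 * of_int r * of_int s * B + (of_int s)\<^sup>2 * C"
    using tr_bilinear[OF eK, of "of_int r" "of_int s" "of_int r" "of_int s"] ww rs
    by (simp add: A_def B_def C_def power2_eq_square)
  have "of_int d = T * G - p\<^sup>2 * C + 2 * p * q * B - q\<^sup>2 * A"
    using dis by (simp add: T_def G_def A_def B_def C_def p_def q_def)
  then have "9 * of_int d = 9 * T * G - (3 * p)\<^sup>2 * C + 2 * (3 * p) * (3 * q) * B - (3 * q)\<^sup>2 * A"
    by (simp add: power2_eq_square algebra_simps)
  also have "\<dots> = 9 * T * G - ((of_int r)\<^sup>2 * A + 2 * of_int r * of_int s * B + (of_int s)\<^sup>2 * C) * G"
    unfolding p q G by (simp add: power2_eq_square algebra_simps)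
  also have "\<dots> = 3 * G" unfolding w2[symmetric] by (simp add: algebra_simps)
  finally have Gd: "G = 3 * of_int d" by simp
  have three: "\<exists>k::int. tr (y\<^sup>2) = 3 * of_int k" if y: "y \<in> L0" and d3: "3 dvd d" for y
  proof -
    obtain m n where mn: "y = of_int m * e1 + of_int n * e2" using e(4)[OF y] by blast
    have g: "gram w y = (of_int (r * n - s * m))\<^sup>2 * (3 * of_int d)"
      unfolding rs mn using gram_transform_int[OF eK, of r s m n] Gd by (simp add: G_def)
    obtain T' where T': "T = of_int T'"
      using trace_algebraic_int[of "t\<^sup>2"] t(1) unfolding T_def by (auto simp: OK_mult power2_eq_square elim: Ints_cases)
    obtain X where X: "tr (y\<^sup>2) = of_int X"
      using trace_algebraic_int[of "y\<^sup>2"] L0_OK[OF y] by (auto simp: OK_mult power2_eq_square elim: Ints_cases)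
    obtain Y where Y: "tr (t * y) = of_int Y"
      using trace_algebraic_int[of "t * y"] L0_OK[OF y] t(1) by (auto simp: OK_mult elim: Ints_cases)
    have "(9 * of_int T' - 3) * of_int X - (3 * of_int Y)\<^sup>2 = (of_int (r * n - s * m))\<^sup>2 * (3 * of_int d :: rat)"
      using g by (simp add: gram_def ww T' X tw[OF y] Y)
    then have "rat_of_int ((9 * T' - 3) * X - (3 * Y)\<^sup>2) = of_int ((r * n - s * m)\<^sup>2 * (3 * d))" by simp
    then have eq: "(9 * T' - 3) * X - (3 * Y)\<^sup>2 = (r * n - s * m)\<^sup>2 * (3 * d)" by (simp only: of_int_eq_iff)
    obtain d' where d': "d = 3 * d'" using d3 by (auto elim: dvdE)
    define E where "E = (r * n - s * m)\<^sup>2"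
    \<comment> \<open>\<open>eq\<close> reads 9 T' X - 3 X - 9 Y^2 = 9 E d'; division by 3 exhibits
      X as a multiple of 3.\<close>
    have "X = 3 * (T' * X - Y\<^sup>2 - E * d')"
      using eq unfolding E_def[symmetric] d' by (simp add: power2_eq_square algebra_simps)
    then have "tr (y\<^sup>2) = 3 * of_int (T' * X - Y\<^sup>2 - E * d')"
      using X by (metis of_int_mult of_int_numeral)
    then show ?thesis by blast
  qed
  show ?thesis
    by (rule that[OF e(1,2) _ e(3,4)]) (use Gd three in \<open>auto simp: G_def d_def\<close>)
qed

end

section \<open>Discriminants of quadratic fields\<close>

context number_field_loc
begin

text \<open>Writing \<open>e\<close> for a generator of the trace zero integers of a quadratic field and \<open>m = e\<^sup>2\<close>,
  the discriminant is \<open>m\<close> or \<open>4 m\<close>; were it divisible by \<open>9\<close>, then \<open>e / 3\<close> would be integral.\<close>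

lemma quadratic_discr_not_dvd_9:
  assumes deg: "field_degree K = 2"
  shows "\<not> 9 dvd field_discr K"
proof -
  obtain x where x: "x \<in> K" "x \<notin> range of_rat" using exists_irrational deg by auto
  define h where "h = tr x / 2"
  define f where "f = x - of_rat h"
  have fK: "f \<in> K" using x by (auto simp: f_def)
  have tf: "tr f = 0" using x by (simp add: f_def h_def tr_diff tr_of_rat deg)
  have f0: "f \<noteq> 0" using x(2) by (auto simp: f_def)
  have nf: "f \<notin> range of_rat" using tr_0_irrational[OF f0 tf] deg by simp
  have multf: "\<exists>b. y = of_rat b * f" if y: "y \<in> K" "tr y = 0" for y
  proof -
    obtain a b where e: "y = of_rat a + of_rat b * f" using quadratic_generated[OF deg fK nf y(1)] .
    have "tr y = a * 2 + b * tr f" unfolding e using fK by (simp add: tr_add tr_scale tr_of_rat deg K_mult)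
    then show ?thesis using y(2) tf e by auto
  qed
  \<comment> \<open>The eigenvalues of f are a and -a with a nonzero, so the quadratic equation of f
    has no linear term and trace zero elements have rational squares.\<close>
  have sq: "\<exists>v. y\<^sup>2 = of_rat v" if y: "y \<in> K" "tr y = 0" for y
  proof -
    obtain u v where uv: "f\<^sup>2 = of_rat v + of_rat u * f" using quadratic_generated[OF deg fK nf, of "f\<^sup>2"] fK by blast
    obtain es where es: "of_rat (tr f) = sum_list es" "length es = 2" "\<And>e. e \<in> set es \<Longrightarrow> \<exists>\<phi>. eigenform \<phi> f e"
      using trace_eigenvalues[OF fK] deg by metis
    then obtain a b where ab: "es = [a, b]" by (metis (no_types, lifting) length_0_conv length_Suc_conv numeral_2_eq_2)
    have b: "b = - a" using es(1) tf ab minus_unique[of a b] by simp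
    have root: "e\<^sup>2 = of_rat v + of_rat u * e" if e: "e \<in> set es" for e
    proof -
      obtain \<phi> where \<phi>: "eigenform \<phi> f e" using es(3)[OF e] by blast
      have ev: "poly (map_poly of_rat [:- v, - u, 1:]) z = z\<^sup>2 - (of_rat v + of_rat u * z)" for z :: "'b::field_char_0"
        by (simp add: map_poly_of_rat_pCons of_rat_minus power2_eq_square algebra_simps)
      have "poly (map_poly of_rat [:- v, - u, 1:]) e = 0"
        by (rule eigenform_root[OF \<phi> fK]) (simp only: ev uv diff_self)
      then show ?thesis unfolding ev by simp
    qed
    have "a\<^sup>2 = of_rat v + of_rat u * a" "b\<^sup>2 = of_rat v + of_rat u * b" using root ab by auto
    then have "of_rat u * a = 0" using b by (simp add: algebra_simps)
    moreover have "a \<noteq> 0"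
      using es(3)[of a] ab eigenform_nonzero[OF _ fK f0] by auto
    ultimately have "u = 0" by simp
    moreover obtain c where "y = of_rat c * f" using multf[OF y] by blast
    ultimately have "y\<^sup>2 = of_rat (c\<^sup>2 * v)" using uv by (simp add: power_mult_distrib of_rat_mult of_rat_power)
    then show ?thesis by blast
  qed
  have sqi: "\<exists>m::int. y\<^sup>2 = of_int m \<and> (y \<noteq> 0 \<longrightarrow> m \<noteq> 0)" if y: "y \<in> L0" for y
  proof -
    obtain v where v: "y\<^sup>2 = of_rat v" using sq[OF L0_K[OF y] L0_tr[OF y]] by blast
    have "of_rat v \<in> OK" using OK_mult[OF L0_OK[OF y] L0_OK[OF y]] v by (simp add: power2_eq_square)
    then have "v \<in> \<int>" by (rule OK_of_rat)
    then obtain m where "v = of_int m" by (rule Ints_cases)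
    then have "y\<^sup>2 = of_int m" using v by simp
    then show ?thesis by (intro exI[of _ m]) auto
  qed
  \<comment> \<open>The absolute value of the square is minimised, since the square is negative in
    an imaginary quadratic field.\<close>
  define P where "P n \<longleftrightarrow> n > 0 \<and> (\<exists>y\<in>L0. y\<^sup>2 = of_int n \<or> y\<^sup>2 = of_int (- n))" for n :: int
  have toP: "P \<bar>m\<bar>" if "y \<in> L0" "y\<^sup>2 = of_int m" "m \<noteq> 0" for y m
  proof -
    have "y\<^sup>2 = of_int \<bar>m\<bar> \<or> y\<^sup>2 = of_int (- \<bar>m\<bar>)" using that(2) by (cases "m \<ge> 0") auto
    then show ?thesis using that unfolding P_def by auto
  qed
  have "\<exists>n::nat. P (int n)"
  proof -
    obtain k :: int where k: "k > 0" "of_int k * f \<in> OK" using multiple_in_OK[OF fK] .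
    then have kL: "of_int k * f \<in> L0" using tf fK by (simp add: L0_iff tr_scale_int)
    then obtain m where "(of_int k * f)\<^sup>2 = of_int m" "m \<noteq> 0" using sqi[OF kL] k f0 by auto
    then have "P \<bar>m\<bar>" using toP kL by blast
    then show ?thesis by (intro exI[of _ "nat \<bar>m\<bar>"]) simp
  qed
  then have least: "P (int (LEAST n. P (int n)))" by (rule LeastI_ex)
  define n where "n = (LEAST n. P (int n))"
  obtain e where e: "e \<in> L0" "e\<^sup>2 = of_int (int n) \<or> e\<^sup>2 = of_int (- int n)" "n > 0"
  proof -
    have "P (int n)" using least by (simp only: n_def)
    then obtain y where "y \<in> L0" "y\<^sup>2 = of_int (int n) \<or> y\<^sup>2 = of_int (- int n)" "int n > 0"
      unfolding P_def by blast
    then show ?thesis by (intro that[of y]) simp_all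
  qed
  obtain m :: int where m: "e\<^sup>2 = of_int m" "\<bar>m\<bar> = int n" using e(2) by (metis abs_minus_cancel abs_of_nat)
  have m0: "m \<noteq> 0" using m(2) e(3) by auto
  have e0: "e \<noteq> 0" using m m0 by auto
  have minimal: "\<bar>m\<bar> \<le> \<bar>k\<bar>" if "y \<in> L0" "y\<^sup>2 = of_int k" "k \<noteq> 0" for y k
  proof -
    have "P (int (nat \<bar>k\<bar>))" using toP[OF that] by simp
    then have "n \<le> nat \<bar>k\<bar>" unfolding n_def by (rule Least_le)
    then show ?thesis using m(2) by linarith
  qed
  have gen: "\<exists>k::int. y = of_int k * e" if y: "y \<in> L0" for y
  proof -
    obtain b where b: "y = of_rat b * f" using multf L0_K[OF y] L0_tr[OF y] by blast
    obtain c where c: "e = of_rat c * f" using multf L0_K[OF e(1)] L0_tr[OF e(1)] by blast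
    have c0: "c \<noteq> 0" using e0 c by auto
    define q where "q = b / c"
    have yq: "y = of_rat q * e" using b c c0 by (simp add: q_def of_rat_mult[symmetric] mult.assoc[symmetric])
    define y' where "y' = y - of_int \<lfloor>q\<rfloor> * e"
    have y'L: "y' \<in> L0" unfolding y'_def by (intro L0_diff L0_scale y e)
    have "of_rat q - of_int \<lfloor>q\<rfloor> = (of_rat (frac q) :: 'a)" by (simp add: frac_def of_rat_diff)
    then have y'q: "y' = of_rat (frac q) * e" unfolding y'_def yq by (metis left_diff_distrib)
    have "y' = 0"
    proof (rule ccontr)
      assume "y' \<noteq> 0"
      then obtain k where k: "y'\<^sup>2 = of_int k" "k \<noteq> 0" using sqi[OF y'L] by blast
      have "(of_rat (of_int k) :: 'a) = of_rat ((frac q)\<^sup>2 * of_int m)"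
        using k(1) m(1) y'q by (simp add: power_mult_distrib of_rat_mult of_rat_power)
      then have "of_int k = (frac q)\<^sup>2 * of_int m" by (simp only: of_rat_eq_iff)
      then have kk: "of_int \<bar>k\<bar> = (frac q)\<^sup>2 * of_int \<bar>m\<bar>" by (simp add: abs_mult)
      have "frac q < 1" "frac q \<ge> 0" by (simp_all add: frac_lt_1 frac_ge_0)
      then have "(frac q)\<^sup>2 < 1" by (simp add: power_less_one_iff)
      then have "(frac q)\<^sup>2 * of_int \<bar>m\<bar> < 1 * of_int \<bar>m\<bar>" using m0 by (intro mult_strict_right_mono) auto
      then have "\<bar>k\<bar> < \<bar>m\<bar>" using kk by (metis mult_1 of_int_less_iff)
      then show False using minimal[OF y'L k] by simp
    qed
    then show ?thesis unfolding y'_def by (intro exI[of _ "\<lfloor>q\<rfloor>"]) simp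
  qed
  have n9: "\<not> 9 dvd m"
  proof
    assume "9 dvd m"
    then obtain j where j: "m = 9 * j" by (auto elim: dvdE)
    \<comment> \<open>For m = 9 j the element e / 3 is a root of X^2 - j, hence a trace zero integer
      with a smaller square than e.\<close>
    have "poly (map_poly of_int [:- j, 0, 1:]) (e / 3) = 0"
      using m(1) j by (simp add: map_poly_pCons power2_eq_square power_divide field_simps)
    moreover have "monic [:- j, 0, 1:]" by simp
    ultimately have "algebraic_int (e / 3)" unfolding algebraic_int_altdef_ipoly by blast
    moreover have "e / 3 \<in> K" using K_divide[OF L0_K[OF e(1)] K_of_int[of 3]] by simp
    moreover have "tr (e / 3) = 0" using tr_scale[of e "1/3"] L0_K[OF e(1)] L0_tr[OF e(1)] by (simp add: of_rat_divide)
    ultimately have eL: "e / 3 \<in> L0" by (simp add: L0_iff ring_of_integers_def)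
    have "(e / 3)\<^sup>2 = of_int j" using m(1) j by (simp add: power_divide)
    then have "\<bar>m\<bar> \<le> \<bar>j\<bar>" using eL m0 j by (intro minimal) auto
    then show False using j m0 by simp
  qed
  have te2: "tr (e\<^sup>2) = 2 * of_int m" using m(1) by (simp add: tr_of_int deg)
  have basis: "integral_basis K [t, e]"
    if t: "t \<in> OK" "tr t \<noteq> 0" and sp: "\<And>x. x \<in> OK \<Longrightarrow> \<exists>k::int. x - of_int k * t \<in> L0" for t
  proof -
    have tK: "t \<in> K" and eK: "e \<in> K" using t(1) OK_K L0_K[OF e(1)] by auto
    have te: "t \<noteq> e" using t(2) L0_tr[OF e(1)] by auto
    have ind: "int_mod.independent {t, e}"
    proof
      assume "int_mod.dependent {t, e}"
      then obtain u where u: "\<exists>v\<in>{t, e}. u v \<noteq> 0" "(\<Sum>v\<in>{t, e}. of_int (u v) * v) = 0"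
        using int_mod.dependent_finite[of "{t, e}"] by auto
      have s: "of_int (u t) * t + of_int (u e) * e = 0" using u(2) te by simp
      have "tr (of_int (u t) * t + of_int (u e) * e) = of_int (u t) * tr t"
        using tK eK L0_tr[OF e(1)] by (simp add: tr_add tr_scale_int K_mult)
      then have "u t = 0" using s t(2) by simp
      then show False using s u(1) e0 by auto
    qed
    have "int_mod.span {t, e} = OK"
    proof (rule antisym)
      have "int_mod.subspace OK" by (rule int_mod.subspaceI) (auto intro: OK_add OK_mult)
      moreover have "{t, e} \<subseteq> OK" using t(1) L0_OK[OF e(1)] by auto
      ultimately show "int_mod.span {t, e} \<subseteq> OK" by (intro int_mod.span_minimal)
      show "OK \<subseteq> int_mod.span {t, e}"
      proof
        fix x assume "x \<in> OK"
        then obtain k :: int where k: "x - of_int k * t \<in> L0" using sp by blast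
        then obtain j where "x - of_int k * t = of_int j * e" using gen by blast
        then have "x = of_int k * t + of_int j * e" by (simp add: algebra_simps)
        also have "\<dots> \<in> int_mod.span {t, e}"
          by (intro int_mod.span_add int_mod.span_scale int_mod.span_base) auto
        finally show "x \<in> int_mod.span {t, e}" .
      qed
    qed
    then show ?thesis using ind te by (simp add: integral_basis_def)
  qed
  have discr: "of_int (field_discr K) = tr (t\<^sup>2) * tr (e\<^sup>2) - (tr (t * e))\<^sup>2" if "integral_basis K [t, e]" for t
  proof -
    have car: "trace_matrix K [t, e] \<in> carrier_mat 2 2" by (rule carrier_matI) (simp_all add: trace_matrix_def)
    have "of_int (field_discr K) = tr (t * t) * tr (e * e) - tr (t * e) * tr (e * t)"
      unfolding field_discr_eq[OF that] by (subst det_2x2[OF car]) (simp add: trace_matrix_def)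
    then show ?thesis by (simp add: power2_eq_square mult.commute[of e t])
  qed
  show ?thesis
  \<comment> \<open>If all traces are even, 1 and e form an integral basis and the discriminant is 4
    m; otherwise some t has trace 1, and the basis t, e gives m.\<close>
  proof (cases "\<exists>x\<in>OK. \<exists>n::int. tr x = of_int n \<and> odd n")
    case False
    have "\<exists>k::int. x - of_int k * 1 \<in> L0" if x: "x \<in> OK" for x
    proof -
      obtain n where n: "tr x = of_int n" using trace_algebraic_int[OF x] by (rule Ints_cases)
      then have "even n" using False x by blast
      then obtain k where "n = 2 * k" by (rule evenE)
      then have "x - of_int k * 1 \<in> L0" using x n by (simp add: L0_iff OK_diff tr_diff OK_K tr_of_int deg)
      then show ?thesis by blast
    qed
    then have "integral_basis K [1, e]" by (intro basis) (simp_all add: tr_1 deg)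
    then have "rat_of_int (field_discr K) = of_int (4 * m)"
      using discr[of 1] te2 L0_tr[OF e(1)] by (simp add: tr_1 deg)
    then have "field_discr K = 4 * m" by (simp only: of_int_eq_iff)
    moreover have "9 dvd 4 * m \<longleftrightarrow> 9 dvd m"
      by presburger
    ultimately show ?thesis using n9 by simp
  next
    case True
    then obtain x n where x: "x \<in> OK" "tr x = of_int n" "odd n" by blast
    then obtain j where j: "n = 2 * j + 1" by (auto elim: oddE)
    define t where "t = x - of_int j"
    have t: "t \<in> OK" "tr t = 1" using x j by (simp_all add: t_def OK_diff tr_diff OK_K tr_of_int deg)
    have tK: "t \<in> K" using t(1) by (rule OK_K)
    have "integral_basis K [t, e]"
    proof (rule basis[OF t(1)])
      fix x assume x: "x \<in> OK"
      obtain k where k: "tr x = of_int k" using trace_algebraic_int[OF x] by (rule Ints_cases)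
      then have "x - of_int k * t \<in> L0" using x t
        by (simp add: L0_iff OK_diff OK_mult tr_diff OK_K K_mult tr_scale_int)
      then show "\<exists>k::int. x - of_int k * t \<in> L0" by blast
    qed (simp add: t)
    note dis = discr[OF this]
    \<comment> \<open>A trace zero integer, hence a multiple of e; as in the cubic case it
      eliminates t from the discriminant.\<close>
    define w where "w = of_int 2 * t - 1"
    have tw: "tr w = 0" using tr_diff[of "of_int 2 * t" 1] tr_scale_int[OF tK, of 2] tK t(2) K_mult[OF K_of_int[of 2] tK]
      by (simp add: w_def tr_1 deg)
    have "w \<in> OK" unfolding w_def using t(1) by (intro OK_diff OK_mult OK_of_int OK_1)
    then obtain k where k: "w = of_int k * e" using gen tw by (auto simp: L0_iff)
    have 1: "2 * tr (t * e) = of_int k * (2 * of_int m)"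
    proof -
      have "w * e = of_int 2 * (t * e) - e" by (simp add: w_def algebra_simps)
      then have "tr (w * e) = of_int 2 * tr (t * e) - tr e"
        using tK L0_K[OF e(1)] by (simp only: tr_diff tr_scale_int K_mult K_of_int)
      moreover have "tr (w * e) = of_int k * tr (e\<^sup>2)"
        using tr_scale_int[of "e\<^sup>2" k] L0_K[OF e(1)] by (simp add: k power2_eq_square mult.assoc K_mult)
      ultimately show ?thesis using te2 L0_tr[OF e(1)] by simp
    qed
    have 2: "4 * tr (t\<^sup>2) - 2 = (of_int k)\<^sup>2 * (2 * of_int m)"
    proof -
      have "w\<^sup>2 = of_int 4 * t\<^sup>2 + (of_int (-4) * t + 1)" by (simp add: w_def power2_eq_square algebra_simps)
      then have "tr (w\<^sup>2) = of_int 4 * tr (t\<^sup>2) + (of_int (-4) * tr t + tr 1)"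
        using tK by (simp only: tr_add tr_scale_int K_add K_mult K_power K_of_int K_1)
      moreover have "tr (w\<^sup>2) = of_int (k\<^sup>2) * tr (e\<^sup>2)"
        using tr_scale_int[of "e\<^sup>2" "k\<^sup>2"] L0_K[OF e(1)] by (simp add: k power_mult_distrib K_power)
      ultimately show ?thesis using te2 t(2) by (simp add: tr_1 deg)
    qed
    have "4 * of_int (field_discr K) = 4 * tr (t\<^sup>2) * (2 * of_int m) - (2 * tr (t * e))\<^sup>2"
      using dis te2 by (simp add: power_mult_distrib)
    also have "\<dots> = ((of_int k)\<^sup>2 * (2 * of_int m) + 2) * (2 * of_int m) - (of_int k * (2 * of_int m))\<^sup>2"
      using 1 2 by (simp add: algebra_simps)
    also have "\<dots> = 4 * of_int m" by (simp add: power2_eq_square algebra_simps)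
    finally have "rat_of_int (field_discr K) = of_int m" by simp
    then have "field_discr K = m" by (simp only: of_int_eq_iff)
    then show ?thesis using n9 by simp
  qed
qed

end

lemma fundamental_discriminant_not_dvd_27:
  assumes "fundamental_discriminant d"
  shows "\<not> 27 dvd d"
proof -
  obtain F :: "complex set" where F: "number_field F" "field_degree F = 2" "d = field_discr F"
    using assms by (auto simp: fundamental_discriminant_def)
  interpret number_field_loc F by unfold_locales (rule F(1))
  have "\<not> 9 dvd d" using quadratic_discr_not_dvd_9[OF F(2)] F(3) by simp
  then show ?thesis by presburger
qed

section \<open>The trace form as an integral binary form, and the conclusion\<close>

text \<open>On trace zero integers tr(y^2) is divisible by 2 and, if 3 divides d, also by 3, so
  division by 2 g leaves integers. The middle coefficient comes from polarising with e1 + e2, the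
  discriminant from gram(e1, e2) = 3 d.\<close>

lemma (in cubic_field) trace_form_bqf:
  assumes nd: "\<not> 27 dvd field_discr K" and g: "g = gcd 3 (field_discr K)"
  obtains e1 e2 a b c where "e1 \<in> L0" "e2 \<in> L0" "gram e1 e2 > 0"
    "\<And>y. y \<in> L0 \<Longrightarrow> \<exists>m n. y = of_int m * e1 + of_int n * e2"
    "\<And>m n. trace_form K (of_int m * e1 + of_int n * e2) = of_int (bqf a b c m n)"
    "a > 0" "g\<^sup>2 * (4 * a * c - b\<^sup>2) = 3 * field_discr K" "field_discr K > 0"
proof -
  define d where "d = field_discr K"
  obtain e1 e2 where e: "e1 \<in> L0" "e2 \<in> L0" "gram e1 e2 = 3 * of_int d" "gram e1 e2 > 0"
    "\<And>y. y \<in> L0 \<Longrightarrow> \<exists>m n. y = of_int m * e1 + of_int n * e2"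
    "\<And>y. y \<in> L0 \<Longrightarrow> 3 dvd d \<Longrightarrow> \<exists>k::int. tr (y\<^sup>2) = 3 * of_int k"
    using trace_form_lattice[OF nd] unfolding d_def by blast
  note eK = L0_K[OF e(1)] L0_K[OF e(2)]
  have d: "d > 0" using e(3,4) by simp
  have g: "g = (if 3 dvd d then 3 else 1)"
  proof (cases "3 dvd d")
    case False
    have "prime (3::int)" by simp
    then have "coprime 3 d" using False by (rule prime_imp_coprime)
    then show ?thesis using False g d_def by (simp add: coprime_iff_gcd_eq_1)
  next
    case True
    then show ?thesis using g d_def by (simp add: gcd_proj1_if_dvd)
  qed
  have sq: "\<exists>k::int. tr (y\<^sup>2) = 2 * of_int g * of_int k" if y: "y \<in> L0" for y
  proof -
    obtain j where j: "tr (y\<^sup>2) / 2 = of_int j" using tr_square_even[OF y] by (rule Ints_cases)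
    show ?thesis
    proof (cases "3 dvd d")
      case False
      then show ?thesis using j g by (intro exI[of _ j]) simp
    next
      case True
      then obtain k where k: "tr (y\<^sup>2) = 3 * of_int k" using e(6)[OF y] by blast
      then have "rat_of_int (3 * k) = of_int (2 * j)" using j by simp
      then have "3 * k = 2 * j" by (simp only: of_int_eq_iff)
      then obtain i where "k = 2 * i" by (metis dvd_triv_left even_mult_iff evenE odd_numeral)
      then show ?thesis using k g True by (intro exI[of _ i]) simp
    qed
  qed
  obtain a where a: "tr (e1\<^sup>2) = 2 * of_int g * of_int a" using sq[OF e(1)] by blast
  obtain c where c: "tr (e2\<^sup>2) = 2 * of_int g * of_int c" using sq[OF e(2)] by blast
  obtain s where s: "tr ((e1 + e2)\<^sup>2) = 2 * of_int g * of_int s" using sq[OF L0_add[OF e(1,2)]] by blast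
  define b where "b = s - a - c"
  have "tr ((e1 + e2)\<^sup>2) = tr (e1\<^sup>2) + 2 * tr (e1 * e2) + tr (e2\<^sup>2)"
    using tr_bilinear[OF eK, of 1 1 1 1] by (simp add: power2_eq_square)
  then have b: "tr (e1 * e2) = of_int g * of_int b"
    using a c s by (simp add: b_def algebra_simps)
  have g0: "g > 0" using g by simp
  have form: "trace_form K (of_int m * e1 + of_int n * e2) = of_int (bqf a b c m n)" for m n
  proof -
    have "tr ((of_int m * e1 + of_int n * e2)\<^sup>2) = (of_int m)\<^sup>2 * tr (e1\<^sup>2) + 2 * of_int m * of_int n * tr (e1 * e2) + (of_int n)\<^sup>2 * tr (e2\<^sup>2)"
      using tr_bilinear[OF eK, of "of_int m" "of_int n" "of_int m" "of_int n"] by (simp add: power2_eq_square)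
    also have "\<dots> = of_int (2 * g) * of_int (bqf a b c m n)"
      unfolding a b c by (simp add: bqf_def power2_eq_square algebra_simps)
    finally show ?thesis
      unfolding trace_form_def assms(2)[symmetric] using g0 by simp
  qed
  have "e1 \<noteq> 0"
  proof
    assume "e1 = 0"
    then show False using e(4) by (simp add: gram_def)
  qed
  then have "tr (e1\<^sup>2) > 0" using tr_square_pos[OF deg real eK(1) L0_tr[OF e(1)]] by simp
  then have "a > 0" using a g0 by (simp add: zero_less_mult_iff)
  moreover have "g\<^sup>2 * (4 * a * c - b\<^sup>2) = 3 * d"
  proof -
    have "rat_of_int (g\<^sup>2 * (4 * a * c - b\<^sup>2)) = of_int (3 * d)"
      using e(3) unfolding gram_def a b c by (simp add: power2_eq_square algebra_simps)
    then show ?thesis by (simp only: of_int_eq_iff)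
  qed
  ultimately show ?thesis using that[OF e(1,2,4,5) form] d unfolding d_def by blast
qed

theorem corollary3p6:
  fixes K :: "'a::field_char_0 set" and d d\<^sub>3 :: int
  assumes "number_field K" and "field_degree K = 3" and "totally_real K"
    and "d = field_discr K" and "fundamental_discriminant d"
    and "d\<^sub>3 = - ((3 * d) div (gcd 3 d)\<^sup>2)"
  shows "trace_theta K \<in> modular_forms 1 \<bar>d\<^sub>3\<bar> (\<lambda>n. of_int (kronecker d\<^sub>3 n))"
proof -
  interpret cubic_field K using assms(1-3) by unfold_locales
  have nd: "\<not> 27 dvd field_discr K" using fundamental_discriminant_not_dvd_27 assms(4,5) by simp
  define g where "g = gcd 3 d"
  have g0: "g > 0" by (simp add: g_def)
  obtain e1 e2 a b c where e: "e1 \<in> L0" "e2 \<in> L0" "gram e1 e2 > 0"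
    and span: "\<And>y. y \<in> L0 \<Longrightarrow> \<exists>m n. y = of_int m * e1 + of_int n * e2"
    and form: "\<And>m n. trace_form K (of_int m * e1 + of_int n * e2) = of_int (bqf a b c m n)"
    and abc: "a > 0" "g\<^sup>2 * (4 * a * c - b\<^sup>2) = 3 * d" "d > 0"
    using trace_form_bqf[OF nd refl] unfolding g_def assms(4) by blast
  define N where "N = 4 * a * c - b\<^sup>2"
  \<comment> \<open>The division in the definition of \<open>d\<^sub>3\<close> is exact, because 3 d
    = g^2 N.\<close>
  have "(3 * d) div g\<^sup>2 = N" using abc(2) g0 by (simp add: N_def flip: abc(2))
  then have d3: "d\<^sub>3 = - N" using assms(6) by (simp add: g_def)
  have "g\<^sup>2 * N > 0" using abc by (simp add: N_def)
  then have N0: "N > 0" using g0 by (simp add: zero_less_mult_iff)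
  interpret posdef_bqf a b c N by unfold_locales (use abc N_def N0 in auto)
  have inj: "inj (\<lambda>(m, n). of_int m * e1 + of_int n * e2)"
  proof (rule injI, clarify)
    fix m n m' n' :: int
    assume "of_int m * e1 + of_int n * e2 = of_int m' * e1 + of_int n' * e2"
    then have eq: "of_int (m - m') * e1 + of_int (n - n') * e2 = 0" by (simp add: algebra_simps)
    show "m = m' \<and> n = n'" using L0_coords_unique[OF L0_K[OF e(1)] L0_K[OF e(2)] e(3) eq] by simp
  qed
  have bij: "bij_betw (\<lambda>(m, n). of_int m * e1 + of_int n * e2) UNIV L0"
    unfolding bij_betw_def
  proof (intro conjI equalityI subsetI)
    fix y assume "y \<in> range (\<lambda>(m, n). of_int m * e1 + of_int n * e2)"
    then show "y \<in> L0" using e(1,2) by (auto intro: L0_add L0_scale)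
  next
    fix y assume "y \<in> L0"
    then obtain m n where "y = of_int m * e1 + of_int n * e2" using span by blast
    then show "y \<in> range (\<lambda>(m, n). of_int m * e1 + of_int n * e2)"
      by (intro image_eqI[of _ _ "(m, n)"]) simp_all
  qed (fact inj)
  have "trace_theta K = bqf_theta a b c"
  proof
    fix z
    have "trace_theta K z = (\<Sum>\<^sub>\<infinity>p\<in>UNIV. exp (2 * of_real pi * \<i> * of_rat (trace_form K (case p of (m, n) \<Rightarrow> of_int m * e1 + of_int n * e2)) * z))"
      unfolding trace_theta_def by (rule infsum_reindex_bij_betw[OF bij, symmetric])
    also have "\<dots> = bqf_theta a b c z"
      unfolding bqf_theta_def by (intro infsum_cong) (auto simp: form ee_def mult.assoc)
    finally show "trace_theta K z = bqf_theta a b c z" .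
  qed
  then show ?thesis using bqf_theta_modular N0 by (simp add: d3)
qed

end
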